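(* Let $A$ be an operator algebra (not necessarily approximately unital), and let $q$ be a closed projection in $(A^1)^{**}$. If $b \in A$ with $bq = qb$, then $b$ achieves its distance to the right ideal $J = \{ a \in A : qa = 0 \}$ (that is, there exists $y \in J$ with $\Vert b - y \Vert = \inf\{\Vert b - z \Vert : z \in J\}$). If further $\Vert bq \Vert \leq 1$, then there exists an element $g \in A$ with $\Vert g \Vert \leq 1$ and $gq = qg = bq$.
   Context: An operator algebra is a norm closed algebra $A$ of operators on a Hilbert space $H$, not assumed to have an identity; it is approximately unital if it has a contractive approximate identity. The unitization $A^1$ equals $A$ if $A$ has an identity of norm $1$, and otherwise is $A + \mathbb{C} I_H$ (by a theorem of Meyer it does not depend on the completely isometric representation); $1$ is the identity of $A^1$. The bidual $(A^1)^{**}$ is an operator algebra with its (unique) Arens product; if $A^1$ is a subalgebra of a $C^*$-algebra $B$, then $(A^1)^{**} \cong (A^1)^{\perp\perp} \subset B^{**}$ with the product of the von Neumann algebra $B^{**}$. A projection means an orthogonal (self-adjoint) projection. A projection $p \in (A^1)^{**}$ is open if there is a net $(x_t)$ in $A^1$ with $x_t = p x_t \to p$ weak*. A projection $q \in (A^1)^{**}$ is closed if $1 - q$ is open. *)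

theory Defs
  imports "HOL-Analysis.Analysis" "HOL-Library.FuncSet"
begin

section \<open>Complex Hilbert spaces and their bounded operators\<close>

text \<open>A complex Hilbert space is a complete real inner product space with a complex scalar
  multiplication and a sesquilinear form whose real part is the given real inner product.
  Positivity of \<open>cinner\<close> and \<open>norm x = sqrt (Re (cinner x x))\<close> are inherited from
  the class \<open>real_inner\<close>. The form is linear in the first variable.\<close>

class complex_hilbert_space = real_inner + complete_space +
  fixes scaleC :: "complex \<Rightarrow> 'a \<Rightarrow> 'a" (infixr "*\<^sub>C" 75)
    and cinner :: "'a \<Rightarrow> 'a \<Rightarrow> complex"
  assumes scaleC_add_right: "c *\<^sub>C (x + y) = c *\<^sub>C x + c *\<^sub>C y"
    and scaleC_add_left: "(c + d) *\<^sub>C x = c *\<^sub>C x + d *\<^sub>C x"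
    and scaleC_scaleC: "c *\<^sub>C (d *\<^sub>C x) = (c * d) *\<^sub>C x"
    and scaleC_of_real: "complex_of_real r *\<^sub>C x = r *\<^sub>R x"
    and cinner_commute: "cinner x y = cnj (cinner y x)"
    and cinner_add_left: "cinner (x + y) z = cinner x z + cinner y z"
    and cinner_scaleC_left: "cinner (c *\<^sub>C x) y = c * cinner x y"
    and Re_cinner: "Re (cinner x y) = inner x y"

lemma norm_scaleC: "norm (c *\<^sub>C x) = cmod c * norm (x :: 'a :: complex_hilbert_space)"
proof -
  have "cinner (c *\<^sub>C x) (c *\<^sub>C x) = (c * cnj c) * cinner x x"
    by (metis (no_types, lifting) cinner_commute cinner_scaleC_left complex_cnj_mult mult.assoc
        mult.commute)
  also have "c * cnj c = complex_of_real ((cmod c)\<^sup>2)"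
    by (rule complex_norm_square [symmetric])
  finally have "Re (cinner (c *\<^sub>C x) (c *\<^sub>C x)) = (cmod c)\<^sup>2 * Re (cinner x x)"
    by simp
  then have "(norm (c *\<^sub>C x))\<^sup>2 = (cmod c * norm x)\<^sup>2"
    by (simp add: Re_cinner power2_norm_eq_inner power_mult_distrib)
  then show ?thesis
    by (simp add: power2_eq_iff_nonneg)
qed

lemma bounded_linear_scaleC: "bounded_linear (\<lambda>x :: 'a :: complex_hilbert_space. c *\<^sub>C x)"
proof (rule bounded_linear_intro [where K = "cmod c"])
  fix r and x :: 'a
  show "c *\<^sub>C (r *\<^sub>R x) = r *\<^sub>R (c *\<^sub>C x)"
    by (metis mult.commute scaleC_of_real scaleC_scaleC)
qed (simp_all add: scaleC_add_right norm_scaleC mult.commute)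

text \<open>The type of bounded \<open>\<real>\<close>-linear operators carries the operator norm;
  \<open>B(H)\<close> is the subset of its \<open>\<complex>\<close>-linear elements.\<close>

definition BH :: "('h :: complex_hilbert_space \<Rightarrow>\<^sub>L 'h) set" where
  "BH = {T. \<forall>c x. blinfun_apply T (c *\<^sub>C x) = c *\<^sub>C blinfun_apply T x}"

lift_definition op_scaleC ::
    "complex \<Rightarrow> ('h :: complex_hilbert_space \<Rightarrow>\<^sub>L 'h) \<Rightarrow> ('h \<Rightarrow>\<^sub>L 'h)"
  is "\<lambda>c f x. c *\<^sub>C f x"
  by (rule bounded_linear_compose [OF bounded_linear_scaleC])

definition op_adj :: "('h :: complex_hilbert_space \<Rightarrow>\<^sub>L 'h) \<Rightarrow> ('h \<Rightarrow>\<^sub>L 'h)" where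
  "op_adj T = (THE S. \<forall>x y.
     cinner (blinfun_apply T x) y = cinner x (blinfun_apply S y))"


section \<open>Operator algebras and their unitizations\<close>

definition operator_algebra :: "('h :: complex_hilbert_space \<Rightarrow>\<^sub>L 'h) set \<Rightarrow> bool" where
  "operator_algebra A \<longleftrightarrow>
     A \<subseteq> BH \<and> closed A \<and> 0 \<in> A \<and>
     (\<forall>a\<in>A. \<forall>b\<in>A. a + b \<in> A) \<and>
     (\<forall>c. \<forall>a\<in>A. op_scaleC c a \<in> A) \<and>
     (\<forall>a\<in>A. \<forall>b\<in>A. a o\<^sub>L b \<in> A)"

definition is_identity ::
    "('h :: complex_hilbert_space \<Rightarrow>\<^sub>L 'h) set \<Rightarrow> ('h \<Rightarrow>\<^sub>L 'h) \<Rightarrow> bool" where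
  "is_identity A e \<longleftrightarrow> e \<in> A \<and> (\<forall>a\<in>A. e o\<^sub>L a = a \<and> a o\<^sub>L e = a)"

definition unitization ::
    "('h :: complex_hilbert_space \<Rightarrow>\<^sub>L 'h) set \<Rightarrow> ('h \<Rightarrow>\<^sub>L 'h) set" where
  "unitization A =
     (if \<exists>e. is_identity A e \<and> norm e = 1 then A
      else {a + op_scaleC c id_blinfun | a c. a \<in> A})"

definition identity_of ::
    "('h :: complex_hilbert_space \<Rightarrow>\<^sub>L 'h) set \<Rightarrow> ('h \<Rightarrow>\<^sub>L 'h)" where
  "identity_of S = (THE e. is_identity S e)"


section \<open>Dual and bidual of a space of operators\<close>

text \<open>\<open>S\<close> is a linear subspace of \<open>B(H)\<close>. Functionals on \<open>S\<close> and on its dual are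
  extensional functions, so that equality of functions is equality of functionals.\<close>

type_synonym 'h functional = "('h \<Rightarrow>\<^sub>L 'h) \<Rightarrow> complex"
type_synonym 'h bifunctional = "'h functional \<Rightarrow> complex"

definition dual :: "('h :: complex_hilbert_space \<Rightarrow>\<^sub>L 'h) set \<Rightarrow> 'h functional set"
  where
  "dual S = {\<phi> \<in> extensional S.
     (\<forall>x\<in>S. \<forall>y\<in>S. \<phi> (x + y) = \<phi> x + \<phi> y) \<and>
     (\<forall>c. \<forall>x\<in>S. \<phi> (op_scaleC c x) = c * \<phi> x) \<and>
     (\<exists>K. \<forall>x\<in>S. cmod (\<phi> x) \<le> K * norm x)}"

definition dual_norm ::
    "('h :: complex_hilbert_space \<Rightarrow>\<^sub>L 'h) set \<Rightarrow> 'h functional \<Rightarrow> real" where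
  "dual_norm S \<phi> = (SUP x\<in>{x \<in> S. norm x \<le> 1}. cmod (\<phi> x))"

definition bidual ::
    "('h :: complex_hilbert_space \<Rightarrow>\<^sub>L 'h) set \<Rightarrow> 'h bifunctional set" where
  "bidual S = {\<Phi> \<in> extensional (dual S).
     (\<forall>\<phi>\<in>dual S. \<forall>\<psi>\<in>dual S. \<Phi> (\<lambda>x\<in>S. \<phi> x + \<psi> x) = \<Phi> \<phi> + \<Phi> \<psi>) \<and>
     (\<forall>c. \<forall>\<phi>\<in>dual S. \<Phi> (\<lambda>x\<in>S. c * \<phi> x) = c * \<Phi> \<phi>) \<and>
     (\<exists>K. \<forall>\<phi>\<in>dual S. cmod (\<Phi> \<phi>) \<le> K * dual_norm S \<phi>)}"

definition bidual_norm ::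
    "('h :: complex_hilbert_space \<Rightarrow>\<^sub>L 'h) set \<Rightarrow> 'h bifunctional \<Rightarrow> real" where
  "bidual_norm S \<Phi> = (SUP \<phi>\<in>{\<phi> \<in> dual S. dual_norm S \<phi> \<le> 1}. cmod (\<Phi> \<phi>))"

definition bidual_zero ::
    "('h :: complex_hilbert_space \<Rightarrow>\<^sub>L 'h) set \<Rightarrow> 'h bifunctional" where
  "bidual_zero S = (\<lambda>\<phi>\<in>dual S. 0)"

definition bidual_diff ::
    "('h :: complex_hilbert_space \<Rightarrow>\<^sub>L 'h) set \<Rightarrow> 'h bifunctional
     \<Rightarrow> 'h bifunctional \<Rightarrow> 'h bifunctional" where
  "bidual_diff S \<Phi> \<Psi> = (\<lambda>\<phi>\<in>dual S. \<Phi> \<phi> - \<Psi> \<phi>)"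

text \<open>The canonical embedding of \<open>S\<close> into its bidual.\<close>

definition canon ::
    "('h :: complex_hilbert_space \<Rightarrow>\<^sub>L 'h) set \<Rightarrow> ('h \<Rightarrow>\<^sub>L 'h)
     \<Rightarrow> 'h bifunctional" where
  "canon S x = (\<lambda>\<phi>\<in>dual S. \<phi> x)"

text \<open>The first Arens product. For \<open>a\<close> in \<open>S\<close>, \<open>\<phi>\<close> in the dual and \<open>\<Psi>\<close> in the bidual,
  \<open>(\<phi> \<cdot> a)(b) = \<phi>(ab)\<close> and \<open>(\<Psi> \<cdot> \<phi>)(a) = \<Psi>(\<phi> \<cdot> a)\<close>; the product of \<open>\<Phi>\<close> and \<open>\<Psi>\<close>
  is \<open>\<phi> \<mapsto> \<Phi>(\<Psi> \<cdot> \<phi>)\<close>. Operator algebras are Arens regular, so the second Arens product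
  is the same.\<close>

definition arens ::
    "('h :: complex_hilbert_space \<Rightarrow>\<^sub>L 'h) set \<Rightarrow> 'h bifunctional
     \<Rightarrow> 'h bifunctional \<Rightarrow> 'h bifunctional" where
  "arens S \<Phi> \<Psi> = (\<lambda>\<phi>\<in>dual S. \<Phi> (\<lambda>a\<in>S. \<Psi> (\<lambda>b\<in>S. \<phi> (a o\<^sub>L b))))"


section \<open>Open and closed projections\<close>

text \<open>The canonical map from the bidual of a subspace \<open>S\<close> of \<open>B(H)\<close> onto the second
  annihilator of \<open>S\<close> in \<open>B(H)**\<close>: the second transpose of the inclusion map.\<close>

definition bidual_incl ::
    "('h :: complex_hilbert_space \<Rightarrow>\<^sub>L 'h) set \<Rightarrow> 'h bifunctional
     \<Rightarrow> 'h bifunctional" where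
  "bidual_incl S \<Phi> = (\<lambda>\<phi>\<in>dual BH. \<Phi> (restrict \<phi> S))"

text \<open>The involution of the von Neumann algebra \<open>B(H)**\<close>: \<open>\<Phi>*(\<phi>)\<close> is the conjugate of
  \<open>\<Phi>(\<phi>*)\<close>, where \<open>\<phi>*(T)\<close> is the conjugate of \<open>\<phi>(T*)\<close>.\<close>

definition bidual_star ::
    "('h :: complex_hilbert_space) bifunctional
     \<Rightarrow> 'h bifunctional" where
  "bidual_star \<Phi> = (\<lambda>\<phi>\<in>dual BH. cnj (\<Phi> (\<lambda>T\<in>BH. cnj (\<phi> (op_adj T)))))"

text \<open>A projection in the bidual of a subalgebra \<open>S\<close> of \<open>B(H)\<close> is a self-adjoint
  idempotent, self-adjointness being taken in \<open>B(H)**\<close>.\<close>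

definition projection ::
    "('h :: complex_hilbert_space \<Rightarrow>\<^sub>L 'h) set \<Rightarrow> 'h bifunctional \<Rightarrow> bool"
  where
  "projection S p \<longleftrightarrow>
     p \<in> bidual S \<and> arens S p p = p \<and> bidual_star (bidual_incl S p) = bidual_incl S p"

text \<open>A net in \<open>S\<close> is rendered by a proper filter on the space of operators (the
  filter of sets in which the net eventually lies); weak* convergence is convergence
  against every functional in the dual of \<open>S\<close>.\<close>

definition open_projection ::
    "('h :: complex_hilbert_space \<Rightarrow>\<^sub>L 'h) set \<Rightarrow> 'h bifunctional \<Rightarrow> bool"
  where
  "open_projection S p \<longleftrightarrow> projection S p \<and>
     (\<exists>F. F \<noteq> bot \<and>
        (\<forall>\<^sub>F x in F. x \<in> S \<and> arens S p (canon S x) = canon S x) \<and>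
        (\<forall>\<phi>\<in>dual S. ((\<lambda>x. canon S x \<phi>) \<longlongrightarrow> p \<phi>) F))"

definition closed_projection ::
    "('h :: complex_hilbert_space \<Rightarrow>\<^sub>L 'h) set \<Rightarrow> 'h bifunctional \<Rightarrow> bool"
  where
  "closed_projection S q \<longleftrightarrow> projection S q \<and>
     open_projection S (bidual_diff S (canon S (identity_of S)) q)"

definition right_ideal ::
    "('h :: complex_hilbert_space \<Rightarrow>\<^sub>L 'h) set \<Rightarrow> 'h bifunctional
     \<Rightarrow> ('h \<Rightarrow>\<^sub>L 'h) set" where
  "right_ideal A q =
     {a \<in> A. arens (unitization A) q (canon (unitization A) a) = bidual_zero (unitization A)}"

end

theory Submission
  imports Defs
begin

text \<open>
  Write \<open>S\<close> for the unitization of \<open>A\<close>, \<open>e\<close> for its identity and \<open>p = e - q\<close>. With respect to \<open>p\<close> and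
  \<open>q\<close> the element \<open>b\<close> is block diagonal; if \<open>bq \<noteq> 0\<close>, one may divide by \<open>\<parallel>bq\<parallel>\<close> and assume
  that \<open>\<parallel>bq\<parallel> \<le> 1\<close>; if \<open>bq = 0\<close>, then \<open>b\<close> itself lies in the right ideal.
  The element \<open>g\<close> is sought in the form \<open>g = bh\<close> with \<open>h = e + z\<close> and \<open>z\<close> in (the closure of) the
  right ideal \<open>J = {z \<in> S. pz = z}\<close>.
  Then \<open>g = b + bz\<close> lies in \<open>A\<close>, because \<open>A\<close> is an ideal of \<open>S\<close>. Moreover
  \<open>qg = bqh = bq\<close>, and \<open>gq = bq\<close> as soon as \<open>zp = z\<close>.

  The element \<open>h\<close> has a lower row \<open>(0, q)\<close> and some off-diagonal corner \<open>\<beta> = phq = z - zp\<close>. On the range of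
  \<open>q\<close> one has \<open>\<parallel>\<xi>\<parallel>\<^sup>2 + \<parallel>\<beta>\<xi>\<parallel>\<^sup>2 = \<parallel>h\<xi>\<parallel>\<^sup>2\<close>, so \<open>\<parallel>\<beta>\<parallel>\<^sup>2 \<le> \<parallel>h\<parallel>\<^sup>2 - 1\<close>: a contraction \<open>h\<close> satisfies \<open>zp = z\<close>
  automatically. It remains to find \<open>h\<close> with \<open>\<parallel>h\<parallel> \<le> 1\<close> and \<open>\<parallel>bh\<parallel> \<le> 1\<close>. Suppose both norms are at most
  \<open>1 + \<epsilon>\<close>. With \<open>\<delta> = \<epsilon> / (1 + \<epsilon>)\<close> the element \<open>\<eta> = (1 - \<delta>) hp + q\<close> of the bidual is block diagonal, both
  \<open>\<eta>\<close> and \<open>b\<eta>\<close> are contractions, \<open>\<parallel>\<eta> - h\<parallel> \<le> \<epsilon> + \<parallel>\<beta>\<parallel>\<close> is of order \<open>\<surd>\<epsilon>\<close>, and \<open>\<eta> - h\<close> belongs to the second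
  annihilator of \<open>J\<close>, because \<open>p\<close> is open. A Hahn-Banach separation (lemma
  \<open>approximation_from_second_annihilator\<close>) replaces \<open>\<eta> - h\<close> by an element of \<open>J\<close> at an arbitrarily small cost
  in all three norms. Iterating with \<open>\<epsilon> = 4\<^sup>-\<^sup>n\<close> gives a norm convergent sequence whose limit is the
  required \<open>h\<close> (\<open>perturbation_step\<close>, \<open>exact_contraction\<close>).

  For the distance, \<open>b - g\<close> lies in the right ideal and has distance \<open>\<parallel>g\<parallel> \<le> \<parallel>bq\<parallel>\<close> from \<open>b\<close>, whereas
  \<open>\<parallel>b - z\<parallel> \<ge> \<parallel>q(b - z)\<parallel> = \<parallel>qb\<parallel>\<close> for every \<open>z\<close> in the right ideal.

  The norm estimates in the bidual are obtained without the von Neumann algebra \<open>B(H)**\<close> and its universal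
  representation. A functional of norm at most one is approximately \<open>x \<mapsto> \<langle>x, a\<rangle>\<close> for the semi-inner
  product \<open>\<langle>x, y\<rangle> = F (y* x)\<close> of a state \<open>F\<close> on \<open>B(H)\<close> (\<open>vector_state\<close>). On this space \<open>p\<close> is only given
  as a bounded form, but an approximate Riesz lemma yields operators \<open>u\<close> and \<open>v\<close> that behave like \<open>pe\<close> and
  \<open>pa\<close> up to an error \<open>\<kappa>\<close>, and the usual computations with block matrices go through with errors
  that vanish as \<open>\<kappa>\<close> tends to zero. Since only real parts of functionals matter for norms, all of this takes place
  in the real normed space of bounded real-linear operators; passing to real parts turns \<open>p\<close> into a
  bounded functional \<open>pp\<close> on the real dual of that space.\<close>

section \<open>Sublinear functionals\<close>

definition sublinear :: "('a::real_vector \<Rightarrow> real) \<Rightarrow> bool" where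
  "sublinear N \<longleftrightarrow> (\<forall>x y. N (x + y) \<le> N x + N y) \<and> (\<forall>t>0. \<forall>x. N (t *\<^sub>R x) = t * N x)"

lemma sublinear_add: "sublinear N \<Longrightarrow> N (x + y) \<le> N x + N y"
  and sublinear_scaleR: "sublinear N \<Longrightarrow> 0 < t \<Longrightarrow> N (t *\<^sub>R x) = t * N x"
  by (auto simp: sublinear_def)

lemma sublinear_zero: "sublinear N \<Longrightarrow> N 0 = 0"
  using sublinear_scaleR [of N 2 0] by simp

lemma sublinear_minus: "sublinear N \<Longrightarrow> - N (- x) \<le> N x"
  using sublinear_add [of N x "- x"] sublinear_zero [of N] by simp

text \<open>The hypothesis of the Mazur-Orlicz theorem for a family of constraints \<open>c \<le> F m\<close>. Convexity of the
  family is relaxed: the sum of two constraints only has to be implied by a constraint of the family.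
  The relaxation admits the family of all pairs \<open>(y* y / s, 2 f y - s)\<close>, which is not convex.\<close>

definition dominated_cone :: "('a::real_vector \<Rightarrow> real) \<Rightarrow> ('a \<times> real) set \<Rightarrow> bool" where
  "dominated_cone N C \<longleftrightarrow> C \<noteq> {} \<and>
     (\<forall>t>0. \<forall>(m, c)\<in>C. (t *\<^sub>R m, t * c) \<in> C) \<and>
     (\<forall>(m, c)\<in>C. \<forall>(m', c')\<in>C. \<exists>(n, d)\<in>C. c + c' \<le> d \<and> (\<forall>w. N (w + n) \<le> N (w + (m + m')))) \<and>
     (\<forall>(m, c)\<in>C. c \<le> N m)"

text \<open>Every linear functional below the envelope is below \<open>N\<close> and satisfies all constraints \<open>c \<le> F m\<close>.\<close>

definition envelope :: "('a::real_vector \<Rightarrow> real) \<Rightarrow> ('a \<times> real) set \<Rightarrow> 'a \<Rightarrow> real" where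
  "envelope N C x = (INF (m, c)\<in>C. N (x + m) - c)"

lemma
  assumes N: "sublinear N" and C: "dominated_cone N C"
  shows envelope_le: "(m, c) \<in> C \<Longrightarrow> envelope N C x \<le> N (x + m) - c"
    and envelope_greatest: "(\<And>m c. (m, c) \<in> C \<Longrightarrow> k \<le> N (x + m) - c) \<Longrightarrow> k \<le> envelope N C x"
proof -
  have "- N (- x) \<le> N (x + m) - c" if "(m, c) \<in> C" for m c
  proof -
    have "c \<le> N m"
      using that C by (auto simp: dominated_cone_def)
    also have "\<dots> \<le> N (x + m) + N (- x)"
      using sublinear_add [OF N, of "x + m" "- x"] by simp
    finally show ?thesis by simp
  qed
  then have "bdd_below ((\<lambda>(m, c). N (x + m) - c) ` C)"
    by (intro bdd_belowI2 [where m = "- N (- x)"]) auto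
  then show "(m, c) \<in> C \<Longrightarrow> envelope N C x \<le> N (x + m) - c"
    unfolding envelope_def by (rule cINF_lower2) auto
  show "(\<And>m c. (m, c) \<in> C \<Longrightarrow> k \<le> N (x + m) - c) \<Longrightarrow> k \<le> envelope N C x"
    unfolding envelope_def using C by (intro cINF_greatest) (auto simp: dominated_cone_def)
qed

lemma sublinear_envelope:
  assumes N: "sublinear N" and C: "dominated_cone N C"
  shows "sublinear (envelope N C)"
proof -
  have le: "envelope N C (t *\<^sub>R x) \<le> t * envelope N C x" if "t > 0" for t x
  proof -
    have "inverse t * envelope N C (t *\<^sub>R x) \<le> envelope N C x"
    proof (rule envelope_greatest [OF N C])
      fix m c assume "(m, c) \<in> C"
      then have "(t *\<^sub>R m, t * c) \<in> C"
        using C that by (auto simp: dominated_cone_def)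
      then have "envelope N C (t *\<^sub>R x) \<le> N (t *\<^sub>R x + t *\<^sub>R m) - t * c"
        by (rule envelope_le [OF N C])
      also have "\<dots> = t * (N (x + m) - c)"
        using sublinear_scaleR [OF N that, of "x + m"] by (simp add: algebra_simps)
      finally show "inverse t * envelope N C (t *\<^sub>R x) \<le> N (x + m) - c"
        using that by (simp add: field_simps)
    qed
    then show ?thesis
      using that by (simp add: field_simps)
  qed
  have "envelope N C (t *\<^sub>R x) = t * envelope N C x" if "t > 0" for t x
  proof (rule antisym)
    have "envelope N C (inverse t *\<^sub>R (t *\<^sub>R x)) \<le> inverse t * envelope N C (t *\<^sub>R x)"
      using that by (intro le) auto
    then show "t * envelope N C x \<le> envelope N C (t *\<^sub>R x)"
      using that by (simp add: field_simps)
  qed (rule le [OF that])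
  moreover have "envelope N C (x + y) \<le> envelope N C x + envelope N C y" for x y
  proof -
    have "envelope N C (x + y) - envelope N C y \<le> envelope N C x"
    proof (rule envelope_greatest [OF N C])
      fix m c assume mc: "(m, c) \<in> C"
      have "envelope N C (x + y) - (N (x + m) - c) \<le> envelope N C y"
      proof (rule envelope_greatest [OF N C])
        fix m' c' assume "(m', c') \<in> C"
        then obtain n d where nd: "(n, d) \<in> C" "c + c' \<le> d" "\<And>w. N (w + n) \<le> N (w + (m + m'))"
          using mc C unfolding dominated_cone_def by blast
        have "envelope N C (x + y) \<le> N (x + y + n) - d"
          by (rule envelope_le [OF N C nd(1)])
        also have "\<dots> \<le> N ((x + m) + (y + m')) - (c + c')"
          using nd(2) nd(3) [of "x + y"] by (simp add: algebra_simps)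
        also have "\<dots> \<le> N (x + m) + N (y + m') - (c + c')"
          using sublinear_add [OF N, of "x + m" "y + m'"] by simp
        finally show "envelope N C (x + y) - (N (x + m) - c) \<le> N (y + m') - c'"
          by simp
      qed
      then show "envelope N C (x + y) - envelope N C y \<le> N (x + m) - c" by simp
    qed
    then show ?thesis by simp
  qed
  ultimately show ?thesis
    by (auto simp: sublinear_def)
qed

lemma envelope_le_self:
  assumes N: "sublinear N" and C: "dominated_cone N C"
  shows "envelope N C x \<le> N x"
proof (rule field_le_epsilon)
  fix \<epsilon> :: real assume \<epsilon>: "\<epsilon> > 0"
  obtain m c where mc: "(m, c) \<in> C"
    using C by (auto simp: dominated_cone_def)
  define t where "t = \<epsilon> / (N m - c + 1)"
  have "c \<le> N m"
    using C mc by (auto simp: dominated_cone_def)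
  then have t: "t > 0" "t * (N m - c) \<le> \<epsilon>"
    using \<epsilon> mult_left_mono [of "N m - c" "N m - c + 1" "\<epsilon> / (N m - c + 1)"] by (auto simp: t_def)
  have "(t *\<^sub>R m, t * c) \<in> C"
    using C mc t by (auto simp: dominated_cone_def)
  then have "envelope N C x \<le> N (x + t *\<^sub>R m) - t * c"
    by (rule envelope_le [OF N C])
  also have "\<dots> \<le> N x + t * (N m - c)"
    using sublinear_add [OF N, of x "t *\<^sub>R m"] sublinear_scaleR [OF N t(1), of m]
    by (simp add: algebra_simps)
  finally show "envelope N C x \<le> N x + \<epsilon>" using t by simp
qed

text \<open>A minimal sublinear functional \<open>F\<close>, which Zorn's lemma provides below \<open>N\<close>, is linear: the envelope of \<open>F\<close>
  for the single constraint \<open>F v \<le> G v\<close> on functionals \<open>G\<close> and its multiples lies below \<open>F\<close>, hence equals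
  \<open>F\<close>, and its value at \<open>- v\<close> is at most \<open>- F v\<close>.\<close>

lemma linear_minorant:
  assumes N: "sublinear (N :: 'a::real_vector \<Rightarrow> real)"
  obtains F where "linear F" "\<And>x. F x \<le> N x"
proof -
  define A where "A = {n. sublinear n \<and> (\<forall>x. n x \<le> N x)}"
  define P where "P n n' \<longleftrightarrow> (\<forall>x. n' x \<le> n x)" for n n' :: "'a \<Rightarrow> real"
  have "\<exists>n\<in>A. \<forall>n'\<in>A. P n n' \<longrightarrow> n' = n"
  proof (rule predicate_Zorn)
    show "partial_order_on A (relation_of P A)"
      by (rule partial_order_on_relation_ofI)
        (auto simp: P_def intro: order_trans intro!: ext antisym)
  next
    fix C assume C: "C \<in> Chains (relation_of P A)"
    show "\<exists>u\<in>A. \<forall>n\<in>C. P n u"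
    proof (cases "C = {}")
      case True
      then show ?thesis using N by (auto simp: A_def)
    next
      case False
      have CA: "C \<subseteq> A"
        using C by (auto simp: Chains_def relation_of_def)
      have tot: "P n n' \<or> P n' n" if "n \<in> C" "n' \<in> C" for n n'
        using C that by (auto simp: Chains_def relation_of_def)
      define u where "u x = (INF n\<in>C. n x)" for x
      have bdd: "bdd_below ((\<lambda>n. n x) ` C)" for x
      proof (intro bdd_belowI2)
        fix n assume "n \<in> C"
        with CA have n: "sublinear n" "n (- x) \<le> N (- x)" by (auto simp: A_def)
        then show "- N (- x) \<le> n x"
          using sublinear_minus [OF n(1), of x] by linarith
      qed
      have u_le: "u x \<le> n x" if "n \<in> C" for n x
        unfolding u_def by (rule cINF_lower [OF bdd that])
      have u_ge: "k \<le> u x" if "\<And>n. n \<in> C \<Longrightarrow> k \<le> n x" for k x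
        unfolding u_def by (rule cINF_greatest [OF False that])
      have "u (x + y) \<le> u x + u y" for x y
      proof -
        have "u (x + y) - u y \<le> u x"
        proof (rule u_ge)
          fix n assume n: "n \<in> C"
          have "u (x + y) - n x \<le> u y"
          proof (rule u_ge)
            fix n' assume n': "n' \<in> C"
            obtain n'' where "n'' \<in> C" "P n n''" "P n' n''"
              using tot [OF n n'] n n' by (auto simp: P_def)
            then have "u (x + y) \<le> n'' x + n'' y"
              using u_le [of n'' "x + y"] CA sublinear_add [of n'' x y] by (force simp: A_def)
            also have "\<dots> \<le> n x + n' y"
              using \<open>P n n''\<close> \<open>P n' n''\<close> by (auto simp: P_def intro: add_mono)
            finally show "u (x + y) - n x \<le> n' y" by simp
          qed
          then show "u (x + y) - u y \<le> n x" by simp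
        qed
        then show ?thesis by simp
      qed
      moreover have "u (t *\<^sub>R x) = t * u x" if t: "t > 0" for t x
      proof -
        have hom: "n (s *\<^sub>R y) = s * n y" if "n \<in> C" "s > 0" for n s y
          using CA that sublinear_scaleR [of n s y] by (auto simp: A_def)
        have "inverse t * u (t *\<^sub>R x) \<le> u x"
        proof (rule u_ge)
          fix n assume "n \<in> C"
          then show "inverse t * u (t *\<^sub>R x) \<le> n x"
            using u_le [of n "t *\<^sub>R x"] hom [of n t x] t by (simp add: field_simps)
        qed
        moreover have "t * u x \<le> u (t *\<^sub>R x)"
        proof (rule u_ge)
          fix n assume "n \<in> C"
          then show "t * u x \<le> n (t *\<^sub>R x)"
            using u_le [of n x] hom [of n t x] t by simp
        qed
        ultimately show ?thesis using t by (simp add: field_simps)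
      qed
      ultimately have "sublinear u" by (auto simp: sublinear_def)
      moreover have "u x \<le> N x" for x
      proof -
        obtain n where "n \<in> C" using False by auto
        then have "n x \<le> N x" "u x \<le> n x" using u_le CA by (auto simp: A_def)
        then show ?thesis by simp
      qed
      ultimately show ?thesis
        using u_le by (auto simp: A_def P_def)
    qed
  qed
  then obtain F where "F \<in> A" and minimal: "\<And>n. n \<in> A \<Longrightarrow> P F n \<Longrightarrow> n = F"
    by blast
  then have F: "sublinear F" "\<And>x. F x \<le> N x"
    by (auto simp: A_def)
  have min: "n = F" if "sublinear n" "\<And>x. n x \<le> F x" for n
    using that F(2) order_trans by (intro minimal) (auto simp: A_def P_def, blast)
  have minus: "F (- v) = - F v" for v
  proof (rule antisym)
    define C where "C = {(t *\<^sub>R v, t * F v) | t. t > 0}"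
    have memC: "(t *\<^sub>R v, t * F v) \<in> C" if "t > 0" for t
      using that by (auto simp: C_def)
    have C: "dominated_cone F C"
      unfolding dominated_cone_def
    proof (intro conjI)
      show "C \<noteq> {}" using memC [of 1] by auto
      show "\<forall>t>0. \<forall>(m, c)\<in>C. (t *\<^sub>R m, t * c) \<in> C"
        using memC by (auto simp: C_def simp flip: mult.assoc)
      show "\<forall>(m, c)\<in>C. \<forall>(m', c')\<in>C. \<exists>(n, d)\<in>C. c + c' \<le> d \<and> (\<forall>w. F (w + n) \<le> F (w + (m + m')))"
      proof clarify
        fix m c m' c' assume "(m, c) \<in> C" "(m', c') \<in> C"
        then obtain s t where "m = s *\<^sub>R v" "c = s * F v" "s > 0" "m' = t *\<^sub>R v" "c' = t * F v" "t > 0"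
          by (auto simp: C_def)
        then show "\<exists>(n, d)\<in>C. c + c' \<le> d \<and> (\<forall>w. F (w + n) \<le> F (w + (m + m')))"
          using memC [of "s + t"] by (intro bexI) (auto simp: algebra_simps)
      qed
      show "\<forall>(m, c)\<in>C. c \<le> F m"
        using sublinear_scaleR [OF F(1)] by (auto simp: C_def)
    qed
    have "envelope F C = F"
      by (rule min [OF sublinear_envelope [OF F(1) C] envelope_le_self [OF F(1) C]])
    moreover have "envelope F C (- v) \<le> F (- v + 1 *\<^sub>R v) - 1 * F v"
      by (rule envelope_le [OF F(1) C memC]) simp
    ultimately show "F (- v) \<le> - F v"
      using sublinear_zero [OF F(1)] by simp
    show "- F v \<le> F (- v)"
      using sublinear_minus [OF F(1), of "- v"] by simp
  qed
  have "linear F"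
  proof (rule linearI)
    fix x y
    have "- F (x + y) \<le> - F x - F y"
      using sublinear_add [OF F(1), of "- x" "- y"] minus [of x] minus [of y] minus [of "x + y"]
      by (simp add: algebra_simps)
    then show "F (x + y) = F x + F y"
      using sublinear_add [OF F(1), of x y] by simp
  next
    fix t :: real and x
    consider "t = 0" | "t > 0" | "- t > 0" by linarith
    then show "F (t *\<^sub>R x) = t *\<^sub>R F x"
    proof cases
      case 3
      then show ?thesis
        using sublinear_scaleR [OF F(1) 3, of x] minus [of "t *\<^sub>R x"] by simp
    qed (use sublinear_scaleR [OF F(1)] sublinear_zero [OF F(1)] in auto)
  qed
  with F show thesis using that by blast
qed

text \<open>Both the Hahn-Banach extension theorem and the two separation arguments below are instances.\<close>

lemma mazur_orlicz:
  assumes N: "sublinear N" and C: "dominated_cone N C"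
  obtains F where "linear F" "\<And>x. F x \<le> N x" "\<And>m c. (m, c) \<in> C \<Longrightarrow> c \<le> F m"
proof -
  obtain F where F: "linear F" "\<And>x. F x \<le> envelope N C x"
    using linear_minorant [OF sublinear_envelope [OF N C]] by blast
  show thesis
  proof
    show "F x \<le> N x" for x
      using F(2) [of x] envelope_le_self [OF N C, of x] by simp
    fix m c assume "(m, c) \<in> C"
    then have "F (- m) \<le> N (- m + m) - c"
      using F(2) envelope_le [OF N C] order_trans by blast
    then show "c \<le> F m"
      using sublinear_zero [OF N] linear_neg [OF F(1), of m] by simp
  qed (rule F(1))
qed

lemma hahn_banach_extension:
  fixes f :: "'a::real_normed_vector \<Rightarrow> real"
  assumes S: "subspace S"
    and add: "\<And>x y. x \<in> S \<Longrightarrow> y \<in> S \<Longrightarrow> f (x + y) = f x + f y"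
    and scale: "\<And>t x. x \<in> S \<Longrightarrow> f (t *\<^sub>R x) = t * f x"
    and bound: "\<And>x. x \<in> S \<Longrightarrow> f x \<le> K * norm x" and K: "0 \<le> K"
  obtains F :: "'a \<Rightarrow>\<^sub>L real" where "\<And>x. x \<in> S \<Longrightarrow> F x = f x" "norm F \<le> K"
proof -
  let ?N = "\<lambda>x::'a. K * norm x" and ?C = "(\<lambda>x. (x, f x)) ` S"
  have "sublinear ?N"
    using K mult_left_mono [OF norm_triangle_ineq K]
    by (auto simp: sublinear_def ring_distribs)
  moreover have "dominated_cone ?N ?C"
    unfolding dominated_cone_def
  proof (intro conjI)
    show "?C \<noteq> {}" using subspace_0 [OF S] by auto
    show "\<forall>(m, c)\<in>?C. \<forall>(m', c')\<in>?C. \<exists>(n, d)\<in>?C. c + c' \<le> d \<and> (\<forall>w. ?N (w + n) \<le> ?N (w + (m + m')))"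
    proof clarify
      fix x y assume "x \<in> S" "y \<in> S"
      then show "\<exists>(n, d)\<in>?C. f x + f y \<le> d \<and> (\<forall>w. ?N (w + n) \<le> ?N (w + (x + y)))"
        by (intro bexI [where x = "(x + y, f (x + y))"]) (auto simp: add subspace_add [OF S])
    qed
  qed (auto simp: image_iff scale bound subspace_scale [OF S])
  ultimately obtain F where F: "linear F" "\<And>x. F x \<le> K * norm x"
    "\<And>m c. (m, c) \<in> ?C \<Longrightarrow> c \<le> F m"
    using mazur_orlicz by blast
  have abs: "\<bar>F x\<bar> \<le> K * norm x" for x
    using F(2) [of x] F(2) [of "- x"] linear_neg [OF F(1), of x] by simp
  then have bl: "bounded_linear F"
    using F(1) by (intro bounded_linear.intro bounded_linear_axioms.intro)
      (auto simp: mult.commute)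
  show thesis
  proof
    show "blinfun_apply (Blinfun F) x = f x" if "x \<in> S" for x
    proof -
      have "(x, f x) \<in> ?C" "(- x, f (- x)) \<in> ?C"
        using that subspace_neg [OF S] by auto
      moreover have "f (- x) = - f x"
        using scale [OF that, of "-1"] by simp
      ultimately have "f x \<le> F x" "- f x \<le> F (- x)"
        using F(3) by metis+
      then show ?thesis
        using linear_neg [OF F(1), of x] bl by (simp add: bounded_linear_Blinfun_apply)
    qed
    show "norm (Blinfun F) \<le> K"
      by (rule norm_blinfun_bound [OF K]) (use abs bl in \<open>simp add: bounded_linear_Blinfun_apply\<close>)
  qed
qed

section \<open>Approximating elements of a second annihilator\<close>

lemma norm_blinfun_attained_approx:
  fixes f :: "'a::real_normed_vector \<Rightarrow>\<^sub>L real"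
  assumes "0 < \<epsilon>"
  obtains x where "norm x \<le> 1" "norm f - \<epsilon> \<le> f x"
proof -
  have "\<exists>x. norm x \<le> 1 \<and> norm f - \<epsilon> \<le> f x"
  proof (rule ccontr)
    assume *: "\<not> ?thesis"
    then have less: "f x < norm f - \<epsilon>" if "norm x \<le> 1" for x
      using that by (meson not_le)
    have pos: "0 \<le> norm f - \<epsilon>"
      using less [of 0] by (simp add: blinfun.zero_right)
    have "norm f \<le> norm f - \<epsilon>"
    proof (rule norm_blinfun_bound [OF pos])
      fix x
      show "norm (f x) \<le> (norm f - \<epsilon>) * norm x"
      proof (cases "x = 0")
        case False
        have "\<bar>f (x /\<^sub>R norm x)\<bar> \<le> norm f - \<epsilon>"
          using less [of "x /\<^sub>R norm x"] less [of "- (x /\<^sub>R norm x)"] False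
          by (simp add: blinfun.minus_right abs_le_iff)
        with False show ?thesis
          by (simp add: blinfun.scaleR_right abs_mult divide_simps mult.commute)
      qed (simp add: blinfun.zero_right)
    qed
    with assms show False by simp
  qed
  with that show thesis by blast
qed

text \<open>Let \<open>\<zeta>\<close> lie in the second annihilator of \<open>J\<close> and let the elements \<open>L\<^sub>i\<^sup>*\<^sup>* \<zeta> + y\<^sub>i\<close> of the bidual have norm at
  most \<open>\<alpha>\<^sub>i\<close>. Then \<open>\<zeta>\<close> can be replaced by an element of \<open>J\<close> without spoiling the three bounds by more than
  \<open>\<epsilon>\<close>. Otherwise the convex set of all triples \<open>(L\<^sub>i z + y\<^sub>i)\<close> misses the unit ball of a weighted maximum
  norm, and a separating triple of functionals, whose sum \<open>\<Sum> F\<^sub>i \<circ> L\<^sub>i\<close> vanishes on \<open>J\<close> and hence at \<open>\<zeta>\<close>,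
  would contradict the bounds. One triple serves the three norms \<open>\<parallel>z\<parallel>\<close>, \<open>\<parallel>h + z\<parallel>\<close> and \<open>\<parallel>bh + bz\<parallel>\<close>.\<close>

lemma approximation_from_second_annihilator:
  fixes \<zeta> :: "('a::real_normed_vector \<Rightarrow>\<^sub>L real) \<Rightarrow> real"
    and L1 L2 L3 :: "'a \<Rightarrow>\<^sub>L 'a"
  assumes J: "subspace J"
    and add: "\<And>f g. \<zeta> (f + g) = \<zeta> f + \<zeta> g"
    and annihilator: "\<And>f. (\<And>z. z \<in> J \<Longrightarrow> blinfun_apply f z = 0) \<Longrightarrow> \<zeta> f = 0"
    and bound1: "\<And>f. \<zeta> (f o\<^sub>L L1) + blinfun_apply f y1 \<le> \<alpha>1 * norm f"
    and bound2: "\<And>f. \<zeta> (f o\<^sub>L L2) + blinfun_apply f y2 \<le> \<alpha>2 * norm f"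
    and bound3: "\<And>f. \<zeta> (f o\<^sub>L L3) + blinfun_apply f y3 \<le> \<alpha>3 * norm f"
    and pos: "0 \<le> \<alpha>1" "0 \<le> \<alpha>2" "0 \<le> \<alpha>3" "0 < \<epsilon>"
  obtains z where "z \<in> J" "norm (L1 z + y1) \<le> \<alpha>1 + \<epsilon>" "norm (L2 z + y2) \<le> \<alpha>2 + \<epsilon>"
    "norm (L3 z + y3) \<le> \<alpha>3 + \<epsilon>"
proof -
  define N :: "'a \<times> 'a \<times> 'a \<Rightarrow> real" where
    "N = (\<lambda>(u, v, w). max (norm u / (\<alpha>1 + \<epsilon>)) (max (norm v / (\<alpha>2 + \<epsilon>)) (norm w / (\<alpha>3 + \<epsilon>))))"
  define m where "m z = (L1 z + y1, L2 z + y2, L3 z + y3)" for z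
  have "\<exists>z\<in>J. N (m z) \<le> 1"
  proof (rule ccontr)
    assume "\<not> ?thesis"
    then have far: "1 \<le> N (m z)" if "z \<in> J" for z
      using that by force
    have N: "sublinear N"
      unfolding sublinear_def
    proof (intro conjI allI impI)
      have tri: "norm (u + v) / (\<alpha> + \<epsilon>) \<le> norm u / (\<alpha> + \<epsilon>) + norm v / (\<alpha> + \<epsilon>)"
        if "0 \<le> \<alpha>" for u v :: 'a and \<alpha>
        using divide_right_mono [OF norm_triangle_ineq, of "\<alpha> + \<epsilon>" u v] that pos
        by (simp add: add_divide_distrib)
      show "N (x + y) \<le> N x + N y" for x y
        using tri [OF pos(1), of "fst x" "fst y"] tri [OF pos(2), of "fst (snd x)" "fst (snd y)"]
          tri [OF pos(3), of "snd (snd x)" "snd (snd y)"]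
        unfolding N_def by (auto simp: case_prod_beta simp del: divide_le_cancel)
      show "N (t *\<^sub>R x) = t * N x" if "0 < t" for t x
        using that unfolding N_def
        by (simp add: case_prod_beta max_mult_distrib_left)
    qed
    define C where "C = {(t *\<^sub>R m z, t) | t z. t > 0 \<and> z \<in> J}"
    have "dominated_cone N C"
      unfolding dominated_cone_def
    proof (intro conjI)
      show "C \<noteq> {}"
        using subspace_0 [OF J] zero_less_one unfolding C_def by blast
      show "\<forall>t>0. \<forall>(n, c)\<in>C. (t *\<^sub>R n, t * c) \<in> C"
      proof clarify
        fix t :: real and n c assume "0 < t" "(n, c) \<in> C"
        then obtain z where "n = c *\<^sub>R m z" "0 < t * c" "z \<in> J" by (auto simp: C_def)
        then show "(t *\<^sub>R n, t * c) \<in> C" unfolding C_def by auto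
      qed
      show "\<forall>(n, c)\<in>C. \<forall>(n', c')\<in>C. \<exists>(k, d)\<in>C. c + c' \<le> d \<and> (\<forall>w. N (w + k) \<le> N (w + (n + n')))"
      proof clarify
        fix n c n' c' assume "(n, c) \<in> C" "(n', c') \<in> C"
        then obtain z z' where z: "n = c *\<^sub>R m z" "c > 0" "z \<in> J" "n' = c' *\<^sub>R m z'" "c' > 0" "z' \<in> J"
          by (auto simp: C_def)
        define z'' where "z'' = (c / (c + c')) *\<^sub>R z + (c' / (c + c')) *\<^sub>R z'"
        have lin: "(c + c') *\<^sub>R (L z'' + y) = c *\<^sub>R (L z + y) + c' *\<^sub>R (L z' + y)"
          for L :: "'a \<Rightarrow>\<^sub>L 'a" and y
        proof -
          have "(c + c') *\<^sub>R L z'' = c *\<^sub>R L z + c' *\<^sub>R L z'"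
            using z by (simp add: z''_def blinfun.add_right blinfun.scaleR_right scaleR_add_right)
          then show ?thesis by (simp add: scaleR_add_right scaleR_add_left)
        qed
        have "z'' \<in> J"
          unfolding z''_def using z J by (intro subspace_add subspace_scale) auto
        then have "((c + c') *\<^sub>R m z'', c + c') \<in> C"
          using z by (auto simp: C_def)
        moreover have "(c + c') *\<^sub>R m z'' = n + n'"
          unfolding z m_def by (simp add: lin del: scaleR_add_right)
        ultimately show "\<exists>(k, d)\<in>C. c + c' \<le> d \<and> (\<forall>w. N (w + k) \<le> N (w + (n + n')))"
          by (intro bexI [where x = "((c + c') *\<^sub>R m z'', c + c')"]) auto
      qed
      show "\<forall>(n, c)\<in>C. c \<le> N n"
      proof clarify
        fix n c assume "(n, c) \<in> C"
        then obtain z where "n = c *\<^sub>R m z" "0 < c" "z \<in> J" by (auto simp: C_def)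
        then show "c \<le> N n"
          using far [of z] sublinear_scaleR [OF N, of c "m z"] by simp
      qed
    qed
    then obtain F where F: "linear F" "\<And>x. F x \<le> N x" "\<And>n c. (n, c) \<in> C \<Longrightarrow> c \<le> F n"
      using mazur_orlicz [OF N] by blast
    have F_split: "F (u, v, w) = F (u, 0, 0) + F (0, v, 0) + F (0, 0, w)" for u v w
      by (simp flip: linear_add [OF F(1)])
    have component: "\<exists>G :: 'a \<Rightarrow>\<^sub>L real. \<forall>x. G x = F (i x)"
      if "linear i" "\<And>x. N (i x) \<le> norm x / (\<alpha> + \<epsilon>)" for i and \<alpha> :: real
    proof -
      have lin: "linear (\<lambda>x. F (i x))"
        using linear_compose [OF that(1) F(1)] by (simp add: o_def)
      have "\<bar>F (i x)\<bar> \<le> norm x * (1 / (\<alpha> + \<epsilon>))" for x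
        using F(2) [of "i x"] F(2) [of "i (- x)"] that(2) [of x] that(2) [of "- x"]
          linear_neg [OF lin, of x] by simp
      then have "bounded_linear (\<lambda>x. F (i x))"
        unfolding bounded_linear_def bounded_linear_axioms_def real_norm_def using lin by blast
      then show ?thesis
        by (metis bounded_linear_Blinfun_apply)
    qed
    have lin1: "linear (\<lambda>x::'a. (x, 0::'a, 0::'a))" and lin2: "linear (\<lambda>x::'a. (0::'a, x, 0::'a))"
      and lin3: "linear (\<lambda>x::'a. (0::'a, 0::'a, x))"
      by (rule linearI; simp)+
    obtain F1 :: "'a \<Rightarrow>\<^sub>L real" where F1: "\<And>x. F1 x = F (x, 0, 0)"
      using component [OF lin1, of \<alpha>1] pos by (auto simp: N_def)
    obtain F2 :: "'a \<Rightarrow>\<^sub>L real" where F2: "\<And>x. F2 x = F (0, x, 0)"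
      using component [OF lin2, of \<alpha>2] pos by (auto simp: N_def)
    obtain F3 :: "'a \<Rightarrow>\<^sub>L real" where F3: "\<And>x. F3 x = F (0, 0, x)"
      using component [OF lin3, of \<alpha>3] pos by (auto simp: N_def)
    have "1 \<le> F (m z)" if "z \<in> J" for z
    proof (rule F(3))
      have "(1 *\<^sub>R m z, 1) \<in> C"
        using that zero_less_one unfolding C_def by blast
      then show "(m z, 1) \<in> C" by simp
    qed
    then have lower: "1 \<le> F1 (L1 z + y1) + F2 (L2 z + y2) + F3 (L3 z + y3)" if "z \<in> J" for z
      using that unfolding F1 F2 F3 m_def F_split [symmetric] by blast
    define G where "G = (F1 o\<^sub>L L1) + (F2 o\<^sub>L L2) + (F3 o\<^sub>L L3)"
    define k where "k = F1 y1 + F2 y2 + F3 y3"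
    have lower': "1 \<le> G z + k" if "z \<in> J" for z
      using lower [OF that] by (simp add: G_def k_def blinfun.add_left blinfun.add_right)
    \<comment> \<open>A functional bounded below on a subspace vanishes there.\<close>
    have "G z = 0" if z: "z \<in> J" for z
    proof (rule ccontr)
      assume "G z \<noteq> 0"
      then have "G ((- k / G z) *\<^sub>R z) + k = 0"
        by (simp add: blinfun.scaleR_right blinfun.minus_right)
      moreover have "1 \<le> G ((- k / G z) *\<^sub>R z) + k"
        by (rule lower' [OF subspace_scale [OF J z]])
      ultimately show False by linarith
    qed
    then have "\<zeta> G = 0" by (rule annihilator)
    then have "\<zeta> (F1 o\<^sub>L L1) + \<zeta> (F2 o\<^sub>L L2) + \<zeta> (F3 o\<^sub>L L3) = 0"
      by (simp add: G_def add)
    moreover have "1 \<le> k"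
      using lower' [OF subspace_0 [OF J]] by (simp add: blinfun.zero_right)
    ultimately have one_le: "1 \<le> \<alpha>1 * norm F1 + \<alpha>2 * norm F2 + \<alpha>3 * norm F3"
      using bound1 [of F1] bound2 [of F2] bound3 [of F3] by (simp add: k_def)
    have upper: "(\<alpha>1 + \<epsilon>) * norm F1 + (\<alpha>2 + \<epsilon>) * norm F2 + (\<alpha>3 + \<epsilon>) * norm F3 \<le> 1"
    proof (rule field_le_epsilon)
      fix e :: real assume e: "e > 0"
      define M where "M = (\<alpha>1 + \<epsilon>) + (\<alpha>2 + \<epsilon>) + (\<alpha>3 + \<epsilon>)"
      have M: "M > 0" using pos by (simp add: M_def)
      have weighted: "a * u + b * v + c * w - (a + b + c) * d = a * (u - d) + b * (v - d) + c * (w - d)"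
        for a b c u v w d :: real
        by (simp add: algebra_simps)
      obtain x1 where x1: "norm x1 \<le> 1" "norm F1 - e / M \<le> F1 x1"
        using norm_blinfun_attained_approx [of "e / M" F1] e M by auto
      obtain x2 where x2: "norm x2 \<le> 1" "norm F2 - e / M \<le> F2 x2"
        using norm_blinfun_attained_approx [of "e / M" F2] e M by auto
      obtain x3 where x3: "norm x3 \<le> 1" "norm F3 - e / M \<le> F3 x3"
        using norm_blinfun_attained_approx [of "e / M" F3] e M by auto
      have "(\<alpha>1 + \<epsilon>) * norm F1 + (\<alpha>2 + \<epsilon>) * norm F2 + (\<alpha>3 + \<epsilon>) * norm F3 - M * (e / M)
          = (\<alpha>1 + \<epsilon>) * (norm F1 - e / M) + (\<alpha>2 + \<epsilon>) * (norm F2 - e / M) + (\<alpha>3 + \<epsilon>) * (norm F3 - e / M)"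
        unfolding M_def by (rule weighted)
      also have "\<dots> \<le> (\<alpha>1 + \<epsilon>) * F1 x1 + (\<alpha>2 + \<epsilon>) * F2 x2 + (\<alpha>3 + \<epsilon>) * F3 x3"
        using x1 x2 x3 pos by (intro add_mono mult_left_mono) auto
      also have "\<dots> = F1 ((\<alpha>1 + \<epsilon>) *\<^sub>R x1) + F2 ((\<alpha>2 + \<epsilon>) *\<^sub>R x2) + F3 ((\<alpha>3 + \<epsilon>) *\<^sub>R x3)"
        by (simp add: blinfun.scaleR_right)
      also have "\<dots> = F ((\<alpha>1 + \<epsilon>) *\<^sub>R x1, (\<alpha>2 + \<epsilon>) *\<^sub>R x2, (\<alpha>3 + \<epsilon>) *\<^sub>R x3)"
        unfolding F1 F2 F3 by (rule F_split [symmetric])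
      also have "\<dots> \<le> N ((\<alpha>1 + \<epsilon>) *\<^sub>R x1, (\<alpha>2 + \<epsilon>) *\<^sub>R x2, (\<alpha>3 + \<epsilon>) *\<^sub>R x3)"
        by (rule F(2))
      also have "\<dots> \<le> 1"
      proof -
        have "norm ((\<alpha> + \<epsilon>) *\<^sub>R x) / (\<alpha> + \<epsilon>) \<le> 1" if "norm x \<le> 1" "0 \<le> \<alpha>" for \<alpha> and x :: 'a
          using that pos(4) by simp
        then show ?thesis
          using x1(1) x2(1) x3(1) pos(1-3) unfolding N_def by simp
      qed
      finally show "(\<alpha>1 + \<epsilon>) * norm F1 + (\<alpha>2 + \<epsilon>) * norm F2 + (\<alpha>3 + \<epsilon>) * norm F3 \<le> 1 + e"
        using M by simp
    qed
    have "\<epsilon> * (norm F1 + norm F2 + norm F3) \<le> 0"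
      using upper one_le by (simp add: algebra_simps)
    then have "norm F1 + norm F2 + norm F3 \<le> 0"
      using pos(4) by (simp add: mult_le_0_iff)
    moreover have "0 \<le> norm F1" "0 \<le> norm F2" "0 \<le> norm F3" by simp_all
    ultimately have "norm F1 = 0" "norm F2 = 0" "norm F3 = 0" by linarith+
    with one_le show False by simp
  qed
  then obtain z where "z \<in> J" "N (m z) \<le> 1" by blast
  with pos that [of z] show thesis
    by (simp add: N_def m_def)
qed

section \<open>Semi-inner products and adjoints\<close>

locale semi_inner =
  fixes ip :: "'v::real_vector \<Rightarrow> 'v \<Rightarrow> real"
  assumes add_left: "ip (x + y) z = ip x z + ip y z"
    and scale_left: "ip (t *\<^sub>R x) z = t * ip x z"
    and commute: "ip x y = ip y x"
    and nonneg: "0 \<le> ip x x"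
begin

definition nrm :: "'v \<Rightarrow> real" where "nrm x = sqrt (ip x x)"

lemma add_right: "ip z (x + y) = ip z x + ip z y"
  by (metis add_left commute)

lemma scale_right: "ip z (t *\<^sub>R x) = t * ip z x"
  by (metis scale_left commute)

lemma minus_left: "ip (- x) z = - ip x z"
  using scale_left [of "-1" x z] by simp

lemma minus_right: "ip z (- x) = - ip z x"
  using scale_right [of z "-1" x] by simp

lemma diff_left: "ip (x - y) z = ip x z - ip y z"
  using add_left [of x "- y" z] by (simp add: minus_left)

lemma diff_right: "ip z (x - y) = ip z x - ip z y"
  using add_right [of z x "- y"] by (simp add: minus_right)

lemmas expand = add_left add_right diff_left diff_right minus_left minus_right scale_left scale_right

lemma nrm_nonneg: "0 \<le> nrm x"
  by (simp add: nrm_def nonneg)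

lemma nrm_square: "(nrm x)\<^sup>2 = ip x x"
  by (simp add: nrm_def nonneg)

lemma Cauchy_Schwarz: "\<bar>ip x y\<bar> \<le> nrm x * nrm y"
proof -
  have quad: "0 \<le> ip x x * t\<^sup>2 - 2 * ip x y * t + ip y y" for t
    using nonneg [of "t *\<^sub>R x - y"] by (simp add: expand commute [of y x] power2_eq_square algebra_simps)
  have "(ip x y)\<^sup>2 \<le> ip x x * ip y y"
  proof (cases "ip x x = 0")
    case True
    have "ip x y = 0"
    proof (rule ccontr)
      assume "ip x y \<noteq> 0"
      then show False
        using quad [of "(ip y y + 1) / (2 * ip x y)"] True by simp
    qed
    then show ?thesis by (simp add: True)
  next
    case False
    then have "0 < ip x x" using nonneg [of x] by simp
    then show ?thesis
      using quad [of "ip x y / ip x x"] by (simp add: field_simps power2_eq_square)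
  qed
  also have "\<dots> = (nrm x * nrm y)\<^sup>2"
    by (simp add: power_mult_distrib nrm_square)
  finally show ?thesis
    using abs_le_square_iff [of "ip x y" "nrm x * nrm y"] nrm_nonneg [of x] nrm_nonneg [of y]
    by simp
qed

lemma nrm_triangle: "nrm (x + y) \<le> nrm x + nrm y"
proof (rule power2_le_imp_le)
  have "(nrm (x + y))\<^sup>2 = (nrm x)\<^sup>2 + 2 * ip x y + (nrm y)\<^sup>2"
    by (simp add: nrm_square expand commute [of y x])
  also have "\<dots> \<le> (nrm x + nrm y)\<^sup>2"
    using Cauchy_Schwarz [of x y] by (simp add: power2_sum)
  finally show "(nrm (x + y))\<^sup>2 \<le> (nrm x + nrm y)\<^sup>2" .
qed (use nrm_nonneg in simp)

lemma nrm_scale: "nrm (t *\<^sub>R x) = \<bar>t\<bar> * nrm x"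
  by (simp add: nrm_def expand real_sqrt_mult flip: mult.assoc power2_eq_square)

lemma nrm_minus: "nrm (- x) = nrm x"
  using nrm_scale [of "-1" x] by simp

lemma nrm_diff: "nrm (x - y) \<le> nrm x + nrm y"
  using nrm_triangle [of x "- y"] by (simp add: nrm_minus)

text \<open>Without completeness there is no representing vector, but an almost minimizer of
  \<open>a \<mapsto> \<langle>a, a\<rangle> / 2 - G a\<close> represents \<open>G\<close> up to \<open>\<epsilon>\<close> in the dual norm.\<close>

lemma approximate_Riesz:
  assumes G: "linear G" and bound: "\<And>x. \<bar>G x\<bar> \<le> K * nrm x" and \<epsilon>: "0 < \<epsilon>"
  obtains a where "\<And>x. \<bar>G x - ip a x\<bar> \<le> \<epsilon> * nrm x"
proof -
  define \<Phi> where "\<Phi> a = ip a a / 2 - G a" for a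
  have "bdd_below (range \<Phi>)"
  proof (rule bdd_belowI2)
    fix a
    have "0 \<le> (nrm a - K)\<^sup>2" by simp
    then show "- (K\<^sup>2 / 2) \<le> \<Phi> a"
      using bound [of a] by (simp add: \<Phi>_def power2_diff nrm_square algebra_simps)
  qed
  then obtain a where a: "\<And>y. \<Phi> a - \<epsilon>\<^sup>2 / 2 \<le> \<Phi> y"
  proof -
    assume bdd: "bdd_below (range \<Phi>)"
    have "(INF y. \<Phi> y) < (INF y. \<Phi> y) + \<epsilon>\<^sup>2 / 2" using \<epsilon> by simp
    then obtain a where "\<Phi> a < (INF y. \<Phi> y) + \<epsilon>\<^sup>2 / 2"
      using cInf_lessD [of "range \<Phi>"] by blast
    then have "\<Phi> a - \<epsilon>\<^sup>2 / 2 \<le> \<Phi> y" for y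
      using cINF_lower [OF bdd, of y] by simp
    with that show thesis by blast
  qed
  show thesis
  proof
    fix x
    define d where "d = G x - ip a x"
    have step: "- (\<epsilon>\<^sup>2 / 2) \<le> t\<^sup>2 * (nrm x)\<^sup>2 / 2 - t * d" for t
      using a [of "a + t *\<^sub>R x"] unfolding nrm_square
      by (simp add: \<Phi>_def expand linear_add [OF G] linear_scale [OF G] commute [of x a]
          d_def power2_eq_square field_simps)
    show "\<bar>G x - ip a x\<bar> \<le> \<epsilon> * nrm x"
    proof (cases "nrm x = 0")
      case True
      then show ?thesis
        using bound [of x] Cauchy_Schwarz [of a x] by simp
    next
      case False
      then have pos: "0 < (nrm x)\<^sup>2" by simp
      have "d\<^sup>2 \<le> (\<epsilon> * nrm x)\<^sup>2"
        using step [of "d / (nrm x)\<^sup>2"] pos False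
        by (simp add: field_simps power2_eq_square)
      then show ?thesis
        using abs_le_square_iff [of d "\<epsilon> * nrm x"] \<epsilon> nrm_nonneg [of x] by (simp add: d_def)
    qed
  qed
qed

end

interpretation inner: semi_inner "inner :: 'a::real_inner \<Rightarrow> 'a \<Rightarrow> real"
  rewrites "semi_inner.nrm (inner :: 'a \<Rightarrow> 'a \<Rightarrow> real) = norm"
proof -
  show *: "semi_inner (inner :: 'a \<Rightarrow> 'a \<Rightarrow> real)"
    by standard (simp_all add: inner_add_left, rule inner_commute)
  show "semi_inner.nrm (inner :: 'a \<Rightarrow> 'a \<Rightarrow> real) = norm"
    by (simp add: fun_eq_iff semi_inner.nrm_def [OF *] norm_eq_sqrt_inner)
qed

text \<open>The approximate representatives for \<open>\<epsilon> = 1 / (n + 1)\<close> form a Cauchy sequence.\<close>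

lemma Riesz_representation:
  fixes G :: "'h::{real_inner, banach} \<Rightarrow> real"
  assumes G: "bounded_linear G"
  obtains a where "\<And>x. G x = inner a x"
proof -
  obtain K where K: "\<And>x. \<bar>G x\<bar> \<le> K * norm x"
    using bounded_linear.bounded [OF G] by (auto simp: mult.commute)
  have "\<exists>a. \<forall>x. \<bar>G x - inner a x\<bar> \<le> inverse (real (Suc n)) * norm x" for n
    using inner.approximate_Riesz [OF bounded_linear.linear [OF G] K, of "inverse (real (Suc n))"]
    by (metis inverse_Suc)
  then obtain a where a: "\<And>n x. \<bar>G x - inner (a n) x\<bar> \<le> inverse (real (Suc n)) * norm x"
    by metis
  have a_close: "norm (a m - a n) \<le> inverse (real (Suc m)) + inverse (real (Suc n))" for m n
  proof (cases "a m = a n")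
    case False
    define x where "x = a m - a n"
    have "norm x * norm x = inner (a m) x - inner (a n) x"
      by (simp add: x_def inner_diff_left flip: power2_eq_square power2_norm_eq_inner)
        (simp add: power2_norm_eq_inner inner_diff_left)
    also have "\<dots> \<le> (inverse (real (Suc m)) + inverse (real (Suc n))) * norm x"
      using a [of x m] a [of x n] by (simp add: ring_distribs abs_le_iff)
    finally show ?thesis
      using False by (simp add: x_def)
  qed simp
  have inv_less: "\<exists>N. \<forall>n\<ge>N. inverse (real (Suc n)) < e" if "e > 0" for e :: real
    using LIMSEQ_D [OF LIMSEQ_inverse_real_of_nat that] by simp
  have "Cauchy a"
  proof (rule metric_CauchyI)
    fix e :: real assume "e > 0"
    then obtain N where N: "\<And>n. n \<ge> N \<Longrightarrow> inverse (real (Suc n)) < e / 2"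
      using inv_less [of "e / 2"] by auto
    have "dist (a m) (a n) < e" if "m \<ge> N" "n \<ge> N" for m n
      using a_close [of m n] N [OF that(1)] N [OF that(2)] by (simp add: dist_norm)
    then show "\<exists>N. \<forall>m\<ge>N. \<forall>n\<ge>N. dist (a m) (a n) < e" by blast
  qed
  then obtain b where b: "a \<longlonglongrightarrow> b"
    using Cauchy_convergent convergent_def by blast
  show thesis
  proof
    fix x
    have "(\<lambda>n. inner (a n) x) \<longlonglongrightarrow> inner b x"
      by (intro tendsto_intros b)
    moreover have "(\<lambda>n. inner (a n) x) \<longlonglongrightarrow> G x"
    proof (rule LIM_zero_cancel, rule tendsto_0_le [where K = 1])
      show "(\<lambda>n. inverse (real (Suc n)) * norm x) \<longlonglongrightarrow> 0"
        using tendsto_mult_right [OF LIMSEQ_inverse_real_of_nat, of "norm x"] by simp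
      show "\<forall>\<^sub>F n in sequentially. norm (inner (a n) x - G x) \<le> norm (inverse (real (Suc n)) * norm x) * 1"
        using a [of x] by (simp add: abs_mult abs_minus_commute)
    qed
    ultimately show "G x = inner b x"
      using LIMSEQ_unique by blast
  qed
qed

definition adjoint :: "('h::{real_inner, banach} \<Rightarrow>\<^sub>L 'h) \<Rightarrow> ('h \<Rightarrow>\<^sub>L 'h)" where
  "adjoint T = (SOME S. \<forall>x y. inner (T x) y = inner x (blinfun_apply S y))"

lemma adjoint_exists:
  fixes T :: "'h::{real_inner, banach} \<Rightarrow>\<^sub>L 'h"
  obtains S :: "'h \<Rightarrow>\<^sub>L 'h" where "\<And>x y. inner (T x) y = inner x (S y)" "norm S \<le> norm T"
proof -
  have "\<exists>a. \<forall>x. inner (T x) y = inner a x" for y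
  proof -
    have "bounded_linear (\<lambda>x. inner (T x) y)"
      by (intro bounded_linear_intros blinfun.bounded_linear_right)
    then show ?thesis using Riesz_representation by metis
  qed
  then obtain S where S: "\<And>x y. inner (T x) y = inner x (S y)"
    by (metis inner_commute)
  have bound: "norm (S y) \<le> norm y * norm T" for y
  proof (cases "S y = 0")
    case False
    have "norm (S y) * norm (S y) = inner (T (S y)) y"
      by (simp add: S flip: power2_eq_square power2_norm_eq_inner)
    also have "\<dots> \<le> norm (T (S y)) * norm y"
      by (rule norm_cauchy_schwarz)
    also have "\<dots> \<le> (norm T * norm (S y)) * norm y"
      by (intro mult_right_mono norm_blinfun) simp
    finally show ?thesis using False by (simp add: mult_ac)
  qed simp
  have "linear S"
  proof (rule linearI)
    fix x y t
    have "inner z (S (x + y)) = inner z (S x + S y)" "inner z (S (t *\<^sub>R x)) = inner z (t *\<^sub>R S x)" for z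
      by (simp_all add: inner_add_right flip: S)
    then show "S (x + y) = S x + S y" "S (t *\<^sub>R x) = t *\<^sub>R S x"
      by (metis vector_eq_rdot inner_commute)+
  qed
  then have bl: "bounded_linear S"
    using bound by (intro bounded_linear.intro bounded_linear_axioms.intro) auto
  show thesis
  proof
    show "inner (T x) y = inner x (Blinfun S y)" for x y
      by (simp add: bl bounded_linear_Blinfun_apply S)
    show "norm (Blinfun S) \<le> norm T"
      by (rule norm_blinfun_bound) (use bound in \<open>auto simp: bl bounded_linear_Blinfun_apply mult.commute\<close>)
  qed
qed

lemma inner_adjoint: "inner (blinfun_apply T x) y = inner x (adjoint T y)"
proof -
  obtain S where "\<forall>x y. inner (T x) y = inner x (blinfun_apply S y)"
    using adjoint_exists by blast
  then have "\<forall>x y. inner (T x) y = inner x (adjoint T y)"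
    unfolding adjoint_def by (rule someI)
  then show ?thesis by blast
qed

lemma inner_adjoint': "inner x (blinfun_apply T y) = inner (adjoint T x) y"
  by (metis inner_adjoint inner_commute)

lemma adjoint_eqI: "(\<And>x y. inner (blinfun_apply T x) y = inner x (blinfun_apply S y)) \<Longrightarrow> adjoint T = S"
  by (rule blinfun_eqI) (metis inner_adjoint vector_eq_rdot inner_commute)

lemma norm_adjoint_le: "norm (adjoint T) \<le> norm T"
  by (metis adjoint_exists adjoint_eqI)

lemma adjoint_adjoint [simp]: "adjoint (adjoint T) = T"
  by (rule adjoint_eqI) (metis inner_adjoint inner_commute)

lemma adjoint_add: "adjoint (S + T) = adjoint S + adjoint T"
  by (rule adjoint_eqI) (simp add: blinfun.add_left inner_add_left inner_add_right inner_adjoint)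

lemma adjoint_scaleR: "adjoint (t *\<^sub>R T) = t *\<^sub>R adjoint T"
  by (rule adjoint_eqI) (simp add: blinfun.scaleR_left inner_adjoint)

lemma adjoint_compose: "adjoint (S o\<^sub>L T) = adjoint T o\<^sub>L adjoint S"
  by (rule adjoint_eqI) (simp add: inner_adjoint)

lemma bounded_linear_adjoint: "bounded_linear (adjoint :: ('h::{real_inner, banach} \<Rightarrow>\<^sub>L 'h) \<Rightarrow> _)"
  by (rule bounded_linear_intro [where K = 1]) (auto simp: adjoint_add adjoint_scaleR norm_adjoint_le)

section \<open>States dominating a functional\<close>

lemmas compose_add_left = bounded_bilinear.add_left [OF bounded_bilinear_blinfun_compose]
  and compose_add_right = bounded_bilinear.add_right [OF bounded_bilinear_blinfun_compose]
  and compose_diff_right = bounded_bilinear.diff_right [OF bounded_bilinear_blinfun_compose]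
  and compose_minus_left = bounded_bilinear.minus_left [OF bounded_bilinear_blinfun_compose]
  and compose_minus_right = bounded_bilinear.minus_right [OF bounded_bilinear_blinfun_compose]
  and compose_scaleR_left = bounded_bilinear.scaleR_left [OF bounded_bilinear_blinfun_compose]
  and compose_scaleR_right = bounded_bilinear.scaleR_right [OF bounded_bilinear_blinfun_compose]

lemma compose_assoc: "(a o\<^sub>L b) o\<^sub>L c = a o\<^sub>L (b o\<^sub>L c)"
  by (rule blinfun_eqI) simp

text \<open>A linear functional below this one is a positive functional of norm at most one, for the order
  given by quadratic forms.\<close>

definition numerical_sup :: "('h::{real_inner, banach} \<Rightarrow>\<^sub>L 'h) \<Rightarrow> real" where
  "numerical_sup T = (SUP \<xi>\<in>{\<xi>. norm \<xi> \<le> 1}. inner (T \<xi>) \<xi>)"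

lemma inner_le_norm: "inner (blinfun_apply T \<xi>) \<xi> \<le> norm T * (norm \<xi>)\<^sup>2"
proof -
  have "inner (T \<xi>) \<xi> \<le> norm (T \<xi>) * norm \<xi>" by (rule norm_cauchy_schwarz)
  also have "\<dots> \<le> (norm T * norm \<xi>) * norm \<xi>"
    by (intro mult_right_mono norm_blinfun) simp
  finally show ?thesis by (simp add: power2_eq_square mult_ac)
qed

lemma numerical_sup_upper: "norm \<xi> \<le> 1 \<Longrightarrow> inner (blinfun_apply T \<xi>) \<xi> \<le> numerical_sup T"
  unfolding numerical_sup_def
proof (rule cSUP_upper)
  have "inner (blinfun_apply T \<eta>) \<eta> \<le> norm T" if "norm \<eta> \<le> 1" for \<eta>
    using inner_le_norm [of T \<eta>] mult_left_mono [of "(norm \<eta>)\<^sup>2" 1 "norm T"] that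
    by (simp add: power_le_one)
  then show "bdd_above ((\<lambda>\<xi>. inner (blinfun_apply T \<xi>) \<xi>) ` {\<xi>. norm \<xi> \<le> 1})"
    by (intro bdd_aboveI2) auto
qed simp

lemma numerical_sup_least: "(\<And>\<xi>. norm \<xi> \<le> 1 \<Longrightarrow> inner (blinfun_apply T \<xi>) \<xi> \<le> k) \<Longrightarrow> numerical_sup T \<le> k"
  unfolding numerical_sup_def by (rule cSUP_least) (auto intro: exI [where x = 0])

lemma numerical_sup_mono:
  "(\<And>\<xi>. inner (blinfun_apply T \<xi>) \<xi> \<le> inner (blinfun_apply T' \<xi>) \<xi>) \<Longrightarrow> numerical_sup T \<le> numerical_sup T'"
  by (meson numerical_sup_least numerical_sup_upper order_trans)

lemma numerical_sup_le_norm: "numerical_sup T \<le> norm T"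
proof (rule numerical_sup_least)
  fix \<xi> :: 'a assume "norm \<xi> \<le> 1"
  then have "norm T * (norm \<xi>)\<^sup>2 \<le> norm T"
    using mult_left_mono [of "(norm \<xi>)\<^sup>2" 1 "norm T"] by (simp add: power_le_one)
  then show "inner (blinfun_apply T \<xi>) \<xi> \<le> norm T"
    using inner_le_norm [of T \<xi>] by simp
qed

lemma sublinear_numerical_sup: "sublinear (numerical_sup :: ('h::{real_inner, banach} \<Rightarrow>\<^sub>L 'h) \<Rightarrow> real)"
  unfolding sublinear_def
proof (intro conjI allI impI)
  show "numerical_sup (S + T) \<le> numerical_sup S + numerical_sup T" for S T :: "'h \<Rightarrow>\<^sub>L 'h"
    by (rule numerical_sup_least)
      (simp add: blinfun.add_left inner_add_left add_mono numerical_sup_upper)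
  have le: "numerical_sup (t *\<^sub>R T) \<le> t * numerical_sup T" if "0 < t" for t and T :: "'h \<Rightarrow>\<^sub>L 'h"
    by (rule numerical_sup_least) (use that in \<open>simp add: blinfun.scaleR_left numerical_sup_upper\<close>)
  show "numerical_sup (t *\<^sub>R T) = t * numerical_sup T" if "0 < t" for t and T :: "'h \<Rightarrow>\<^sub>L 'h"
    using le [OF that, of T] le [of "inverse t" "t *\<^sub>R T"] that by (simp add: field_simps)
qed

lemma inner_adjoint_compose_self:
  "inner (blinfun_apply (adjoint y o\<^sub>L y) \<xi>) \<xi> = (norm (y \<xi>))\<^sup>2"
  by (simp add: power2_norm_eq_inner flip: inner_adjoint')

lemma norm_square_le_numerical_sup: "(norm y)\<^sup>2 \<le> numerical_sup (adjoint y o\<^sub>L y)"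
proof -
  let ?s = "numerical_sup (adjoint y o\<^sub>L y)"
  have s: "0 \<le> ?s"
    using numerical_sup_upper [of 0 "adjoint y o\<^sub>L y"] by (simp add: blinfun.zero_right)
  have "norm y \<le> sqrt ?s"
  proof (rule norm_blinfun_bound)
    fix \<xi>
    show "norm (y \<xi>) \<le> sqrt ?s * norm \<xi>"
    proof (cases "\<xi> = 0")
      case False
      have "(norm (y (\<xi> /\<^sub>R norm \<xi>)))\<^sup>2 \<le> ?s"
        using numerical_sup_upper [of "\<xi> /\<^sub>R norm \<xi>" "adjoint y o\<^sub>L y"] False
        unfolding inner_adjoint_compose_self by simp
      then have "norm (y (\<xi> /\<^sub>R norm \<xi>)) \<le> sqrt ?s"
        by (rule real_le_rsqrt)
      then show ?thesis
        using False by (simp add: blinfun.scaleR_right divide_simps mult.commute)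
    qed (simp add: blinfun.zero_right)
  qed (use s in simp)
  then show ?thesis
    using s by (metis norm_ge_zero power_mono real_sqrt_pow2)
qed

locale state =
  fixes F :: "('h::{real_inner, banach} \<Rightarrow>\<^sub>L 'h) \<Rightarrow> real"
  assumes linear: "linear F" and le_numerical_sup: "F T \<le> numerical_sup T"

text \<open>Joint convexity of \<open>(a, s) \<mapsto> \<parallel>a\<parallel>\<^sup>2 / s\<close>; it makes the family of constraints in the next lemma
  closed under sums.\<close>

lemma weighted_square_sum:
  fixes a b :: "'a::real_inner"
  assumes "0 < s" "0 < t"
  shows "(norm (a + b))\<^sup>2 / (s + t) \<le> (norm a)\<^sup>2 / s + (norm b)\<^sup>2 / t"
proof -
  have "(norm (t *\<^sub>R a - s *\<^sub>R b))\<^sup>2 = t * t * inner a a + s * s * inner b b - 2 * s * t * inner a b"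
    by (simp add: power2_norm_eq_inner inner_diff inner_commute [of b a] algebra_simps)
  then have sq: "2 * s * t * inner a b \<le> t * t * inner a a + s * s * inner b b"
    by (metis diff_ge_0_iff_ge zero_le_power2)
  have "(inner a a + 2 * inner a b + inner b b) * (s * t) \<le> (t * inner a a + s * inner b b) * (s + t)"
    using sq by (simp add: algebra_simps)
  then show ?thesis
    using assms
    by (simp add: power2_norm_eq_inner inner_add inner_commute [of b a] divide_simps mult_ac add_ac)
qed

text \<open>The inequality \<open>(f y)\<^sup>2 \<le> F (y* y)\<close> follows from the constraints \<open>2 f y - s \<le> F (y* y) / s\<close> for all
  \<open>s > 0\<close> by taking \<open>s = \<bar>f y\<bar>\<close>. The constraints are compatible with \<open>F T \<le> numerical_sup T\<close> because
  \<open>2 f y - s \<le> 2 \<parallel>y\<parallel> - s \<le> \<parallel>y\<parallel>\<^sup>2 / s\<close>.\<close>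

lemma dominating_state:
  fixes f :: "('h::{real_inner, banach} \<Rightarrow>\<^sub>L 'h) \<Rightarrow>\<^sub>L real"
  assumes f: "norm f \<le> 1"
  obtains F where "state F" "\<And>y. (f y)\<^sup>2 \<le> F (adjoint y o\<^sub>L y)"
proof -
  let ?N = "numerical_sup :: ('h \<Rightarrow>\<^sub>L 'h) \<Rightarrow> real"
  define m where "m y s = (1 / s) *\<^sub>R (adjoint y o\<^sub>L y)" for y :: "'h \<Rightarrow>\<^sub>L 'h" and s :: real
  have inner_m: "inner (m y s \<xi>) \<xi> = (norm (y \<xi>))\<^sup>2 / s" for y s \<xi>
    using inner_adjoint_compose_self [of y \<xi>] by (simp add: m_def blinfun.scaleR_left)
  define C where "C = {(m y s, 2 * f y - s) | y s. 0 < s}"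
  have memC: "(m y s, 2 * f y - s) \<in> C" if "0 < s" for y s
    using that by (auto simp: C_def)
  have C: "dominated_cone ?N C"
    unfolding dominated_cone_def
  proof (intro conjI)
    show "C \<noteq> {}" using memC [of 1] by auto
    show "\<forall>t>0. \<forall>(n, c)\<in>C. (t *\<^sub>R n, t * c) \<in> C"
    proof clarify
      fix t :: real and n c assume t: "0 < t" and "(n, c) \<in> C"
      then obtain y s where ys: "n = m y s" "c = 2 * f y - s" "0 < s" by (auto simp: C_def)
      have "(m (t *\<^sub>R y) (t * s), 2 * f (t *\<^sub>R y) - t * s) \<in> C"
        using t ys by (intro memC) simp
      moreover have "m (t *\<^sub>R y) (t * s) = t *\<^sub>R n"
        using t ys by (simp add: m_def adjoint_scaleR compose_scaleR_left compose_scaleR_right)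
      moreover have "2 * f (t *\<^sub>R y) - t * s = t * c"
        unfolding ys(2) by (simp add: blinfun.scaleR_right algebra_simps)
      ultimately show "(t *\<^sub>R n, t * c) \<in> C" by simp
    qed
    show "\<forall>(n, c)\<in>C. \<forall>(n', c')\<in>C. \<exists>(k, d)\<in>C. c + c' \<le> d \<and> (\<forall>w. ?N (w + k) \<le> ?N (w + (n + n')))"
    proof clarify
      fix n c n' c' assume "(n, c) \<in> C" "(n', c') \<in> C"
      then obtain y s y' s' where ys: "n = m y s" "c = 2 * f y - s" "0 < s"
        "n' = m y' s'" "c' = 2 * f y' - s'" "0 < s'"
        by (auto simp: C_def)
      have "?N (w + m (y + y') (s + s')) \<le> ?N (w + (n + n'))" for w
        by (rule numerical_sup_mono)
          (use weighted_square_sum [of s s'] ys in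
            \<open>simp add: blinfun.add_left inner_add_left inner_m\<close>)
      moreover have "c + c' \<le> 2 * f (y + y') - (s + s')"
        by (simp add: ys blinfun.add_right)
      ultimately show "\<exists>(k, d)\<in>C. c + c' \<le> d \<and> (\<forall>w. ?N (w + k) \<le> ?N (w + (n + n')))"
        using memC [of "s + s'" "y + y'"] ys by (intro bexI) auto
    qed
    show "\<forall>(n, c)\<in>C. c \<le> ?N n"
    proof clarify
      fix n c assume "(n, c) \<in> C"
      then obtain y s where ys: "n = m y s" "c = 2 * f y - s" "0 < s" by (auto simp: C_def)
      have "f y \<le> norm y"
        using norm_blinfun [of f y] mult_right_mono [OF f, of "norm y"] by simp
      moreover have "2 * norm y - s \<le> (norm y)\<^sup>2 / s"
      proof -
        have "0 \<le> (norm y - s)\<^sup>2 / s" using ys(3) by simp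
        then show ?thesis
          using ys(3) by (simp add: power2_eq_square field_simps)
      qed
      moreover have "(norm y)\<^sup>2 / s \<le> ?N n"
        using norm_square_le_numerical_sup [of y] ys(3)
          sublinear_scaleR [OF sublinear_numerical_sup, of "1 / s" "adjoint y o\<^sub>L y"]
        by (simp add: ys(1) m_def field_simps)
      ultimately show "c \<le> ?N n" using ys by linarith
    qed
  qed
  obtain F where F: "linear F" "\<And>T. F T \<le> ?N T" "\<And>n c. (n, c) \<in> C \<Longrightarrow> c \<le> F n"
    using mazur_orlicz [OF sublinear_numerical_sup C] by blast
  have dom: "2 * f y - s \<le> F (adjoint y o\<^sub>L y) / s" if "0 < s" for y s
    using F(3) [OF memC [OF that, of y]] by (simp add: m_def linear_scale [OF F(1)])
  have "(f y)\<^sup>2 \<le> F (adjoint y o\<^sub>L y)" for y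
  proof -
    consider "f y = 0" | "0 < f y" | "0 < f (- y)"
      by (metis blinfun.minus_right neg_0_less_iff_less linorder_neqE_linordered_idom)
    then show ?thesis
    proof cases
      case 1
      have "F (- (adjoint y o\<^sub>L y)) \<le> 0"
        by (rule order_trans [OF F(2)], rule numerical_sup_least)
          (use inner_adjoint_compose_self [of y] in \<open>simp add: blinfun.minus_left\<close>)
      then show ?thesis
        by (simp add: 1 linear_neg [OF F(1)])
    next
      case 2
      then show ?thesis
        using dom [OF 2, of y] by (simp add: field_simps power2_eq_square)
    next
      case 3
      have "adjoint (- y) o\<^sub>L (- y) = adjoint y o\<^sub>L y"
        using adjoint_scaleR [of "-1" y]
        by (simp add: compose_minus_left compose_minus_right)
      then show ?thesis
        using dom [OF 3, of "- y"] 3 by (simp add: blinfun.minus_right field_simps power2_eq_square)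
    qed
  qed
  with F that [of F] show thesis by (simp add: state_def)
qed

context state
begin

lemma mono: "(\<And>\<xi>. inner (blinfun_apply S \<xi>) \<xi> \<le> inner (blinfun_apply T \<xi>) \<xi>) \<Longrightarrow> F S \<le> F T"
proof -
  assume *: "\<And>\<xi>. inner (blinfun_apply S \<xi>) \<xi> \<le> inner (blinfun_apply T \<xi>) \<xi>"
  have "F (S - T) \<le> numerical_sup (S - T)" by (rule le_numerical_sup)
  also have "\<dots> \<le> 0"
    by (rule numerical_sup_least) (use * in \<open>simp add: blinfun.diff_left inner_diff_left\<close>)
  finally show ?thesis by (simp add: linear_diff [OF linear])
qed

lemma adjoint_invariant: "F (adjoint T) = F T"
  by (rule antisym; rule mono; metis inner_adjoint inner_commute order_refl)

definition ip :: "('h \<Rightarrow>\<^sub>L 'h) \<Rightarrow> ('h \<Rightarrow>\<^sub>L 'h) \<Rightarrow> real" where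
  "ip x y = F (adjoint y o\<^sub>L x)"

sublocale semi_inner ip
proof
  show "ip (x + y) z = ip x z + ip y z" for x y z
    by (simp add: ip_def compose_add_right linear_add [OF linear])
  show "ip (t *\<^sub>R x) z = t * ip x z" for t x z
    by (simp add: ip_def compose_scaleR_right linear_scale [OF linear])
  show "ip x y = ip y x" for x y
    using adjoint_invariant [of "adjoint y o\<^sub>L x"] by (simp add: ip_def adjoint_compose)
  show "0 \<le> ip x x" for x
    using mono [of 0 "adjoint x o\<^sub>L x"] inner_adjoint_compose_self [of x] linear_0 [OF linear]
    by (simp add: ip_def)
qed

lemma ip_compose_left: "ip (a o\<^sub>L x) y = ip x (adjoint a o\<^sub>L y)"
  by (simp add: ip_def adjoint_compose compose_assoc)

lemma nrm_compose: "nrm (a o\<^sub>L x) \<le> norm a * nrm x"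
proof (rule power2_le_imp_le)
  have "F (adjoint (a o\<^sub>L x) o\<^sub>L (a o\<^sub>L x)) \<le> F ((norm a)\<^sup>2 *\<^sub>R (adjoint x o\<^sub>L x))"
  proof (rule mono)
    fix \<xi>
    have "(norm (a (x \<xi>)))\<^sup>2 \<le> (norm a * norm (x \<xi>))\<^sup>2"
      by (intro power_mono norm_blinfun) simp
    then show "inner (blinfun_apply (adjoint (a o\<^sub>L x) o\<^sub>L (a o\<^sub>L x)) \<xi>) \<xi>
        \<le> inner (blinfun_apply ((norm a)\<^sup>2 *\<^sub>R (adjoint x o\<^sub>L x)) \<xi>) \<xi>"
      using inner_adjoint_compose_self [of x \<xi>] inner_adjoint_compose_self [of "a o\<^sub>L x" \<xi>]
      by (simp add: blinfun.scaleR_left power_mult_distrib)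
  qed
  then show "(nrm (a o\<^sub>L x))\<^sup>2 \<le> (norm a * nrm x)\<^sup>2"
    by (simp add: nrm_square power_mult_distrib ip_def linear_scale [OF linear])
qed (simp add: nrm_nonneg)

lemma nrm_le_norm: "nrm x \<le> norm x"
proof (rule power2_le_imp_le)
  have "F (adjoint x o\<^sub>L x) \<le> norm (adjoint x o\<^sub>L x)"
    using le_numerical_sup numerical_sup_le_norm order_trans by blast
  also have "\<dots> \<le> norm (adjoint x) * norm x"
    by (rule norm_blinfun_compose)
  also have "\<dots> \<le> norm x * norm x"
    by (intro mult_right_mono norm_adjoint_le) simp
  finally show "(nrm x)\<^sup>2 \<le> (norm x)\<^sup>2"
    unfolding nrm_square ip_def by (simp add: power2_eq_square)
qed simp

lemma ip_le_norm: "\<bar>ip (a o\<^sub>L x) y\<bar> \<le> norm a * nrm x * nrm y"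
  using Cauchy_Schwarz [of "a o\<^sub>L x" y] mult_right_mono [OF nrm_compose nrm_nonneg, of a x y]
  by simp

end

text \<open>A functional of norm at most one is almost a vector functional in the GNS space of a state.\<close>

lemma vector_state:
  fixes f :: "('h::{real_inner, banach} \<Rightarrow>\<^sub>L 'h) \<Rightarrow>\<^sub>L real"
  assumes f: "norm f \<le> 1" and \<kappa>: "0 < \<kappa>"
  obtains F a where "state F" "\<And>y. \<bar>f y - state.ip F y a\<bar> \<le> \<kappa> * semi_inner.nrm (state.ip F) y"
    "semi_inner.nrm (state.ip F) a \<le> 1 + \<kappa>"
proof -
  obtain F where F: "state F" "\<And>y. (f y)\<^sup>2 \<le> F (adjoint y o\<^sub>L y)"
    using dominating_state [OF f] by blast
  interpret state F by (rule F(1))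
  have bound: "\<bar>f y\<bar> \<le> nrm y" for y
    using F(2) [of y] by (simp add: nrm_def ip_def real_le_rsqrt)
  obtain a where a: "\<And>y. \<bar>f y - ip a y\<bar> \<le> \<kappa> * nrm y"
    using approximate_Riesz [of "blinfun_apply f" 1 \<kappa>] bound \<kappa>
      bounded_linear.linear [OF blinfun.bounded_linear_right] by auto
  have "nrm a * nrm a \<le> (1 + \<kappa>) * nrm a"
    using a [of a] bound [of a] nrm_square [of a] by (simp add: power2_eq_square algebra_simps)
  then have "nrm a \<le> 1 + \<kappa>"
    using nrm_nonneg [of a] \<kappa> by (cases "nrm a = 0") auto
  with F(1) a that [of F a] show thesis by (simp add: commute)
qed

section \<open>Projections in the bidual and norm estimates\<close>

definition lmult :: "('h::real_normed_vector \<Rightarrow>\<^sub>L 'h) \<Rightarrow> ('h \<Rightarrow>\<^sub>L 'h) \<Rightarrow>\<^sub>L ('h \<Rightarrow>\<^sub>L 'h)" where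
  "lmult a = Blinfun (\<lambda>x. a o\<^sub>L x)"

definition rmult :: "('h::real_normed_vector \<Rightarrow>\<^sub>L 'h) \<Rightarrow> ('h \<Rightarrow>\<^sub>L 'h) \<Rightarrow>\<^sub>L ('h \<Rightarrow>\<^sub>L 'h)" where
  "rmult a = Blinfun (\<lambda>x. x o\<^sub>L a)"

lemma lmult_apply [simp]: "lmult a x = a o\<^sub>L x"
  unfolding lmult_def
  by (simp add: bounded_linear_Blinfun_apply bounded_bilinear.bounded_linear_right [OF bounded_bilinear_blinfun_compose])

lemma rmult_apply [simp]: "rmult a x = x o\<^sub>L a"
  unfolding rmult_def
  by (simp add: bounded_linear_Blinfun_apply bounded_bilinear.bounded_linear_left [OF bounded_bilinear_blinfun_compose])

text \<open>The adjoint as an element of the space of bounded operators, so that a functional can be composed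
  with it.\<close>

definition adjoint_map :: "('h::{real_inner, banach} \<Rightarrow>\<^sub>L 'h) \<Rightarrow>\<^sub>L ('h \<Rightarrow>\<^sub>L 'h)" where
  "adjoint_map = Blinfun adjoint"

lemma adjoint_map_apply [simp]: "adjoint_map x = adjoint x"
  unfolding adjoint_map_def by (simp add: bounded_linear_Blinfun_apply bounded_linear_adjoint)

text \<open>The traces of \<open>p\<^sup>2 = p\<close>, \<open>p* = p\<close> and \<open>ep = pe = p\<close> on real functionals. The functional \<open>f o\<^sub>L lmult a\<close>
  is \<open>x \<mapsto> f (a x)\<close>, so \<open>pp (f o\<^sub>L lmult a)\<close> is the value of \<open>ap\<close> at \<open>f\<close> and \<open>pp (f o\<^sub>L rmult a)\<close> that of \<open>pa\<close>.\<close>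

locale bidual_projection =
  fixes pp :: "(('h::{real_inner, banach} \<Rightarrow>\<^sub>L 'h) \<Rightarrow>\<^sub>L real) \<Rightarrow>\<^sub>L real"
    and e :: "'h \<Rightarrow>\<^sub>L 'h"
  assumes idempotent: "(\<And>a. blinfun_apply g a = pp (f o\<^sub>L lmult a)) \<Longrightarrow> pp g = pp f"
    and selfadjoint: "pp (f o\<^sub>L adjoint_map) = pp f"
    and unit_left: "pp (f o\<^sub>L lmult e) = pp f"
    and unit_right: "pp (f o\<^sub>L rmult e) = pp f"
    and unit_idempotent: "e o\<^sub>L e = e"
    and norm_unit: "norm e \<le> 1"
begin

definition commutes :: "('h \<Rightarrow>\<^sub>L 'h) \<Rightarrow> bool" where
  "commutes c \<longleftrightarrow> c o\<^sub>L e = c \<and> (\<forall>f. pp (f o\<^sub>L rmult c) = pp (f o\<^sub>L lmult c))"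

definition left_fixed :: "('h \<Rightarrow>\<^sub>L 'h) \<Rightarrow> bool" where
  "left_fixed z \<longleftrightarrow> z o\<^sub>L e = z \<and> e o\<^sub>L z = z \<and> (\<forall>f. pp (f o\<^sub>L rmult z) = blinfun_apply f z)"

lemma commutes_unit: "commutes e"
  by (simp add: commutes_def unit_idempotent unit_left unit_right)

end

locale projection_in_state = bidual_projection pp e + state F
  for pp :: "(('h::{real_inner, banach} \<Rightarrow>\<^sub>L 'h) \<Rightarrow>\<^sub>L real) \<Rightarrow>\<^sub>L real" and e
    and F :: "('h \<Rightarrow>\<^sub>L 'h) \<Rightarrow> real"
begin

text \<open>The vector functional \<open>a \<mapsto> \<langle>a x, y\<rangle>\<close>.\<close>

definition vf :: "('h \<Rightarrow>\<^sub>L 'h) \<Rightarrow> ('h \<Rightarrow>\<^sub>L 'h) \<Rightarrow> ('h \<Rightarrow>\<^sub>L 'h) \<Rightarrow>\<^sub>L real" where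
  "vf x y = Blinfun (\<lambda>a. ip (a o\<^sub>L x) y)"

lemma vf_apply [simp]: "vf x y a = ip (a o\<^sub>L x) y"
proof -
  have "bounded_linear (\<lambda>a. ip (a o\<^sub>L x) y)"
    by (rule bounded_linear_intro [where K = "nrm x * nrm y"])
      (use ip_le_norm [of _ x y] in \<open>simp_all add: compose_add_left compose_scaleR_left expand mult_ac\<close>)
  then show ?thesis
    unfolding vf_def by (simp add: bounded_linear_Blinfun_apply)
qed

lemma norm_vf: "norm (vf x y) \<le> nrm x * nrm y"
  by (rule norm_blinfun_bound) (use ip_le_norm [of _ x y] nrm_nonneg in \<open>simp_all add: mult_ac\<close>)

text \<open>The form \<open>\<langle>p x, y\<rangle>\<close>; the vector \<open>p x\<close> itself lives only in the completion.\<close>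

definition B :: "('h \<Rightarrow>\<^sub>L 'h) \<Rightarrow> ('h \<Rightarrow>\<^sub>L 'h) \<Rightarrow> real" where
  "B x y = pp (vf x y)"

lemma B_add_right: "B x (y + y') = B x y + B x y'"
proof -
  have "vf x (y + y') = vf x y + vf x y'"
    by (rule blinfun_eqI) (simp add: expand blinfun.add_left)
  then show ?thesis by (simp add: B_def blinfun.add_right)
qed

lemma B_scale_right: "B x (t *\<^sub>R y) = t * B x y"
proof -
  have "vf x (t *\<^sub>R y) = t *\<^sub>R vf x y"
    by (rule blinfun_eqI) (simp add: expand blinfun.scaleR_left)
  then show ?thesis by (simp add: B_def blinfun.scaleR_right)
qed

lemma B_commute: "B x y = B y x"
proof -
  have "vf x y o\<^sub>L adjoint_map = vf y x"
    by (rule blinfun_eqI) (use ip_compose_left [of "adjoint _" x y] commute in simp)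
  then show ?thesis using selfadjoint [of "vf x y"] by (simp add: B_def)
qed

lemma B_diff_left: "B (x - x') y = B x y - B x' y"
  using B_add_right [of y x "- x'"] B_scale_right [of y "-1" x']
  by (simp add: B_commute [of _ y])

lemma vf_lmult: "vf x y o\<^sub>L lmult a = vf x (adjoint a o\<^sub>L y)"
  by (rule blinfun_eqI) (simp add: compose_assoc ip_compose_left)

lemma vf_rmult: "vf x y o\<^sub>L rmult a = vf (a o\<^sub>L x) y"
  by (rule blinfun_eqI) (simp add: compose_assoc)

lemma B_unit_right: "B x (adjoint e o\<^sub>L y) = B x y"
  using unit_left [of "vf x y"] by (simp add: B_def vf_lmult)

lemma B_commutes: "commutes c \<Longrightarrow> B (c o\<^sub>L x) y = B x (adjoint c o\<^sub>L y)"
  by (simp add: B_def commutes_def flip: vf_lmult vf_rmult)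

lemma B_left_fixed: "left_fixed z \<Longrightarrow> B (z o\<^sub>L x) y = ip (z o\<^sub>L x) y"
  by (simp add: B_def left_fixed_def flip: vf_rmult)

lemma pp_le: "norm f \<le> k \<Longrightarrow> \<bar>pp f\<bar> \<le> norm pp * k"
  using norm_blinfun [of pp f] mult_left_mono [of "norm f" k "norm pp"] by simp

lemma B_le: "\<bar>B x y\<bar> \<le> norm pp * (nrm x * nrm y)"
  unfolding B_def by (rule pp_le [OF norm_vf])

lemma nrm_adjoint_compose: "nrm (adjoint a o\<^sub>L y) \<le> norm a * nrm y"
  using nrm_compose [of "adjoint a" y] mult_right_mono [OF norm_adjoint_le [of a] nrm_nonneg [of y]] by simp

text \<open>Here \<open>u\<close> is an approximation to the missing vector \<open>p x\<close>. That \<open>p u\<close> is close to \<open>u\<close> follows from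
  idempotence: \<open>\<langle>p x, y\<rangle>\<close> is the value of \<open>p\<close> at \<open>a \<mapsto> \<langle>p x, a* y\<rangle>\<close>, which is close in norm to the vector
  functional of \<open>u\<close> and \<open>y\<close>.\<close>

lemma approximate_compression:
  assumes \<kappa>: "0 < \<kappa>"
  obtains u where "e o\<^sub>L u = u" "\<And>y. \<bar>B x y - ip u y\<bar> \<le> \<kappa> * nrm y" "\<And>y. \<bar>B u y - ip u y\<bar> \<le> \<kappa> * nrm y"
proof -
  define \<mu> where "\<mu> = \<kappa> / (norm pp + 1)"
  have den: "0 < norm pp + 1" by (simp add: add_nonneg_pos)
  have \<mu>: "0 < \<mu>" "(norm pp + 1) * \<mu> = \<kappa>"
    using \<kappa> den by (simp_all add: \<mu>_def)
  have "linear (B x)"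
    by (rule linearI) (simp_all add: B_add_right B_scale_right)
  then obtain a where a: "\<And>y. \<bar>B x y - ip a y\<bar> \<le> \<mu> * nrm y"
    using approximate_Riesz [of "B x" "norm pp * nrm x" \<mu>] B_le [of x] \<mu> by (auto simp: mult.assoc)
  define u where "u = e o\<^sub>L a"
  have u: "\<bar>B x y - ip u y\<bar> \<le> \<mu> * nrm y" for y
  proof -
    have "nrm (adjoint e o\<^sub>L y) \<le> nrm y"
      using nrm_adjoint_compose [of e y] mult_right_mono [OF norm_unit nrm_nonneg [of y]] by simp
    then have "\<mu> * nrm (adjoint e o\<^sub>L y) \<le> \<mu> * nrm y"
      using \<mu> by simp
    then show ?thesis
      using a [of "adjoint e o\<^sub>L y"] by (simp add: u_def ip_compose_left B_unit_right)
  qed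
  have Bu: "\<bar>B u y - B x y\<bar> \<le> norm pp * (\<mu> * nrm y)" for y
  proof -
    define g where "g = Blinfun (\<lambda>a. B x (adjoint a o\<^sub>L y))"
    have "bounded_linear (\<lambda>a. B x (adjoint a o\<^sub>L y))"
    proof (rule bounded_linear_intro [where K = "norm pp * (nrm x * nrm y)"])
      fix a
      have "norm pp * (nrm x * nrm (adjoint a o\<^sub>L y)) \<le> norm pp * (nrm x * (norm a * nrm y))"
        by (intro mult_left_mono nrm_adjoint_compose nrm_nonneg norm_ge_zero)
      then show "norm (B x (adjoint a o\<^sub>L y)) \<le> norm a * (norm pp * (nrm x * nrm y))"
        using B_le [of x "adjoint a o\<^sub>L y"] by (simp add: mult_ac)
    qed (simp_all add: adjoint_add adjoint_scaleR compose_add_left compose_scaleR_left B_add_right B_scale_right)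
    then have g: "g a = B x (adjoint a o\<^sub>L y)" for a
      by (simp add: g_def bounded_linear_Blinfun_apply)
    have "pp g = B x y"
      unfolding B_def by (rule idempotent) (simp add: g B_def vf_lmult)
    moreover have "norm (vf u y - g) \<le> \<mu> * nrm y"
    proof (rule norm_blinfun_bound)
      fix a
      have "\<bar>ip u (adjoint a o\<^sub>L y) - B x (adjoint a o\<^sub>L y)\<bar> \<le> \<mu> * nrm (adjoint a o\<^sub>L y)"
        using u by (simp add: abs_minus_commute)
      also have "\<dots> \<le> \<mu> * (norm a * nrm y)"
        using \<mu> by (intro mult_left_mono nrm_adjoint_compose) simp
      finally show "norm ((vf u y - g) a) \<le> \<mu> * nrm y * norm a"
        by (simp add: blinfun.diff_left g ip_compose_left mult_ac)
    qed (use \<mu> nrm_nonneg in simp)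
    ultimately show ?thesis
      using pp_le [of "vf u y - g" "\<mu> * nrm y"] by (simp add: blinfun.diff_right B_def)
  qed
  show thesis
  proof
    show "e o\<^sub>L u = u" by (simp add: u_def unit_idempotent flip: compose_assoc)
    fix y
    have split: "\<kappa> * nrm y = norm pp * (\<mu> * nrm y) + \<mu> * nrm y"
      by (simp add: algebra_simps flip: \<mu>(2))
    have "0 \<le> norm pp * (\<mu> * nrm y)"
      using \<mu> nrm_nonneg by simp
    then show "\<bar>B x y - ip u y\<bar> \<le> \<kappa> * nrm y" "\<bar>B u y - ip u y\<bar> \<le> \<kappa> * nrm y"
      using u [of y] Bu [of y] unfolding split by linarith+
  qed
qed

end

text \<open>The functional \<open>f\<close> is approximately \<open>y \<mapsto> \<langle>y, a0\<rangle>\<close>, and on elements \<open>y = ye\<close> it is the vector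
  functional of \<open>e\<close> and \<open>a0\<close>. The vectors \<open>u\<close> and \<open>v\<close> approximate \<open>p e\<close> and \<open>p a0\<close>. The vectors
  \<open>s\<close> and \<open>t\<close> below then play the parts of \<open>q e\<close> and \<open>q a0\<close>.\<close>

locale compression = projection_in_state pp e F
  for pp :: "(('h::{real_inner, banach} \<Rightarrow>\<^sub>L 'h) \<Rightarrow>\<^sub>L real) \<Rightarrow>\<^sub>L real" and e
    and F :: "('h \<Rightarrow>\<^sub>L 'h) \<Rightarrow> real" +
  fixes f :: "('h \<Rightarrow>\<^sub>L 'h) \<Rightarrow>\<^sub>L real" and a0 u v :: "'h \<Rightarrow>\<^sub>L 'h" and \<kappa> :: real
  assumes \<kappa>: "0 < \<kappa>" "\<kappa> \<le> 1"
    and f_approx: "\<bar>f y - ip y a0\<bar> \<le> \<kappa> * nrm y" and nrm_a0: "nrm a0 \<le> 1 + \<kappa>"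
    and u_unit: "e o\<^sub>L u = u"
    and u_approx: "\<bar>B e y - ip u y\<bar> \<le> \<kappa> * nrm y" "\<bar>B u y - ip u y\<bar> \<le> \<kappa> * nrm y"
    and v_approx: "\<bar>B a0 y - ip v y\<bar> \<le> \<kappa> * nrm y" "\<bar>B v y - ip v y\<bar> \<le> \<kappa> * nrm y"
begin

definition s where "s = e - u"
definition t where "t = a0 - v"
text \<open>A bound, independent of \<open>\<kappa>\<close>, for all vectors that occur; the errors below are expressed through \<open>\<kappa> R\<close>.\<close>

definition R where "R = 2 * norm pp + 3"

lemma R: "3 \<le> R" "norm pp \<le> R" by (simp_all add: R_def)

lemma nrm_e: "nrm e \<le> 1"
  using nrm_le_norm [of e] norm_unit by simp

lemma compressed_bound:
  assumes "\<And>y. \<bar>B x y - ip w y\<bar> \<le> \<kappa> * nrm y" and x: "nrm x \<le> k"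
  shows "nrm w \<le> norm pp * k + \<kappa>"
proof -
  have "ip w w \<le> norm pp * (nrm x * nrm w) + \<kappa> * nrm w"
    using assms(1) [of w] B_le [of x w] by linarith
  also have "\<dots> \<le> norm pp * (k * nrm w) + \<kappa> * nrm w"
    using x by (intro add_mono mult_left_mono mult_right_mono nrm_nonneg) auto
  finally have "nrm w * nrm w \<le> (norm pp * k + \<kappa>) * nrm w"
    using nrm_square [of w] by (simp add: power2_eq_square algebra_simps)
  moreover have "0 \<le> norm pp * k + \<kappa>"
    using x nrm_nonneg [of x] \<kappa> by (auto intro!: add_nonneg_nonneg mult_nonneg_nonneg)
  ultimately show ?thesis
    using nrm_nonneg [of w] by (cases "nrm w = 0") auto
qed

lemma bounds: "nrm u \<le> R" "nrm v \<le> R" "nrm a0 \<le> R" "nrm s \<le> R" "nrm t \<le> R"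
proof -
  have a: "nrm a0 \<le> 2" using nrm_a0 \<kappa> by simp
  have u: "nrm u \<le> norm pp + 1"
    using compressed_bound [OF u_approx(1) nrm_e] \<kappa> by simp
  have v: "nrm v \<le> norm pp * 2 + 1"
    using compressed_bound [OF v_approx(1) a] \<kappa> by simp
  show "nrm u \<le> R" "nrm v \<le> R" "nrm a0 \<le> R"
    using u v a norm_ge_zero [of pp] unfolding R_def by linarith+
  show "nrm s \<le> R" "nrm t \<le> R"
    using u v a nrm_e nrm_diff [of e u] nrm_diff [of a0 v] norm_ge_zero [of pp]
    unfolding R_def s_def t_def by linarith+
qed

lemma pythagoras:
  assumes 1: "\<And>y. \<bar>B x y - ip w y\<bar> \<le> \<kappa> * nrm y" and 2: "\<And>y. \<bar>B w y - ip w y\<bar> \<le> \<kappa> * nrm y"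
  shows "(nrm w)\<^sup>2 + (nrm (x - w))\<^sup>2 \<le> (nrm x)\<^sup>2 + 2 * (\<kappa> * nrm x) + 2 * (\<kappa> * nrm w)"
proof -
  have "(nrm (x - w))\<^sup>2 = (nrm x)\<^sup>2 - 2 * ip w x + (nrm w)\<^sup>2"
    by (simp add: nrm_square expand commute [of x w])
  moreover have "\<bar>ip w x - ip w w\<bar> \<le> \<kappa> * nrm x + \<kappa> * nrm w"
    using 1 [of w] 2 [of x] B_commute [of x w] by linarith
  ultimately show ?thesis
    using nrm_square [of w] by linarith
qed

lemma err: "y \<le> R \<Longrightarrow> \<kappa> * y \<le> \<kappa> * R"
  using \<kappa> by simp

lemma squares_u: "(nrm u)\<^sup>2 + (nrm s)\<^sup>2 \<le> 1 + 4 * (\<kappa> * R)"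
proof -
  have "(nrm e)\<^sup>2 \<le> 1" using nrm_e nrm_nonneg [of e] by (simp add: power_le_one)
  then show ?thesis
    using pythagoras [OF u_approx] err [of "nrm e"] err [OF bounds(1)] nrm_e R
    unfolding s_def by linarith
qed

lemma squares_v: "(nrm v)\<^sup>2 + (nrm t)\<^sup>2 \<le> 1 + 7 * (\<kappa> * R)"
proof -
  have "(nrm a0)\<^sup>2 \<le> (1 + \<kappa>)\<^sup>2" using nrm_a0 nrm_nonneg [of a0] by (intro power_mono) auto
  also have "\<dots> = 1 + 2 * \<kappa> + \<kappa> * \<kappa>" by (simp add: power2_eq_square algebra_simps)
  also have "\<dots> \<le> 1 + 3 * \<kappa>" using mult_left_mono [of \<kappa> 1 \<kappa>] \<kappa> by simp
  also have "\<dots> \<le> 1 + \<kappa> * R" using mult_left_mono [of 3 R \<kappa>] R \<kappa> by (simp add: mult.commute)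
  finally have "(nrm a0)\<^sup>2 \<le> 1 + \<kappa> * R" .
  moreover have "0 \<le> \<kappa> * R" using \<kappa> R by simp
  ultimately show ?thesis
    using pythagoras [OF v_approx] err [OF bounds(3)] err [OF bounds(2)]
    unfolding t_def by linarith
qed

lemma le_of_square_le:
  assumes "0 \<le> k" "(y::real)\<^sup>2 \<le> 1 + k" shows "y \<le> 1 + k"
proof (cases "1 \<le> y")
  case True
  then have "y * 1 \<le> y * y" by (intro mult_left_mono) auto
  then show ?thesis using assms by (simp add: power2_eq_square)
qed (use assms in simp)

lemma pp_lmult_approx: "\<bar>pp (f o\<^sub>L lmult w) - ip (w o\<^sub>L u) a0\<bar> \<le> 2 * norm w * (\<kappa> * R)"
proof -
  let ?g = "(f o\<^sub>L lmult w) o\<^sub>L rmult e" and ?h = "vf e (adjoint w o\<^sub>L a0)"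
  have "norm (?g - ?h) \<le> \<kappa> * norm w"
  proof (rule norm_blinfun_bound)
    fix x
    have "nrm (w o\<^sub>L (x o\<^sub>L e)) \<le> norm w * nrm (x o\<^sub>L e)" by (rule nrm_compose)
    also have "\<dots> \<le> norm w * (norm x * nrm e)" by (intro mult_left_mono nrm_compose) simp
    also have "\<dots> \<le> norm w * (norm x * 1)" by (intro mult_left_mono nrm_e) simp_all
    finally have "\<kappa> * nrm (w o\<^sub>L (x o\<^sub>L e)) \<le> \<kappa> * (norm w * norm x)"
      using \<kappa> by simp
    then show "norm ((?g - ?h) x) \<le> \<kappa> * norm w * norm x"
      using f_approx [of "w o\<^sub>L (x o\<^sub>L e)"] by (simp add: blinfun.diff_left mult_ac flip: ip_compose_left)
  qed (use \<kappa> in simp)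
  then have 1: "\<bar>pp (f o\<^sub>L lmult w) - B e (adjoint w o\<^sub>L a0)\<bar> \<le> norm pp * (\<kappa> * norm w)"
    using pp_le [of "?g - ?h" "\<kappa> * norm w"] unit_right [of "f o\<^sub>L lmult w"]
    by (simp add: blinfun.diff_right B_def)
  have 2: "\<bar>B e (adjoint w o\<^sub>L a0) - ip (w o\<^sub>L u) a0\<bar> \<le> \<kappa> * (norm w * R)"
  proof -
    have "nrm (adjoint w o\<^sub>L a0) \<le> norm w * R"
      using nrm_adjoint_compose [of w a0] mult_left_mono [OF bounds(3), of "norm w"] by simp
    then have "\<kappa> * nrm (adjoint w o\<^sub>L a0) \<le> \<kappa> * (norm w * R)" using \<kappa> by simp
    then show ?thesis
      using u_approx(1) [of "adjoint w o\<^sub>L a0"] by (simp add: ip_compose_left)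
  qed
  have "norm pp * (\<kappa> * norm w) \<le> R * (\<kappa> * norm w)"
    using \<kappa> R by (intro mult_right_mono) auto
  then show ?thesis
    using 1 2 by (simp add: mult_ac)
qed

text \<open>The left-hand side is the value of \<open>qx\<close> at \<open>f\<close>, approximately \<open>\<langle>x, q a0\<rangle>\<close>.\<close>

lemma complement_contractive:
  "\<bar>f x - pp (f o\<^sub>L rmult x)\<bar> \<le> norm x + 10 * (norm x * (\<kappa> * R))"
proof -
  let ?g = "f o\<^sub>L rmult x"
  have "norm (?g - vf x a0) \<le> \<kappa> * norm x"
  proof (rule norm_blinfun_bound)
    fix a
    have "nrm (a o\<^sub>L x) \<le> norm a * norm x"
      using nrm_compose [of a x] mult_left_mono [OF nrm_le_norm [of x], of "norm a"] by simp
    then have "\<kappa> * nrm (a o\<^sub>L x) \<le> \<kappa> * (norm a * norm x)" using \<kappa> by simp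
    then show "norm ((?g - vf x a0) a) \<le> \<kappa> * norm x * norm a"
      using f_approx [of "a o\<^sub>L x"] by (simp add: blinfun.diff_left mult_ac)
  qed (use \<kappa> in simp)
  then have 1: "\<bar>pp ?g - B x a0\<bar> \<le> norm pp * (\<kappa> * norm x)"
    using pp_le [of "?g - vf x a0" "\<kappa> * norm x"] by (simp add: blinfun.diff_right B_def)
  have nx: "\<kappa> * nrm x \<le> \<kappa> * norm x" using nrm_le_norm [of x] \<kappa> by simp
  have 2: "\<bar>B x a0 - ip x v\<bar> \<le> \<kappa> * norm x" "\<bar>f x - ip x a0\<bar> \<le> \<kappa> * norm x"
    using v_approx(1) [of x] f_approx [of x] nx B_commute [of x a0] commute [of x v] by linarith+
  have 3: "\<bar>ip x a0 - ip x v\<bar> \<le> norm x + 7 * (norm x * (\<kappa> * R))"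
  proof -
    have "(nrm t)\<^sup>2 \<le> 1 + 7 * (\<kappa> * R)"
      using squares_v zero_le_power2 [of "nrm v"] by linarith
    then have "nrm t \<le> 1 + 7 * (\<kappa> * R)"
      by (rule le_of_square_le [rotated]) (use \<kappa> R in simp)
    then have "nrm x * nrm t \<le> norm x * (1 + 7 * (\<kappa> * R))"
      by (intro mult_mono nrm_le_norm nrm_nonneg norm_ge_zero)
    also have "\<dots> = norm x + 7 * (norm x * (\<kappa> * R))"
      by (simp add: distrib_left)
    finally have "nrm x * nrm t \<le> norm x + 7 * (norm x * (\<kappa> * R))" .
    moreover have "ip x t = ip x a0 - ip x v" by (simp add: t_def diff_right)
    ultimately show ?thesis
      using Cauchy_Schwarz [of x t] by linarith
  qed
  have 4: "norm pp * (\<kappa> * norm x) \<le> norm x * (\<kappa> * R)" "\<kappa> * norm x \<le> norm x * (\<kappa> * R)"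
    using mult_right_mono [OF R(2), of "\<kappa> * norm x"] mult_right_mono [of 1 R "\<kappa> * norm x"] R \<kappa>
    by (simp_all add: mult_ac)
  show ?thesis
    using 1 2 3 4 by linarith
qed

lemma products: "nrm u * nrm v + nrm s * nrm t \<le> 1 + 6 * (\<kappa> * R)"
proof -
  have "2 * (a * b) \<le> a\<^sup>2 + b\<^sup>2" for a b :: real
    using zero_le_power2 [of "a - b"] unfolding power2_diff by linarith
  from this [of "nrm u" "nrm v"] this [of "nrm s" "nrm t"] show ?thesis
    using squares_u squares_v mult_nonneg_nonneg [of \<kappa> R] \<kappa> R by linarith
qed

lemma weaken_error: "y \<le> k * R \<Longrightarrow> \<kappa> * y \<le> k * (\<kappa> * R)"
  using mult_left_mono [of y "k * R" \<kappa>] \<kappa> by (simp add: mult_ac)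

text \<open>Approximate orthogonality of \<open>q e\<close> to the range of \<open>p\<close>.\<close>

lemma B_s: "\<bar>B s y\<bar> \<le> 2 * (\<kappa> * nrm y)"
  unfolding s_def B_diff_left using u_approx [of y] by linarith

lemma left_fixed_compress:
  assumes "left_fixed z"
  shows "\<bar>ip (z o\<^sub>L x) a0 - ip (z o\<^sub>L x) v\<bar> \<le> \<kappa> * nrm (z o\<^sub>L x)"
  using B_left_fixed [OF assms, of x a0] v_approx(1) [of "z o\<^sub>L x"]
    B_commute [of "z o\<^sub>L x" a0] commute [of "z o\<^sub>L x" v] by linarith

lemma nrm_compose_le: "nrm x \<le> k \<Longrightarrow> nrm (c o\<^sub>L x) \<le> norm c * k"
  using nrm_compose [of c x] mult_left_mono [of "nrm x" k "norm c"] by simp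

lemma nrm_adjoint_compose_le: "nrm x \<le> k \<Longrightarrow> nrm (adjoint c o\<^sub>L x) \<le> norm c * k"
  using nrm_adjoint_compose [of c x] mult_left_mono [of "nrm x" k "norm c"] by simp

lemma commutes_compress:
  assumes "commutes c"
  shows "\<bar>B y (adjoint c o\<^sub>L a0) - ip (c o\<^sub>L y) v\<bar> \<le> \<kappa> * nrm (c o\<^sub>L y)"
  using B_commutes [OF assms, of y a0] v_approx(1) [of "c o\<^sub>L y"]
    B_commute [of "c o\<^sub>L y" a0] commute [of "c o\<^sub>L y" v] by linarith

text \<open>Because \<open>pwp = wp\<close>, the value of \<open>wp\<close> at \<open>f\<close> is approximately \<open>\<langle>w p e, p a0\<rangle>\<close>. The two summands \<open>c\<close>
  and \<open>cz\<close> of \<open>w\<close> need different reasons: \<open>c\<close> commutes with \<open>p\<close>, and \<open>pz = z\<close>.\<close>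

lemma corner_approx:
  assumes c: "commutes c" and z: "left_fixed z" and w: "w = c o\<^sub>L (e + z)"
  shows "\<bar>pp (f o\<^sub>L lmult w) - ip (w o\<^sub>L u) v\<bar> \<le> (2 * norm w + 2 * norm c + norm c * norm z) * (\<kappa> * R)"
proof -
  have "\<bar>ip (c o\<^sub>L u) a0 - ip (c o\<^sub>L u) v\<bar> \<le> \<kappa> * nrm (adjoint c o\<^sub>L a0) + \<kappa> * nrm (c o\<^sub>L u)"
    using commutes_compress [OF c, of u] u_approx(2) [of "adjoint c o\<^sub>L a0"] ip_compose_left [of c u a0]
    by linarith
  moreover have "\<kappa> * nrm (adjoint c o\<^sub>L a0) \<le> norm c * (\<kappa> * R)" "\<kappa> * nrm (c o\<^sub>L u) \<le> norm c * (\<kappa> * R)"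
    by (intro weaken_error nrm_adjoint_compose_le nrm_compose_le bounds)+
  moreover have "\<bar>ip (c o\<^sub>L (z o\<^sub>L u)) a0 - ip (c o\<^sub>L (z o\<^sub>L u)) v\<bar> \<le> \<kappa> * nrm (c o\<^sub>L (z o\<^sub>L u))"
    using commutes_compress [OF c, of "z o\<^sub>L u"] B_left_fixed [OF z, of u "adjoint c o\<^sub>L a0"]
      ip_compose_left [of c "z o\<^sub>L u" a0] by linarith
  moreover have "\<kappa> * nrm (c o\<^sub>L (z o\<^sub>L u)) \<le> (norm c * norm z) * (\<kappa> * R)"
  proof (rule weaken_error)
    show "nrm (c o\<^sub>L (z o\<^sub>L u)) \<le> norm c * norm z * R"
      unfolding mult.assoc by (intro nrm_compose_le bounds)
  qed
  moreover have "w o\<^sub>L u = (c o\<^sub>L u) + (c o\<^sub>L (z o\<^sub>L u))"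
    by (simp add: w compose_assoc compose_add_left compose_add_right u_unit)
  then have "ip (w o\<^sub>L u) a0 = ip (c o\<^sub>L u) a0 + ip (c o\<^sub>L (z o\<^sub>L u)) a0"
    and "ip (w o\<^sub>L u) v = ip (c o\<^sub>L u) v + ip (c o\<^sub>L (z o\<^sub>L u)) v"
    by (simp_all add: add_left)
  ultimately have "\<bar>ip (w o\<^sub>L u) a0 - ip (w o\<^sub>L u) v\<bar>
      \<le> norm c * (\<kappa> * R) + norm c * (\<kappa> * R) + (norm c * norm z) * (\<kappa> * R)"
    by linarith
  moreover have "(2 * norm w + 2 * norm c + norm c * norm z) * (\<kappa> * R) = 2 * norm w * (\<kappa> * R)
      + (norm c * (\<kappa> * R) + norm c * (\<kappa> * R) + (norm c * norm z) * (\<kappa> * R))"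
    by (simp add: algebra_simps)
  ultimately show ?thesis
    using pp_lmult_approx [of w] by linarith
qed

lemma corner_bound: "\<bar>ip (w o\<^sub>L u) v\<bar> \<le> norm w * (nrm u * nrm v)"
  using ip_le_norm [of w u v] by (simp add: mult_ac)

text \<open>The element \<open>r wp + cq\<close> is block diagonal, so its value at \<open>f\<close> is approximately
  \<open>r \<langle>w p e, p a0\<rangle> + \<langle>c q e, q a0\<rangle>\<close>, where \<open>\<parallel>r w\<parallel> \<le> 1\<close>. The bound on \<open>cq\<close> is used for the
  vector functional of \<open>q e\<close> and \<open>q a0\<close>; what remains is \<open>\<parallel>pe\<parallel>\<parallel>pa0\<parallel> + \<parallel>qe\<parallel>\<parallel>qa0\<parallel>\<close>, and by the Pythagorean
  relations for \<open>e\<close> and \<open>a0\<close> this is at most one.\<close>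

lemma block_diagonal_bound:
  assumes c: "commutes c" and cq: "\<And>g. \<bar>blinfun_apply g c - pp (g o\<^sub>L lmult c)\<bar> \<le> norm g"
    and z: "left_fixed z" and w: "w = c o\<^sub>L (e + z)"
    and r: "0 \<le> r" "r \<le> 1" "r * norm w \<le> 1"
  shows "\<bar>r * pp (f o\<^sub>L lmult w) + (f c - pp (f o\<^sub>L lmult c))\<bar>
    \<le> 1 + (6 + 2 * norm w + 10 * norm c + norm c * norm z) * (\<kappa> * R)"
proof -
  define D where "D = norm c * (\<kappa> * R)"
  define E where "E = (2 * norm w + 2 * norm c + norm c * norm z) * (\<kappa> * R)"
  have E: "0 \<le> E" using \<kappa> R by (simp add: E_def)
  have 1: "\<bar>r * pp (f o\<^sub>L lmult w)\<bar> \<le> nrm u * nrm v + E"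
  proof -
    have "\<bar>pp (f o\<^sub>L lmult w)\<bar> \<le> norm w * (nrm u * nrm v) + E"
      using corner_approx [OF c z w] corner_bound [of w] unfolding E_def by linarith
    then have "r * \<bar>pp (f o\<^sub>L lmult w)\<bar> \<le> r * (norm w * (nrm u * nrm v) + E)"
      using r by (intro mult_left_mono)
    also have "\<dots> = (r * norm w) * (nrm u * nrm v) + r * E"
      by (simp add: algebra_simps)
    also have "\<dots> \<le> 1 * (nrm u * nrm v) + 1 * E"
      using r E by (intro add_mono mult_right_mono mult_nonneg_nonneg nrm_nonneg)
    finally show ?thesis using r by (simp add: abs_mult)
  qed
  have ce: "c o\<^sub>L e = c" using c by (simp add: commutes_def)
  have 2: "\<bar>f c - ip c a0\<bar> \<le> D"
    using f_approx [of c] weaken_error [of "nrm c" "norm c"] nrm_compose_le [of e R c] nrm_e R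
    by (simp add: ce D_def)
  have 3: "\<bar>pp (f o\<^sub>L lmult c) - ip (c o\<^sub>L u) a0\<bar> \<le> 2 * D"
    using pp_lmult_approx [of c] by (simp add: D_def)
  have 4: "ip c a0 - ip (c o\<^sub>L u) a0 = ip (c o\<^sub>L s) t + ip (c o\<^sub>L s) v"
    by (simp add: s_def t_def compose_diff_right ce diff_left diff_right)
  have 5: "\<bar>ip (c o\<^sub>L s) t\<bar> \<le> nrm s * nrm t + 2 * D"
  proof -
    have "\<bar>ip (c o\<^sub>L s) t - B s (adjoint c o\<^sub>L t)\<bar> \<le> nrm s * nrm t"
      using cq [of "vf s t"] norm_vf [of s t] by (simp add: vf_lmult B_def)
    moreover have "\<kappa> * nrm (adjoint c o\<^sub>L t) \<le> D"
      unfolding D_def by (intro weaken_error nrm_adjoint_compose_le bounds)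
    ultimately show ?thesis
      using B_s [of "adjoint c o\<^sub>L t"] by linarith
  qed
  have 6: "\<bar>ip (c o\<^sub>L s) v\<bar> \<le> 3 * D"
  proof -
    have "\<kappa> * nrm (adjoint c o\<^sub>L a0) \<le> D" "\<kappa> * nrm (c o\<^sub>L s) \<le> D"
      unfolding D_def by (intro weaken_error nrm_adjoint_compose_le nrm_compose_le bounds)+
    then show ?thesis
      using commutes_compress [OF c, of s] B_s [of "adjoint c o\<^sub>L a0"] by linarith
  qed
  have "(6 + 2 * norm w + 10 * norm c + norm c * norm z) * (\<kappa> * R) = 6 * (\<kappa> * R) + E + 8 * D"
    by (simp add: E_def D_def algebra_simps)
  then show ?thesis
    using 1 2 3 4 5 6 products by linarith
qed

lemma corner_contractive:
  assumes z: "left_fixed z"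
  shows "\<bar>pp (f o\<^sub>L lmult (e + z))\<bar> \<le> norm (e + z) + (8 * norm (e + z) + 2 * norm e + norm e * norm z) * (\<kappa> * R)"
proof -
  have w: "e + z = e o\<^sub>L (e + z)"
    using z by (simp add: left_fixed_def compose_add_right unit_idempotent)
  have "0 \<le> nrm s * nrm t" by (simp add: nrm_nonneg)
  then have "norm (e + z) * (nrm u * nrm v) \<le> norm (e + z) * (1 + 6 * (\<kappa> * R))"
    using products by (intro mult_left_mono) auto
  moreover have "norm (e + z) * (1 + 6 * (\<kappa> * R)) + (2 * norm (e + z) + 2 * norm e + norm e * norm z) * (\<kappa> * R)
      = norm (e + z) + (8 * norm (e + z) + 2 * norm e + norm e * norm z) * (\<kappa> * R)"
    by (simp add: algebra_simps)
  ultimately show ?thesis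
    using corner_approx [OF commutes_unit z w] corner_bound [of "e + z"] by linarith
qed

text \<open>The left-hand side is the value of the corner \<open>z - zp\<close> at \<open>f\<close>. On the vector \<open>s\<close> in the range of \<open>q\<close> one
  has \<open>(e + z) s = s + z s\<close> with orthogonal summands, whence \<open>\<parallel>z s\<parallel>\<^sup>2 \<le> (m\<^sup>2 - 1) \<parallel>s\<parallel>\<^sup>2\<close>.\<close>

lemma off_diagonal_bound:
  assumes z: "left_fixed z" and m: "norm (e + z) \<le> m" "1 \<le> m"
  shows "\<bar>f z - pp (f o\<^sub>L lmult z)\<bar>
    \<le> sqrt ((m\<^sup>2 - 1) * (1 + 4 * (\<kappa> * R)) + 4 * norm z * (\<kappa> * R)) * (1 + 7 * (\<kappa> * R)) + 4 * norm z * (\<kappa> * R)"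
proof -
  define D where "D = norm z * (\<kappa> * R)"
  have ze: "z o\<^sub>L e = z" using z by (simp add: left_fixed_def)
  have es: "e o\<^sub>L s = s" by (simp add: s_def compose_diff_right unit_idempotent u_unit)
  have 1: "\<bar>f z - ip z a0\<bar> \<le> D"
    using f_approx [of z] weaken_error [of "nrm z" "norm z"] nrm_compose_le [of e R z] nrm_e R
    by (simp add: ze D_def)
  have 2: "\<bar>pp (f o\<^sub>L lmult z) - ip (z o\<^sub>L u) a0\<bar> \<le> 2 * D"
    using pp_lmult_approx [of z] by (simp add: D_def)
  have 3: "ip z a0 - ip (z o\<^sub>L u) a0 = ip (z o\<^sub>L s) a0"
    by (simp add: s_def compose_diff_right ze diff_left)
  have zs: "\<kappa> * nrm (z o\<^sub>L s) \<le> D"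
    unfolding D_def by (intro weaken_error nrm_compose_le bounds)
  have 4: "\<bar>ip (z o\<^sub>L s) a0 - ip (z o\<^sub>L s) v\<bar> \<le> D"
    using left_fixed_compress [OF z, of s] zs by linarith
  have "(nrm (z o\<^sub>L s))\<^sup>2 \<le> (m\<^sup>2 - 1) * (1 + 4 * (\<kappa> * R)) + 4 * D"
  proof -
    have "nrm ((e + z) o\<^sub>L s) \<le> m * nrm s"
      using nrm_compose [of "e + z" s] mult_right_mono [OF m(1) nrm_nonneg [of s]] by linarith
    then have "(nrm ((e + z) o\<^sub>L s))\<^sup>2 \<le> (m * nrm s)\<^sup>2"
      by (intro power_mono nrm_nonneg)
    moreover have "(nrm ((e + z) o\<^sub>L s))\<^sup>2 = (nrm s)\<^sup>2 + 2 * ip (z o\<^sub>L s) s + (nrm (z o\<^sub>L s))\<^sup>2"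
      by (simp add: nrm_square compose_add_left es add_left add_right commute [of s "z o\<^sub>L s"])
    moreover have "ip (z o\<^sub>L s) s = B s (z o\<^sub>L s)"
      using B_left_fixed [OF z, of s s] B_commute by simp
    moreover have "(m * nrm s)\<^sup>2 - (nrm s)\<^sup>2 \<le> (m\<^sup>2 - 1) * (1 + 4 * (\<kappa> * R))"
    proof -
      have "(nrm s)\<^sup>2 \<le> 1 + 4 * (\<kappa> * R)"
        using squares_u zero_le_power2 [of "nrm u"] by linarith
      then have "(m\<^sup>2 - 1) * (nrm s)\<^sup>2 \<le> (m\<^sup>2 - 1) * (1 + 4 * (\<kappa> * R))"
        using m by (intro mult_left_mono) auto
      then show ?thesis by (simp add: power_mult_distrib algebra_simps)
    qed
    ultimately show ?thesis
      using B_s [of "z o\<^sub>L s"] zs by linarith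
  qed
  then have 5: "nrm (z o\<^sub>L s) \<le> sqrt ((m\<^sup>2 - 1) * (1 + 4 * (\<kappa> * R)) + 4 * D)"
    by (rule real_le_rsqrt)
  have 6: "nrm v \<le> 1 + 7 * (\<kappa> * R)"
  proof (rule le_of_square_le)
    show "(nrm v)\<^sup>2 \<le> 1 + 7 * (\<kappa> * R)"
      using squares_v zero_le_power2 [of "nrm t"] by linarith
  qed (use \<kappa> R in simp)
  have "\<bar>ip (z o\<^sub>L s) v\<bar> \<le> sqrt ((m\<^sup>2 - 1) * (1 + 4 * (\<kappa> * R)) + 4 * D) * (1 + 7 * (\<kappa> * R))"
  proof (rule order_trans [OF Cauchy_Schwarz mult_mono [OF 5 6]])
    show "0 \<le> sqrt ((m\<^sup>2 - 1) * (1 + 4 * (\<kappa> * R)) + 4 * D)"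
      using 5 nrm_nonneg [of "z o\<^sub>L s"] by linarith
  qed (rule nrm_nonneg)
  then show ?thesis
    using 1 2 3 4 unfolding D_def mult.assoc by linarith
qed

end

lemma le_by_limit:
  fixes g :: "real \<Rightarrow> real"
  assumes "\<And>\<kappa>. 0 < \<kappa> \<Longrightarrow> \<kappa> \<le> 1 \<Longrightarrow> X \<le> g \<kappa>" and "isCont g 0"
  shows "X \<le> g 0"
proof (rule tendsto_lowerbound)
  show "(g \<longlongrightarrow> g 0) (at_right 0)"
    using assms(2) by (simp add: isCont_def filterlim_at_split)
  show "\<forall>\<^sub>F \<kappa> in at_right 0. X \<le> g \<kappa>"
    by (rule eventually_at_rightI [of 0 1]) (use assms(1) in auto)
qed simp

context bidual_projection
begin

text \<open>The data of the approximation exist for every error bound, so that letting \<open>\<kappa>\<close> tend to zero turns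
  the estimates above into exact ones.\<close>

lemma compression_exists:
  assumes f: "norm f \<le> 1" and \<kappa>: "0 < \<kappa>" "\<kappa> \<le> 1"
  obtains F a0 u v where "compression pp e F f a0 u v \<kappa>"
proof -
  obtain F a0 where F: "state F" "\<And>y. \<bar>f y - state.ip F y a0\<bar> \<le> \<kappa> * semi_inner.nrm (state.ip F) y"
    "semi_inner.nrm (state.ip F) a0 \<le> 1 + \<kappa>"
    using vector_state [OF f \<kappa>(1)] by blast
  interpret projection_in_state pp e F
    using F(1) bidual_projection_axioms by (simp add: projection_in_state_def)
  obtain u where u: "e o\<^sub>L u = u" "\<And>y. \<bar>B e y - ip u y\<bar> \<le> \<kappa> * nrm y" "\<And>y. \<bar>B u y - ip u y\<bar> \<le> \<kappa> * nrm y"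
    using approximate_compression [OF \<kappa>(1)] by blast
  obtain v where v: "\<And>y. \<bar>B a0 y - ip v y\<bar> \<le> \<kappa> * nrm y" "\<And>y. \<bar>B v y - ip v y\<bar> \<le> \<kappa> * nrm y"
    using approximate_compression [OF \<kappa>(1)] by blast
  have "compression pp e F f a0 u v \<kappa>"
    using F(2,3) u v \<kappa> by unfold_locales
  then show thesis by (rule that)
qed

lemma norm_complement_le:
  assumes "norm f \<le> 1"
  shows "\<bar>blinfun_apply f x - pp (f o\<^sub>L rmult x)\<bar> \<le> norm x"
proof -
  define g where "g \<kappa> = norm x + 10 * (norm x * (\<kappa> * (2 * norm pp + 3)))" for \<kappa>
  have "\<bar>blinfun_apply f x - pp (f o\<^sub>L rmult x)\<bar> \<le> g 0"
  proof (rule le_by_limit)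
    fix \<kappa> :: real assume "0 < \<kappa>" "\<kappa> \<le> 1"
    with assms obtain F a0 u v where "compression pp e F f a0 u v \<kappa>"
      using compression_exists by blast
    then show "\<bar>blinfun_apply f x - pp (f o\<^sub>L rmult x)\<bar> \<le> g \<kappa>"
      unfolding g_def
      using compression.complement_contractive compression.R_def by metis
  qed (unfold g_def, intro continuous_intros)
  then show ?thesis by (simp add: g_def)
qed

lemma norm_block_diagonal_le:
  assumes f: "norm f \<le> 1"
    and c: "commutes c" and cq: "\<And>g. \<bar>blinfun_apply g c - pp (g o\<^sub>L lmult c)\<bar> \<le> norm g"
    and z: "left_fixed z"
    and r: "0 \<le> r" "r \<le> 1" "r * norm (c o\<^sub>L (e + z)) \<le> 1"
  shows "\<bar>r * pp (f o\<^sub>L lmult (c o\<^sub>L (e + z))) + (blinfun_apply f c - pp (f o\<^sub>L lmult c))\<bar> \<le> 1"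
    (is "?X \<le> 1")
proof -
  define g where "g \<kappa> = 1 + (6 + 2 * norm (c o\<^sub>L (e + z)) + 10 * norm c + norm c * norm z) * (\<kappa> * (2 * norm pp + 3))" for \<kappa>
  have "?X \<le> g 0"
  proof (rule le_by_limit)
    fix \<kappa> :: real assume "0 < \<kappa>" "\<kappa> \<le> 1"
    with f obtain F a0 u v where *: "compression pp e F f a0 u v \<kappa>"
      using compression_exists by blast
    then show "?X \<le> g \<kappa>"
      using compression.block_diagonal_bound [OF * c cq z refl r]
      by (simp add: g_def compression.R_def [OF *])
  qed (unfold g_def, intro continuous_intros)
  then show ?thesis by (simp add: g_def)
qed

lemma norm_corner_le:
  assumes f: "norm f \<le> 1" and z: "left_fixed z"
  shows "\<bar>pp (f o\<^sub>L lmult (e + z))\<bar> \<le> norm (e + z)" (is "?X \<le> _")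
proof -
  define g where "g \<kappa> = norm (e + z) + (8 * norm (e + z) + 2 * norm e + norm e * norm z) * (\<kappa> * (2 * norm pp + 3))" for \<kappa>
  have "?X \<le> g 0"
  proof (rule le_by_limit)
    fix \<kappa> :: real assume "0 < \<kappa>" "\<kappa> \<le> 1"
    with f obtain F a0 u v where *: "compression pp e F f a0 u v \<kappa>"
      using compression_exists by blast
    then show "?X \<le> g \<kappa>"
      using compression.corner_contractive [OF * z]
      by (simp add: g_def compression.R_def [OF *])
  qed (unfold g_def, intro continuous_intros)
  then show ?thesis by (simp add: g_def)
qed

lemma norm_off_diagonal_le:
  assumes f: "norm f \<le> 1" and z: "left_fixed z" and m: "norm (e + z) \<le> m" "1 \<le> m"
  shows "\<bar>blinfun_apply f z - pp (f o\<^sub>L lmult z)\<bar> \<le> sqrt (m\<^sup>2 - 1)" (is "?X \<le> _")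
proof -
  define k where "k \<kappa> = \<kappa> * (2 * norm pp + 3)" for \<kappa>
  define g where "g \<kappa> = sqrt ((m\<^sup>2 - 1) * (1 + 4 * k \<kappa>) + 4 * norm z * k \<kappa>) * (1 + 7 * k \<kappa>) + 4 * norm z * k \<kappa>" for \<kappa>
  have "?X \<le> g 0"
  proof (rule le_by_limit)
    fix \<kappa> :: real assume "0 < \<kappa>" "\<kappa> \<le> 1"
    with f obtain F a0 u v where *: "compression pp e F f a0 u v \<kappa>"
      using compression_exists by blast
    then show "?X \<le> g \<kappa>"
      using compression.off_diagonal_bound [OF * z m]
      by (simp add: g_def k_def compression.R_def [OF *])
  qed (unfold g_def k_def, intro continuous_intros)
  then show ?thesis by (simp add: g_def k_def)
qed

end

section \<open>From approximate to exact contractions\<close>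

lemma linear_functional_bound:
  fixes \<phi> :: "('a::real_normed_vector \<Rightarrow>\<^sub>L real) \<Rightarrow> real"
  assumes \<phi>: "linear \<phi>" and le: "\<And>f. norm f \<le> 1 \<Longrightarrow> \<phi> f \<le> \<alpha>"
  shows "\<phi> f \<le> \<alpha> * norm f"
proof (cases "f = 0")
  case False
  have "\<phi> (f /\<^sub>R norm f) \<le> \<alpha>"
    by (rule le) (use False in simp)
  then show ?thesis
    using False by (simp add: linear_scale [OF \<phi>] field_simps)
qed (simp add: linear_0 [OF \<phi>])

context bidual_projection
begin

lemma norm_compose_rmult: "norm (f o\<^sub>L rmult x) \<le> norm (f :: ('h \<Rightarrow>\<^sub>L 'h) \<Rightarrow>\<^sub>L real) * norm x"
proof (rule norm_blinfun_bound)
  fix a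
  have "norm (f (a o\<^sub>L x)) \<le> norm f * norm (a o\<^sub>L x)" by (rule norm_blinfun)
  also have "\<dots> \<le> norm f * (norm a * norm x)"
    by (intro mult_left_mono norm_blinfun_compose) simp
  finally show "norm ((f o\<^sub>L rmult x) a) \<le> norm f * norm x * norm a" by (simp add: mult_ac)
qed simp

lemma closed_left_fixed: "closed {z. left_fixed z}"
proof -
  have "bounded_linear (\<lambda>z. f o\<^sub>L rmult z)" for f :: "('h \<Rightarrow>\<^sub>L 'h) \<Rightarrow>\<^sub>L real"
  proof (rule bounded_linear_intro)
    show "norm (f o\<^sub>L rmult x) \<le> norm x * norm f" for x
      using norm_compose_rmult [of f x] by (simp add: mult.commute)
  qed (auto intro!: blinfun_eqI
      simp: compose_add_right compose_scaleR_right blinfun.add_right blinfun.add_left blinfun.scaleR_right blinfun.scaleR_left)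
  then have *: "continuous_on UNIV (\<lambda>z. pp (f o\<^sub>L rmult z))" for f
    by (intro linear_continuous_on bounded_linear_compose [OF blinfun.bounded_linear_right])
  show ?thesis
    unfolding left_fixed_def
    by (intro closed_Collect_conj closed_Collect_all closed_Collect_eq * continuous_intros)
qed

end

text \<open>The hypothesis on functionals vanishing on \<open>J\<close> says that \<open>p\<close> and all \<open>zp\<close> with \<open>z \<in> J\<close> belong to the second
  annihilator of \<open>J\<close>; the last hypothesis is \<open>\<parallel>bq\<parallel> \<le> 1\<close>.\<close>

locale peak_setting = bidual_projection pp e
  for pp :: "(('h::{real_inner, banach} \<Rightarrow>\<^sub>L 'h) \<Rightarrow>\<^sub>L real) \<Rightarrow>\<^sub>L real" and e +
  fixes J :: "('h \<Rightarrow>\<^sub>L 'h) set" and b :: "'h \<Rightarrow>\<^sub>L 'h"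
  assumes J: "subspace J" "\<And>z. z \<in> J \<Longrightarrow> left_fixed z"
    and annihilator: "\<And>f. (\<And>z. z \<in> J \<Longrightarrow> blinfun_apply f z = 0) \<Longrightarrow> pp f = 0"
    and ideal: "\<And>f z. (\<And>y. y \<in> J \<Longrightarrow> blinfun_apply f y = 0) \<Longrightarrow> z \<in> J \<Longrightarrow> pp (f o\<^sub>L lmult z) = 0"
    and b: "commutes b" "\<And>g. \<bar>blinfun_apply g b - pp (g o\<^sub>L lmult b)\<bar> \<le> norm g"
begin

text \<open>With \<open>\<eta> = (1 - \<delta>) hp + q\<close> the difference \<open>\<zeta> = \<eta> - h = - \<delta> hp - (z - zp)\<close> belongs to the second annihilator of
  \<open>J\<close>. The number \<open>\<delta>\<close> is chosen so that \<open>(1 - \<delta>) (1 + \<epsilon>) = 1\<close>, which makes \<open>\<eta>\<close> and \<open>b\<eta>\<close> contractions.\<close>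

lemma perturbation_step:
  assumes z: "z \<in> J" and \<epsilon>: "0 < \<epsilon>" "norm (e + z) \<le> 1 + \<epsilon>" "norm (b o\<^sub>L (e + z)) \<le> 1 + \<epsilon>"
    and \<eta>: "0 < \<eta>"
  obtains z' where "z' \<in> J" "norm (z' - z) \<le> \<epsilon> + sqrt ((1 + \<epsilon>)\<^sup>2 - 1) + \<eta>"
    "norm (e + z') \<le> 1 + \<eta>" "norm (b o\<^sub>L (e + z')) \<le> 1 + \<eta>"
proof -
  define \<delta> where "\<delta> = \<epsilon> / (1 + \<epsilon>)"
  have \<delta>: "0 \<le> \<delta>" "\<delta> \<le> 1" "\<delta> * (1 + \<epsilon>) = \<epsilon>" "(1 - \<delta>) * (1 + \<epsilon>) = 1"
    using \<epsilon>(1) by (simp_all add: \<delta>_def divide_simps)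
  have lz: "left_fixed z" by (rule J(2) [OF z])
  have eh: "e o\<^sub>L (e + z) = e + z"
    using lz by (simp add: left_fixed_def compose_add_right unit_idempotent)
  have be: "b o\<^sub>L e = b" using b(1) by (simp add: commutes_def)
  have e_le: "\<bar>blinfun_apply g e - pp (g o\<^sub>L lmult e)\<bar> \<le> norm g" for g
  proof -
    have lin: "linear (\<lambda>g. k * (blinfun_apply g e - pp g))" for k
      by (rule linearI) (simp_all add: blinfun.add_left blinfun.add_right
          blinfun.scaleR_left blinfun.scaleR_right algebra_simps)
    have "\<bar>k * (blinfun_apply f e - pp f)\<bar> \<le> \<bar>k\<bar>" if "norm f \<le> 1" for f and k :: real
      using norm_complement_le [OF that, of e] norm_unit
      by (simp add: unit_right abs_mult mult_left_le)
    then have "k * (g e - pp g) \<le> \<bar>k\<bar> * norm g" for k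
      by (intro linear_functional_bound [OF lin]) (meson abs_le_D1)
    from this [of 1] this [of "- 1"] show ?thesis by (simp add: unit_left abs_le_iff)
  qed
  define \<zeta> where "\<zeta> f = - \<delta> * pp (f o\<^sub>L lmult (e + z)) - (blinfun_apply f z - pp (f o\<^sub>L lmult z))" for f
  have lmult_add: "f o\<^sub>L lmult (x + y) = (f o\<^sub>L lmult x) + (f o\<^sub>L lmult y)"
    for f :: "('h \<Rightarrow>\<^sub>L 'h) \<Rightarrow>\<^sub>L real" and x y
    by (rule blinfun_eqI) (simp add: compose_add_left blinfun.add_left blinfun.add_right)
  have lmult_lmult: "(f o\<^sub>L lmult x) o\<^sub>L lmult y = f o\<^sub>L lmult (x o\<^sub>L y)"
    for f :: "('h \<Rightarrow>\<^sub>L 'h) \<Rightarrow>\<^sub>L real" and x y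
    by (rule blinfun_eqI) (simp add: compose_assoc)
  have lin: "linear (\<lambda>f. \<zeta> (f o\<^sub>L L) + blinfun_apply f y)" for L y
    by (rule linearI)
      (simp_all add: \<zeta>_def compose_add_left compose_scaleR_left blinfun.add_left blinfun.add_right
          blinfun.scaleR_left blinfun.scaleR_right algebra_simps)
  have bound1: "\<zeta> (f o\<^sub>L id_blinfun) + blinfun_apply f 0 \<le> (\<epsilon> + sqrt ((1 + \<epsilon>)\<^sup>2 - 1)) * norm f" for f
  proof (rule linear_functional_bound [OF lin])
    fix f :: "('h \<Rightarrow>\<^sub>L 'h) \<Rightarrow>\<^sub>L real" assume f: "norm f \<le> 1"
    have "\<bar>\<delta> * pp (f o\<^sub>L lmult (e + z))\<bar> \<le> \<delta> * (1 + \<epsilon>)"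
      using norm_corner_le [OF f lz] \<epsilon>(2) \<delta>(1) by (simp add: abs_mult mult_left_mono)
    moreover have "\<bar>f z - pp (f o\<^sub>L lmult z)\<bar> \<le> sqrt ((1 + \<epsilon>)\<^sup>2 - 1)"
      using \<epsilon> by (intro norm_off_diagonal_le [OF f lz]) auto
    moreover have "f o\<^sub>L id_blinfun = f" by (rule blinfun_eqI) simp
    ultimately show "\<zeta> (f o\<^sub>L id_blinfun) + blinfun_apply f 0 \<le> \<epsilon> + sqrt ((1 + \<epsilon>)\<^sup>2 - 1)"
      by (simp add: \<zeta>_def \<delta>(3) blinfun.zero_right abs_le_iff)
  qed
  have block: "\<zeta> (f o\<^sub>L lmult c) + blinfun_apply f (c o\<^sub>L (e + z)) \<le> 1 * norm f"
    if c: "commutes c" "\<And>g. \<bar>blinfun_apply g c - pp (g o\<^sub>L lmult c)\<bar> \<le> norm g"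
      and norm_c: "norm (c o\<^sub>L (e + z)) \<le> 1 + \<epsilon>" for c f
  proof (rule linear_functional_bound [OF lin])
    fix f :: "('h \<Rightarrow>\<^sub>L 'h) \<Rightarrow>\<^sub>L real" assume f: "norm f \<le> 1"
    let ?h = "c o\<^sub>L (e + z)"
    have "(1 - \<delta>) * norm ?h \<le> (1 - \<delta>) * (1 + \<epsilon>)"
      using norm_c \<delta> by (intro mult_left_mono) auto
    then have "\<bar>(1 - \<delta>) * pp (f o\<^sub>L lmult ?h) + (f c - pp (f o\<^sub>L lmult c))\<bar> \<le> 1"
      using \<delta> by (intro norm_block_diagonal_le [OF f c lz]) auto
    moreover have h: "?h = c + (c o\<^sub>L z)"
      using c(1) by (simp add: commutes_def compose_add_right)
    have "\<zeta> (f o\<^sub>L lmult c) + f ?h = (1 - \<delta>) * pp (f o\<^sub>L lmult ?h) + (f c - pp (f o\<^sub>L lmult c))"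
      unfolding \<zeta>_def lmult_lmult h
      by (simp add: lmult_add blinfun.add_right algebra_simps)
    ultimately show "\<zeta> (f o\<^sub>L lmult c) + f ?h \<le> 1" by simp
  qed
  have bound2: "\<zeta> (f o\<^sub>L lmult e) + blinfun_apply f (e + z) \<le> 1 * norm f" for f
    using block [OF commutes_unit e_le] \<epsilon>(2) by (simp add: eh)
  obtain w where w: "w \<in> J" "norm (id_blinfun w + 0) \<le> (\<epsilon> + sqrt ((1 + \<epsilon>)\<^sup>2 - 1)) + \<eta>"
    "norm (lmult e w + (e + z)) \<le> 1 + \<eta>" "norm (lmult b w + (b o\<^sub>L (e + z))) \<le> 1 + \<eta>"
  proof (rule approximation_from_second_annihilator [OF J(1) _ _ bound1 bound2 block [OF b \<epsilon>(3)] _ _ _ \<eta>])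
    show "\<zeta> (f + g) = \<zeta> f + \<zeta> g" for f g
      using linear_add [OF lin [of id_blinfun 0], of f g]
      by (simp add: \<zeta>_def compose_add_left blinfun.add_left blinfun.add_right algebra_simps)
    show "\<zeta> f = 0" if "\<And>z. z \<in> J \<Longrightarrow> blinfun_apply f z = 0" for f
      using that annihilator [OF that] ideal [OF that z] z
      by (simp add: \<zeta>_def lmult_add blinfun.add_right unit_left)
    show "0 \<le> \<epsilon> + sqrt ((1 + \<epsilon>)\<^sup>2 - 1)" using \<epsilon>(1) by (simp add: power2_eq_square algebra_simps)
  qed auto
  have ew: "e o\<^sub>L w = w" using J(2) [OF w(1)] by (simp add: left_fixed_def)
  show thesis
  proof
    show "z + w \<in> J" using J(1) z w(1) by (rule subspace_add)
  qed (use w ew in \<open>simp_all add: compose_add_right be add_ac\<close>)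
qed

text \<open>Successive elements differ by at most a multiple of \<open>2\<^sup>-\<^sup>n\<close>, since the bound \<open>\<epsilon> = 4\<^sup>-\<^sup>n\<close> enters the step through its
  square root. The limit \<open>h = e + l\<close> is a contraction, so its off-diagonal corner vanishes.\<close>

theorem exact_contraction:
  obtains z where "z \<in> closure J" "norm (b o\<^sub>L (e + z)) \<le> 1"
    "\<And>f. pp (f o\<^sub>L rmult z) = blinfun_apply f z" "\<And>f. pp (f o\<^sub>L lmult z) = blinfun_apply f z"
proof -
  define \<epsilon> :: "nat \<Rightarrow> real" where "\<epsilon> n = (1 / 4) ^ n" for n
  define good where "good n z \<longleftrightarrow> z \<in> J \<and> norm (e + z) \<le> 1 + \<epsilon> n \<and> norm (b o\<^sub>L (e + z)) \<le> 1 + \<epsilon> n" for n z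
  \<comment> \<open>The first step starts from \<open>h = e\<close>, with the crude bound \<open>\<parallel>b\<parallel> \<le> 1 + \<epsilon>\<close> for \<open>\<epsilon> = 1 + \<parallel>b\<parallel>\<close>.\<close>
  have start: "\<exists>z. good 0 z"
  proof -
    have "norm (e + 0) \<le> 1 + (1 + norm b)" "norm (b o\<^sub>L (e + 0)) \<le> 1 + (1 + norm b)"
      using norm_unit norm_ge_zero [of b] b(1) by (auto simp: commutes_def simp del: norm_ge_zero)
    moreover have "0 < 1 + norm b" using norm_ge_zero [of b] by linarith
    ultimately obtain z' where "z' \<in> J" "norm (e + z') \<le> 1 + 1" "norm (b o\<^sub>L (e + z')) \<le> 1 + 1"
      using perturbation_step [OF subspace_0 [OF J(1)], of "1 + norm b" 1] by (metis zero_less_one)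
    then show ?thesis by (auto simp: good_def \<epsilon>_def)
  qed
  have step: "\<exists>z'. good (Suc n) z' \<and> norm (z' - z) \<le> 4 * (1 / 2) ^ n" if good: "good n z" for n z
  proof -
    have \<epsilon>: "0 < \<epsilon> n" "0 < \<epsilon> (Suc n)" by (simp_all add: \<epsilon>_def)
    obtain z' where z': "z' \<in> J" "norm (z' - z) \<le> \<epsilon> n + sqrt ((1 + \<epsilon> n)\<^sup>2 - 1) + \<epsilon> (Suc n)"
      "norm (e + z') \<le> 1 + \<epsilon> (Suc n)" "norm (b o\<^sub>L (e + z')) \<le> 1 + \<epsilon> (Suc n)"
      using good \<epsilon> perturbation_step [of z "\<epsilon> n" "\<epsilon> (Suc n)"]
      unfolding good_def by metis
    define p :: real where "p = (1 / 2) ^ n"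
    have p: "0 < p" "p \<le> 1" by (simp_all add: p_def power_le_one)
    have \<epsilon>p: "\<epsilon> n = p * p" by (simp add: \<epsilon>_def p_def flip: power_mult_distrib)
    have pp: "p * p \<le> p * 1" using p by (intro mult_left_mono) auto
    have "p * p \<le> 1" using pp p by linarith
    then have "(p * p) * (p * p) \<le> 1 * (p * p)" using p by (intro mult_right_mono) auto
    moreover have "(1 + \<epsilon> n)\<^sup>2 - 1 = 2 * (p * p) + (p * p) * (p * p)"
      by (simp add: \<epsilon>p power2_eq_square algebra_simps)
    moreover have "(2 * p)\<^sup>2 = 4 * (p * p)" by (simp add: power2_eq_square)
    ultimately have "(1 + \<epsilon> n)\<^sup>2 - 1 \<le> (2 * p)\<^sup>2"
      using mult_pos_pos [OF p(1) p(1)] by linarith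
    then have "sqrt ((1 + \<epsilon> n)\<^sup>2 - 1) \<le> 2 * p"
      using p by (intro real_le_lsqrt) auto
    moreover have "\<epsilon> (Suc n) = \<epsilon> n / 4" by (simp add: \<epsilon>_def)
    ultimately have "norm (z' - z) \<le> 4 * p" using z'(2) pp p \<epsilon>p by linarith
    then show ?thesis using z' by (auto simp: good_def p_def)
  qed
  obtain z where z: "\<And>n. good n (z n)" "\<And>n. norm (z (Suc n) - z n) \<le> 4 * (1 / 2) ^ n"
    using dependent_nat_choice [of good "\<lambda>n z z'. norm (z' - z) \<le> 4 * (1 / 2) ^ n"] start step
    by metis
  have "summable (\<lambda>n. z (Suc n) - z n)"
    by (rule summable_comparison_test' [where g = "\<lambda>n. 4 * (1 / 2) ^ n" and N = 0])
      (use z(2) in \<open>auto intro: summable_mult summable_geometric\<close>)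
  then have "(\<lambda>n. \<Sum>k<n. z (Suc k) - z k) \<longlonglongrightarrow> (\<Sum>n. z (Suc n) - z n)"
    by (rule summable_LIMSEQ)
  then have "(\<lambda>n. z 0 + (z n - z 0)) \<longlonglongrightarrow> z 0 + (\<Sum>n. z (Suc n) - z n)"
    unfolding sum_lessThan_telescope by (intro tendsto_intros)
  then obtain l where l: "z \<longlonglongrightarrow> l" by auto
  have \<epsilon>0: "(\<lambda>n. 1 + \<epsilon> n) \<longlonglongrightarrow> 1 + 0"
    unfolding \<epsilon>_def by (intro tendsto_intros LIMSEQ_realpow_zero) auto
  have zJ: "z n \<in> J" for n using z(1) by (simp add: good_def)
  have norm_l: "norm (e + l) \<le> 1" "norm (b o\<^sub>L (e + l)) \<le> 1"
  proof -
    have "(\<lambda>n. norm (e + z n)) \<longlonglongrightarrow> norm (e + l)" "(\<lambda>n. norm (b o\<^sub>L (e + z n))) \<longlonglongrightarrow> norm (b o\<^sub>L (e + l))"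
      by (intro tendsto_intros l)+
    with \<epsilon>0 show "norm (e + l) \<le> 1" "norm (b o\<^sub>L (e + l)) \<le> 1"
      using LIMSEQ_le z(1) by (fastforce simp: good_def)+
  qed
  have fixed: "left_fixed l"
    using closed_sequentially [OF closed_left_fixed _ l] J(2) zJ by simp
  show thesis
  proof
    show "l \<in> closure J" using l zJ closure_sequential by blast
    show "norm (b o\<^sub>L (e + l)) \<le> 1" by (rule norm_l)
    show "pp (f o\<^sub>L rmult l) = blinfun_apply f l" for f
      using fixed by (simp add: left_fixed_def)
    show "pp (f o\<^sub>L lmult l) = blinfun_apply f l" for f
    proof -
      define \<phi> where "\<phi> k g = k * (blinfun_apply g l - pp (g o\<^sub>L lmult l))" for k :: real and g
      have "linear (\<phi> k)" for k
        by (rule linearI) (simp_all add: \<phi>_def compose_add_left compose_scaleR_left blinfun.add_left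
            blinfun.add_right blinfun.scaleR_left blinfun.scaleR_right algebra_simps)
      moreover have "\<phi> k g \<le> 0" if "norm g \<le> 1" for k g
        using norm_off_diagonal_le [OF that fixed norm_l(1)] by (simp add: \<phi>_def)
      ultimately have "\<phi> k f \<le> 0 * norm f" for k
        by (rule linear_functional_bound)
      from this [of 1] this [of "- 1"] show ?thesis by (simp add: \<phi>_def)
    qed
  qed
qed

end

section \<open>Complex functionals and their real parts\<close>

instance complex_hilbert_space \<subseteq> banach ..

lemma op_scaleC_apply [simp]: "blinfun_apply (op_scaleC c T) x = c *\<^sub>C T x"
  by (simp add: op_scaleC.rep_eq)

lemma op_scaleC_add_right: "op_scaleC c (S + T) = op_scaleC c S + op_scaleC c T"
  by (rule blinfun_eqI) (simp add: blinfun.add_left scaleC_add_right)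

lemma op_scaleC_add_left: "op_scaleC (c + d) T = op_scaleC c T + op_scaleC d T"
  by (rule blinfun_eqI) (simp add: blinfun.add_left scaleC_add_left)

lemma op_scaleC_scaleC: "op_scaleC c (op_scaleC d T) = op_scaleC (c * d) T"
  by (rule blinfun_eqI) (simp add: scaleC_scaleC)

lemma op_scaleC_of_real: "op_scaleC (complex_of_real r) T = r *\<^sub>R T"
  by (rule blinfun_eqI) (simp add: scaleC_of_real blinfun.scaleR_left)

lemma op_scaleC_scaleR: "op_scaleC c (r *\<^sub>R T) = r *\<^sub>R op_scaleC c T"
  by (simp add: op_scaleC_scaleC mult.commute flip: op_scaleC_of_real)

lemma op_scaleC_compose_left: "op_scaleC c S o\<^sub>L T = op_scaleC c (S o\<^sub>L T)"
  by (rule blinfun_eqI) simp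

lemma op_scaleC_compose_right: "S \<in> BH \<Longrightarrow> S o\<^sub>L op_scaleC c T = op_scaleC c (S o\<^sub>L T)"
  by (rule blinfun_eqI) (simp add: BH_def)

lemma norm_op_scaleC_le: "norm (op_scaleC c T) \<le> cmod c * norm T"
proof (rule norm_blinfun_bound)
  fix x
  show "norm (op_scaleC c T x) \<le> cmod c * norm T * norm x"
    using mult_left_mono [OF norm_blinfun [of T x], of "cmod c"] by (simp add: norm_scaleC mult.assoc)
qed simp

lemma op_scaleC_Complex: "op_scaleC c T = Re c *\<^sub>R T + Im c *\<^sub>R op_scaleC \<i> T"
proof -
  have "op_scaleC c T = op_scaleC (complex_of_real (Re c) + complex_of_real (Im c) * \<i>) T"
    by (rule arg_cong [where f = "\<lambda>d. op_scaleC d T"]) (simp add: complex_eq_iff)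
  also have "\<dots> = Re c *\<^sub>R T + Im c *\<^sub>R op_scaleC \<i> T"
    by (simp only: op_scaleC_add_left op_scaleC_of_real flip: op_scaleC_scaleC)
  finally show ?thesis .
qed

definition scalar_map :: "complex \<Rightarrow> ('h::complex_hilbert_space \<Rightarrow>\<^sub>L 'h) \<Rightarrow>\<^sub>L ('h \<Rightarrow>\<^sub>L 'h)" where
  "scalar_map c = Blinfun (op_scaleC c)"

lemma scalar_map_apply [simp]: "scalar_map c T = op_scaleC c T"
  for T :: "'h::complex_hilbert_space \<Rightarrow>\<^sub>L 'h"
proof -
  have "bounded_linear (op_scaleC c :: ('h \<Rightarrow>\<^sub>L 'h) \<Rightarrow> _)"
    by (rule bounded_linear_intro [where K = "cmod c"])
      (auto simp: op_scaleC_add_right op_scaleC_scaleR norm_op_scaleC_le mult.commute)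
  then show ?thesis by (simp add: scalar_map_def bounded_linear_Blinfun_apply)
qed

lemma norm_compose_scalar_map: "norm (f o\<^sub>L scalar_map c) \<le> norm f * cmod c"
  for f :: "('h::complex_hilbert_space \<Rightarrow>\<^sub>L 'h) \<Rightarrow>\<^sub>L real"
proof (rule order_trans [OF norm_blinfun_compose mult_left_mono])
  show "norm (scalar_map c :: ('h \<Rightarrow>\<^sub>L 'h) \<Rightarrow>\<^sub>L _) \<le> cmod c"
    by (rule norm_blinfun_bound) (simp_all add: norm_op_scaleC_le)
qed simp

lemma cinner_eq_inner: "cinner x y = Complex (inner x y) (- inner (\<i> *\<^sub>C x) y)"
  by (simp add: complex_eq_iff cinner_scaleC_left flip: Re_cinner)

lemma inner_scaleC_left: "inner (c *\<^sub>C x) y = inner x (cnj c *\<^sub>C y)"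
proof -
  have "cinner x (cnj c *\<^sub>C y) = c * cinner x y"
    by (metis cinner_commute cinner_scaleC_left complex_cnj_cnj complex_cnj_mult)
  then show ?thesis
    by (simp add: cinner_scaleC_left flip: Re_cinner)
qed

lemma BH_apply: "T \<in> BH \<Longrightarrow> blinfun_apply T (c *\<^sub>C x) = c *\<^sub>C T x"
  by (simp add: BH_def)

lemma op_adj_eq_adjoint:
  assumes T: "T \<in> BH"
  shows "op_adj T = adjoint T"
  unfolding op_adj_def
proof (rule the_equality)
  show "\<forall>x y. cinner (blinfun_apply T x) y = cinner x (blinfun_apply (adjoint T) y)"
    by (simp add: cinner_eq_inner flip: inner_adjoint BH_apply [OF T])
  fix S assume "\<forall>x y. cinner (blinfun_apply T x) y = cinner x (blinfun_apply S y)"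
  then show "S = adjoint T"
    by (metis adjoint_eqI Re_cinner)
qed

lemma adjoint_in_BH:
  assumes T: "T \<in> BH"
  shows "adjoint T \<in> BH"
proof -
  have "inner x (adjoint T (c *\<^sub>C y)) = inner x (c *\<^sub>C adjoint T y)" for c x y
  proof -
    have "inner x (adjoint T (c *\<^sub>C y)) = inner (cnj c *\<^sub>C T x) y"
      by (simp add: inner_scaleC_left flip: inner_adjoint)
    also have "\<dots> = inner x (c *\<^sub>C adjoint T y)"
      using inner_scaleC_left [of "cnj c" x "adjoint T y"]
      by (simp add: inner_adjoint flip: BH_apply [OF T])
    finally show ?thesis .
  qed
  then have "adjoint T (c *\<^sub>C y) = c *\<^sub>C adjoint T y" for c y
    by (metis vector_eq_rdot inner_commute)
  then show ?thesis by (simp add: BH_def)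
qed

lemma adjoint_op_scaleC:
  assumes T: "T \<in> BH"
  shows "adjoint (op_scaleC c T) = op_scaleC (cnj c) (adjoint T)"
proof (rule adjoint_eqI)
  fix x y
  show "inner (op_scaleC c T x) y = inner x (op_scaleC (cnj c) (adjoint T) y)"
    by (simp add: inner_adjoint flip: BH_apply [OF T] inner_scaleC_left)
qed

text \<open>The complex-linear functional on \<open>S\<close> with real part \<open>f\<close>.\<close>

definition complexify :: "('h::complex_hilbert_space \<Rightarrow>\<^sub>L 'h) set \<Rightarrow> (('h \<Rightarrow>\<^sub>L 'h) \<Rightarrow>\<^sub>L real) \<Rightarrow> 'h functional" where
  "complexify S f = (\<lambda>x\<in>S. Complex (f x) (- f (op_scaleC \<i> x)))"

locale operator_space =
  fixes S :: "('h::complex_hilbert_space \<Rightarrow>\<^sub>L 'h) set"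
  assumes zero_in: "0 \<in> S"
    and add_in: "x \<in> S \<Longrightarrow> y \<in> S \<Longrightarrow> x + y \<in> S"
    and scaleC_in: "x \<in> S \<Longrightarrow> op_scaleC c x \<in> S"
begin

lemma scaleR_in: "x \<in> S \<Longrightarrow> r *\<^sub>R x \<in> S"
  using scaleC_in [of x "complex_of_real r"] by (simp add: op_scaleC_of_real)

lemma subspace: "subspace S"
  by (simp add: subspace_def zero_in add_in scaleR_in)

lemma complexify_apply: "x \<in> S \<Longrightarrow> complexify S f x = Complex (f x) (- f (op_scaleC \<i> x))"
  by (simp add: complexify_def)

lemma complexify_scaleC:
  assumes "x \<in> S"
  shows "complexify S f (op_scaleC c x) = c * complexify S f x"
proof -
  have "f (op_scaleC \<i> (op_scaleC c x)) = Re c * f (op_scaleC \<i> x) - Im c * f x"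
    by (simp add: op_scaleC_Complex [of c x] op_scaleC_add_right op_scaleC_scaleR op_scaleC_scaleC
        op_scaleC_Complex [of "- 1" x] blinfun.add_right blinfun.scaleR_right blinfun.minus_right blinfun.diff_right)
  moreover have "f (op_scaleC c x) = Re c * f x + Im c * f (op_scaleC \<i> x)"
    by (simp add: op_scaleC_Complex [of c x] blinfun.add_right blinfun.scaleR_right)
  ultimately show ?thesis
    using assms by (simp add: complexify_apply scaleC_in complex_eq_iff)
qed

lemma rotation: obtains c where "cmod c = 1" "c * w = complex_of_real (cmod w)"
proof (cases "w = 0")
  case True
  then show thesis using that [of 1] by simp
next
  case False
  show thesis
  proof
    show "cmod (cnj w / cmod w) = 1" using False by (simp add: norm_divide)
    show "cnj w / cmod w * w = complex_of_real (cmod w)"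
      using False complex_norm_square [of w] by (simp add: field_simps power2_eq_square)
  qed
qed

text \<open>Multiplying \<open>x\<close> by a scalar of modulus one makes the value real without changing the norm, so passing
  to real parts costs nothing in norm.\<close>

lemma complexify_bound:
  assumes "x \<in> S"
  shows "cmod (complexify S f x) \<le> norm f * norm x"
proof -
  obtain c where c: "cmod c = 1" "c * complexify S f x = complex_of_real (cmod (complexify S f x))"
    using rotation by blast
  have "cmod (complexify S f x) = Re (complexify S f (op_scaleC c x))"
    using assms c by (simp add: complexify_scaleC)
  also have "\<dots> = f (op_scaleC c x)"
    using assms by (simp add: complexify_apply scaleC_in)
  also have "\<dots> \<le> norm f * norm (op_scaleC c x)"
    using norm_blinfun [of f "op_scaleC c x"] by simp
  also have "\<dots> \<le> norm f * norm x"
    using norm_op_scaleC_le [of c x] c by (intro mult_left_mono) auto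
  finally show ?thesis .
qed

lemma complexify_in_dual: "complexify S f \<in> dual S"
  unfolding dual_def
proof (intro CollectI conjI ballI allI exI)
  show "complexify S f \<in> extensional S" by (simp add: complexify_def)
  show "complexify S f (x + y) = complexify S f x + complexify S f y" if "x \<in> S" "y \<in> S" for x y
    using that by (simp add: complexify_apply add_in op_scaleC_add_right blinfun.add_right complex_eq_iff)
qed (use complexify_scaleC complexify_bound in auto)

lemma dual_norm_complexify_le: "dual_norm S (complexify S f) \<le> norm f"
  unfolding dual_norm_def
proof (rule cSUP_least)
  fix x assume "x \<in> {x \<in> S. norm x \<le> 1}"
  then show "cmod (complexify S f x) \<le> norm f"
    using complexify_bound [of x f] mult_left_mono [of "norm x" 1 "norm f"] by simp
qed (use zero_in in auto)

lemma dual_bdd_above: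
  assumes "\<psi> \<in> dual S"
  shows "bdd_above ((\<lambda>x. cmod (\<psi> x)) ` {x \<in> S. norm x \<le> 1})"
proof -
  obtain K where K: "\<forall>x\<in>S. cmod (\<psi> x) \<le> K * norm x"
    using assms unfolding dual_def by blast
  show ?thesis
  proof (rule bdd_aboveI2)
    fix x assume x: "x \<in> {x \<in> S. norm x \<le> 1}"
    have "K * norm x \<le> \<bar>K\<bar> * 1" using x by (intro mult_mono) auto
    moreover have "cmod (\<psi> x) \<le> K * norm x" using K x by blast
    ultimately show "cmod (\<psi> x) \<le> \<bar>K\<bar>" by simp
  qed
qed

lemma dual_norm_nonneg: "\<psi> \<in> dual S \<Longrightarrow> 0 \<le> dual_norm S \<psi>"
  unfolding dual_norm_def
  by (rule cSUP_upper2 [OF dual_bdd_above, where x = 0]) (auto simp: zero_in)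

lemma dual_bound:
  assumes \<psi>: "\<psi> \<in> dual S" and x: "x \<in> S"
  shows "cmod (\<psi> x) \<le> dual_norm S \<psi> * norm x"
proof -
  have scale: "\<psi> (r *\<^sub>R x) = complex_of_real r * \<psi> x" for r
    using \<psi> x unfolding dual_def op_scaleC_of_real [symmetric] by blast
  show ?thesis
  proof (cases "x = 0")
    case True
    then show ?thesis using scale [of 0] by simp
  next
    case False
    have "inverse (norm x) *\<^sub>R x \<in> {x \<in> S. norm x \<le> 1}"
      using x False by (simp add: scaleR_in)
    then have "cmod (\<psi> (inverse (norm x) *\<^sub>R x)) \<le> dual_norm S \<psi>"
      unfolding dual_norm_def by (rule cSUP_upper [OF _ dual_bdd_above [OF \<psi>]])
    then have "inverse (norm x) * cmod (\<psi> x) \<le> dual_norm S \<psi>"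
      unfolding scale norm_mult by (simp add: norm_inverse)
    then show ?thesis
      using False by (simp add: field_simps)
  qed
qed

text \<open>Every functional on \<open>S\<close> is determined by a real functional on the whole space of operators, with the
  same norm; hence all statements about the bidual can be tested on real functionals.\<close>

lemma dual_eq_complexify:
  assumes \<psi>: "\<psi> \<in> dual S"
  obtains f where "\<psi> = complexify S f" "norm f \<le> dual_norm S \<psi>"
proof -
  have add: "\<psi> (x + y) = \<psi> x + \<psi> y" if "x \<in> S" "y \<in> S" for x y
    using \<psi> that by (simp add: dual_def)
  have scale: "\<psi> (op_scaleC c x) = c * \<psi> x" if "x \<in> S" for c x
    using \<psi> that by (simp add: dual_def)
  obtain f :: "('h \<Rightarrow>\<^sub>L 'h) \<Rightarrow>\<^sub>L real" where f: "\<And>x. x \<in> S \<Longrightarrow> f x = Re (\<psi> x)" "norm f \<le> dual_norm S \<psi>"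
  proof (rule hahn_banach_extension [OF subspace, of "\<lambda>x. Re (\<psi> x)" "dual_norm S \<psi>"])
    show "Re (\<psi> (t *\<^sub>R x)) = t * Re (\<psi> x)" if "x \<in> S" for t x
      using scale [OF that, of "complex_of_real t"] by (simp add: op_scaleC_of_real)
    show "Re (\<psi> x) \<le> dual_norm S \<psi> * norm x" if "x \<in> S" for x
      using dual_bound [OF \<psi> that] complex_Re_le_cmod [of "\<psi> x"] by linarith
  qed (use add dual_norm_nonneg [OF \<psi>] in auto)
  have "\<psi> x = complexify S f x" for x
  proof (cases "x \<in> S")
    case True
    then show ?thesis
      using f(1) [OF scaleC_in [OF True, of \<i>]] scale [OF True, of \<i>]
      by (simp add: complexify_apply f complex_eq_iff)
  next
    case False
    then show ?thesis
      using \<psi> by (simp add: dual_def complexify_def extensional_def)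
  qed
  then show thesis using f(2) that by blast
qed

lemma complexify_scalar_map: "complexify S (f o\<^sub>L scalar_map c) = (\<lambda>x\<in>S. c * complexify S f x)"
proof (rule extensionalityI [where A = S])
  fix x assume x: "x \<in> S"
  have "complexify S (f o\<^sub>L scalar_map c) x = complexify S f (op_scaleC c x)"
    using x by (simp add: complexify_apply scaleC_in op_scaleC_scaleC mult.commute)
  then show "complexify S (f o\<^sub>L scalar_map c) x = (\<lambda>x\<in>S. c * complexify S f x) x"
    using x by (simp add: complexify_scaleC)
qed (simp_all add: complexify_def)

lemma complexify_add: "complexify S (f + g) = (\<lambda>x\<in>S. complexify S f x + complexify S g x)"
  by (rule extensionalityI [where A = S])
    (simp_all add: complexify_def blinfun.add_left complex_eq_iff)

lemma complexify_cong: "(\<And>x. x \<in> S \<Longrightarrow> blinfun_apply f x = blinfun_apply g x) \<Longrightarrow> complexify S f = complexify S g"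
  by (rule extensionalityI [where A = S]) (simp_all add: complexify_def scaleC_in)

context
  fixes \<Phi> assumes \<Phi>: "\<Phi> \<in> bidual S"
begin

lemma bidual_scalar_map: "\<Phi> (complexify S (f o\<^sub>L scalar_map c)) = c * \<Phi> (complexify S f)"
proof -
  have "\<forall>c. \<forall>\<psi>\<in>dual S. \<Phi> (\<lambda>x\<in>S. c * \<psi> x) = c * \<Phi> \<psi>"
    using \<Phi> unfolding bidual_def by blast
  then show ?thesis
    unfolding complexify_scalar_map using complexify_in_dual by blast
qed

lemma bidual_add: "\<Phi> (complexify S (f + g)) = \<Phi> (complexify S f) + \<Phi> (complexify S g)"
proof -
  have "\<forall>\<phi>\<in>dual S. \<forall>\<psi>\<in>dual S. \<Phi> (\<lambda>x\<in>S. \<phi> x + \<psi> x) = \<Phi> \<phi> + \<Phi> \<psi>"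
    using \<Phi> unfolding bidual_def by blast
  then show ?thesis
    unfolding complexify_add using complexify_in_dual by blast
qed

lemma bidual_bounded: obtains K where "0 \<le> K" "\<And>f. cmod (\<Phi> (complexify S f)) \<le> K * norm f"
proof -
  obtain K where K: "\<forall>\<psi>\<in>dual S. cmod (\<Phi> \<psi>) \<le> K * dual_norm S \<psi>"
    using \<Phi> unfolding bidual_def by blast
  have "cmod (\<Phi> (complexify S f)) \<le> \<bar>K\<bar> * norm f" for f
  proof -
    have "K * dual_norm S (complexify S f) \<le> \<bar>K\<bar> * norm f"
      using dual_norm_complexify_le dual_norm_nonneg [OF complexify_in_dual] by (intro mult_mono) auto
    then show ?thesis using bspec [OF K complexify_in_dual, of f] by linarith
  qed
  then show thesis using that [of "\<bar>K\<bar>"] by simp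
qed

definition real_part :: "(('h \<Rightarrow>\<^sub>L 'h) \<Rightarrow>\<^sub>L real) \<Rightarrow>\<^sub>L real" where
  "real_part = Blinfun (\<lambda>f. Re (\<Phi> (complexify S f)))"

lemma real_part_apply: "real_part f = Re (\<Phi> (complexify S f))"
proof -
  obtain K where K: "0 \<le> K" "\<And>f. cmod (\<Phi> (complexify S f)) \<le> K * norm f"
    using bidual_bounded by blast
  have "bounded_linear (\<lambda>f. Re (\<Phi> (complexify S f)))"
  proof (rule bounded_linear_intro [where K = K])
    show "Re (\<Phi> (complexify S (f + g))) = Re (\<Phi> (complexify S f)) + Re (\<Phi> (complexify S g))" for f g
      by (simp add: bidual_add)
    show "Re (\<Phi> (complexify S (r *\<^sub>R f))) = r *\<^sub>R Re (\<Phi> (complexify S f))" for r f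
    proof -
      have "r *\<^sub>R f = f o\<^sub>L scalar_map (complex_of_real r)"
        by (rule blinfun_eqI) (simp add: op_scaleC_of_real blinfun.scaleR_left blinfun.scaleR_right)
      then have "\<Phi> (complexify S (r *\<^sub>R f)) = complex_of_real r * \<Phi> (complexify S f)"
        by (simp only: bidual_scalar_map)
      then show ?thesis by simp
    qed
    show "norm (Re (\<Phi> (complexify S f))) \<le> norm f * K" for f
      using K(2) [of f] abs_Re_le_cmod [of "\<Phi> (complexify S f)"] by (simp add: mult.commute)
  qed
  then show ?thesis unfolding real_part_def by (simp add: bounded_linear_Blinfun_apply)
qed

lemma bidual_eq_real_part: "\<Phi> (complexify S f) = Complex (real_part f) (- real_part (f o\<^sub>L scalar_map \<i>))"
  by (simp add: real_part_apply bidual_scalar_map complex_eq_iff)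

lemma real_part_cong: "(\<And>x. x \<in> S \<Longrightarrow> blinfun_apply f x = blinfun_apply g x) \<Longrightarrow> real_part f = real_part g"
  unfolding real_part_apply by (metis complexify_cong)

end

end

section \<open>Arens products and closed projections\<close>

lemma norm_compose_lmult: "norm (f o\<^sub>L lmult x) \<le> norm f * norm x"
  for f :: "('h::real_normed_vector \<Rightarrow>\<^sub>L 'h) \<Rightarrow>\<^sub>L real"
proof (rule norm_blinfun_bound)
  fix a
  have "norm (f (x o\<^sub>L a)) \<le> norm f * norm (x o\<^sub>L a)" by (rule norm_blinfun)
  also have "\<dots> \<le> norm f * (norm x * norm a)"
    by (intro mult_left_mono norm_blinfun_compose) simp
  finally show "norm ((f o\<^sub>L lmult x) a) \<le> norm f * norm x * norm a" by (simp add: mult_ac)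
qed simp

lemma compose_lmult_scalar_map:
  "x \<in> BH \<Longrightarrow> (f o\<^sub>L lmult x) o\<^sub>L scalar_map c = (f o\<^sub>L scalar_map c) o\<^sub>L lmult x"
  by (rule blinfun_eqI) (simp add: op_scaleC_compose_right)

lemma compose_rmult_scalar_map:
  "(f o\<^sub>L rmult x) o\<^sub>L scalar_map c = (f o\<^sub>L scalar_map c) o\<^sub>L rmult x"
  by (rule blinfun_eqI) (simp add: op_scaleC_compose_left)

locale unital_operator_algebra = operator_space S
  for S :: "('h::complex_hilbert_space \<Rightarrow>\<^sub>L 'h) set" +
  fixes e :: "'h \<Rightarrow>\<^sub>L 'h"
  assumes in_BH: "x \<in> S \<Longrightarrow> x \<in> BH"
    and compose_in: "x \<in> S \<Longrightarrow> y \<in> S \<Longrightarrow> x o\<^sub>L y \<in> S"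
    and unit_in: "e \<in> S"
    and unit_compose: "x \<in> S \<Longrightarrow> e o\<^sub>L x = x"
    and compose_unit: "x \<in> S \<Longrightarrow> x o\<^sub>L e = x"
    and norm_unit: "norm e \<le> 1"
begin

lemma identity_of_eq: "identity_of S = e"
  unfolding identity_of_def
  by (rule the_equality) (auto simp: is_identity_def unit_in unit_compose compose_unit, metis unit_in compose_unit)

lemma complexify_lmult: "a \<in> S \<Longrightarrow> (\<lambda>x\<in>S. complexify S f (a o\<^sub>L x)) = complexify S (f o\<^sub>L lmult a)"
  by (rule extensionalityI [where A = S])
    (simp_all add: complexify_def compose_in op_scaleC_compose_right in_BH)

lemma complexify_rmult: "a \<in> S \<Longrightarrow> (\<lambda>x\<in>S. complexify S f (x o\<^sub>L a)) = complexify S (f o\<^sub>L rmult a)"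
  by (rule extensionalityI [where A = S])
    (simp_all add: complexify_def compose_in op_scaleC_compose_left)

text \<open>The real form of the functional \<open>\<Phi> \<cdot> f\<close> that enters the Arens product.\<close>

definition slice :: "'h bifunctional \<Rightarrow> (('h \<Rightarrow>\<^sub>L 'h) \<Rightarrow>\<^sub>L real) \<Rightarrow> (('h \<Rightarrow>\<^sub>L 'h) \<Rightarrow>\<^sub>L real)" where
  "slice \<Phi> f = Blinfun (\<lambda>a. real_part \<Phi> (f o\<^sub>L lmult a))"

context
  fixes \<Phi> assumes \<Phi>: "\<Phi> \<in> bidual S"
begin

lemma slice_apply: "slice \<Phi> f a = real_part \<Phi> (f o\<^sub>L lmult a)"
proof -
  have "bounded_linear (\<lambda>a. f o\<^sub>L lmult a)"
  proof (rule bounded_linear_intro)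
    show "norm (f o\<^sub>L lmult a) \<le> norm a * norm f" for a
      using norm_compose_lmult [of f a] by (simp add: mult.commute)
  qed (auto intro!: blinfun_eqI
      simp: compose_add_left compose_scaleR_left blinfun.add_right blinfun.add_left blinfun.scaleR_right blinfun.scaleR_left)
  then have "bounded_linear (\<lambda>a. real_part \<Phi> (f o\<^sub>L lmult a))"
    by (rule bounded_linear_compose [OF blinfun.bounded_linear_right])
  then show ?thesis by (simp add: slice_def bounded_linear_Blinfun_apply)
qed

lemma complexify_slice: "(\<lambda>a\<in>S. \<Phi> (\<lambda>x\<in>S. complexify S f (a o\<^sub>L x))) = complexify S (slice \<Phi> f)"
proof (rule extensionalityI [where A = S])
  fix a assume a: "a \<in> S"
  have "(f o\<^sub>L lmult a) o\<^sub>L scalar_map \<i> = f o\<^sub>L lmult (op_scaleC \<i> a)"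
    by (rule blinfun_eqI) (simp add: op_scaleC_compose_right in_BH [OF a] op_scaleC_compose_left)
  then show "(\<lambda>a\<in>S. \<Phi> (\<lambda>x\<in>S. complexify S f (a o\<^sub>L x))) a = complexify S (slice \<Phi> f) a"
    using a by (simp add: complexify_lmult bidual_eq_real_part [OF \<Phi>] complexify_apply slice_apply)
qed (simp_all add: complexify_def)

lemma arens_complexify: "arens S \<Psi> \<Phi> (complexify S f) = \<Psi> (complexify S (slice \<Phi> f))"
  by (simp add: arens_def complexify_in_dual complexify_slice)

lemma arens_canon_left:
  assumes b: "b \<in> S"
  shows "arens S (canon S b) \<Phi> (complexify S f) = \<Phi> (complexify S (f o\<^sub>L lmult b))"
proof -
  have "arens S (canon S b) \<Phi> (complexify S f) = complexify S (slice \<Phi> f) b"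
    by (simp add: arens_complexify canon_def complexify_in_dual)
  also have "\<dots> = \<Phi> (complexify S (f o\<^sub>L lmult b))"
    using b by (simp flip: complexify_slice complexify_lmult)
  finally show ?thesis .
qed

end

lemma arens_canon_right:
  assumes b: "b \<in> S"
  shows "arens S \<Phi> (canon S b) (complexify S f) = \<Phi> (complexify S (f o\<^sub>L rmult b))"
proof -
  have "(\<lambda>a\<in>S. canon S b (\<lambda>x\<in>S. complexify S f (a o\<^sub>L x))) = (\<lambda>a\<in>S. complexify S f (a o\<^sub>L b))"
  proof (rule restrict_ext)
    fix a assume a: "a \<in> S"
    have "canon S b (\<lambda>x\<in>S. complexify S f (a o\<^sub>L x)) = (\<lambda>x\<in>S. complexify S f (a o\<^sub>L x)) b"
      unfolding complexify_lmult [OF a] by (simp add: canon_def complexify_in_dual)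
    then show "canon S b (\<lambda>x\<in>S. complexify S f (a o\<^sub>L x)) = complexify S f (a o\<^sub>L b)"
      using b by simp
  qed
  then show ?thesis
    by (simp add: arens_def complexify_in_dual complexify_rmult b)
qed

lemma eq_on_dual:
  assumes "\<Phi> \<in> extensional (dual S)" "\<Psi> \<in> extensional (dual S)"
    and "\<And>f. \<Phi> (complexify S f) = \<Psi> (complexify S f)"
  shows "\<Phi> = \<Psi>"
  using assms(1,2)
proof (rule extensionalityI)
  fix \<psi> assume "\<psi> \<in> dual S"
  then obtain f where "\<psi> = complexify S f" using dual_eq_complexify by blast
  then show "\<Phi> \<psi> = \<Psi> \<psi>" using assms(3) by simp
qed

lemma arens_extensional: "arens S \<Phi> \<Psi> \<in> extensional (dual S)"
  by (simp add: arens_def)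

end

lemma operator_space_BH: "operator_space (BH :: ('h::complex_hilbert_space \<Rightarrow>\<^sub>L 'h) set)"
proof
  fix x y :: "'h \<Rightarrow>\<^sub>L 'h" and c
  assume "x \<in> BH"
  then show "op_scaleC c x \<in> BH" by (simp add: BH_def scaleC_scaleC mult.commute)
  assume "y \<in> BH"
  with \<open>x \<in> BH\<close> show "x + y \<in> BH" by (simp add: BH_def blinfun.add_left scaleC_add_right)
next
  have "c *\<^sub>C (0::'h) = 0" for c
    using norm_scaleC [of c "0::'h"] by simp
  then show "(0 :: 'h \<Rightarrow>\<^sub>L 'h) \<in> BH" by (simp add: BH_def)
qed

locale closed_projection_algebra = unital_operator_algebra S e
  for S :: "('h::complex_hilbert_space \<Rightarrow>\<^sub>L 'h) set" and e +
  fixes q :: "'h bifunctional"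
  assumes closed_q: "closed_projection S q"
begin

definition p where "p = bidual_diff S (canon S e) q"

abbreviation "pp \<equiv> real_part p"

lemma open_p: "open_projection S p"
  using closed_q by (simp add: closed_projection_def p_def identity_of_eq)

lemma p_bidual: "p \<in> bidual S" and p_idempotent: "arens S p p = p"
  and p_selfadjoint: "bidual_star (bidual_incl S p) = bidual_incl S p"
  using open_p by (simp_all add: open_projection_def projection_def)

lemma q_bidual: "q \<in> bidual S"
  using closed_q by (simp add: closed_projection_def projection_def)

lemma real_part_q: "real_part q f = f e - pp f"
proof -
  have "p (complexify S f) = complexify S f e - q (complexify S f)"
    by (simp add: p_def bidual_diff_def canon_def complexify_in_dual)
  then show ?thesis
    by (simp add: real_part_apply p_bidual q_bidual complexify_apply unit_in)
qed

lemma pp_cong: "(\<And>x. x \<in> S \<Longrightarrow> blinfun_apply f x = blinfun_apply g x) \<Longrightarrow> pp f = pp g"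
  by (rule real_part_cong [OF p_bidual])

lemma pp_selfadjoint: "pp (f o\<^sub>L adjoint_map) = pp f"
proof -
  interpret BH: operator_space "BH :: ('h \<Rightarrow>\<^sub>L 'h) set" by (rule operator_space_BH)
  have res: "restrict (complexify BH g) S = complexify S g" for g
    by (rule ext) (simp add: complexify_def restrict_def in_BH)
  have star: "(\<lambda>T\<in>BH. cnj (complexify BH f (op_adj T))) = complexify BH (f o\<^sub>L adjoint_map)"
  proof (rule extensionalityI [where A = BH])
    fix T :: "'h \<Rightarrow>\<^sub>L 'h" assume T: "T \<in> BH"
    have "op_scaleC (- \<i>) (adjoint T) = - op_scaleC \<i> (adjoint T)"
      using op_scaleC_scaleC [of "complex_of_real (- 1)" \<i> "adjoint T"]
      unfolding op_scaleC_of_real by simp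
    then have "f (op_scaleC (- \<i>) (adjoint T)) = - f (op_scaleC \<i> (adjoint T))"
      by (simp only: blinfun.minus_right)
    then show "(\<lambda>T\<in>BH. cnj (complexify BH f (op_adj T))) T = complexify BH (f o\<^sub>L adjoint_map) T"
      using T by (simp add: op_adj_eq_adjoint complexify_def adjoint_in_BH adjoint_op_scaleC complex_eq_iff)
  qed (simp_all add: complexify_def)
  have "bidual_star (bidual_incl S p) (complexify BH f) = cnj (p (complexify S (f o\<^sub>L adjoint_map)))"
    unfolding bidual_star_def bidual_incl_def
    by (simp add: BH.complexify_in_dual star res)
  moreover have "bidual_incl S p (complexify BH f) = p (complexify S f)"
    by (simp add: bidual_incl_def BH.complexify_in_dual res)
  ultimately have "cnj (p (complexify S (f o\<^sub>L adjoint_map))) = p (complexify S f)"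
    by (simp add: p_selfadjoint)
  then show ?thesis
    by (simp add: real_part_apply p_bidual complex_eq_iff)
qed

sublocale bidual_projection pp e
proof
  fix f g :: "('h \<Rightarrow>\<^sub>L 'h) \<Rightarrow>\<^sub>L real"
  show "pp g = pp f" if "\<And>a. blinfun_apply g a = pp (f o\<^sub>L lmult a)"
  proof -
    have "g = slice p f"
      by (rule blinfun_eqI) (simp add: that slice_apply p_bidual)
    then have "p (complexify S g) = p (complexify S f)"
      using arens_complexify [OF p_bidual, of p f] by (simp add: p_idempotent)
    then show ?thesis by (simp add: real_part_apply p_bidual)
  qed
  show "pp (f o\<^sub>L adjoint_map) = pp f" by (rule pp_selfadjoint)
  show "pp (f o\<^sub>L lmult e) = pp f" by (rule pp_cong) (simp add: unit_compose)
  show "pp (f o\<^sub>L rmult e) = pp f" by (rule pp_cong) (simp add: compose_unit)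
  show "e o\<^sub>L e = e" by (rule unit_compose [OF unit_in])
qed (rule norm_unit)

definition J where "J = {z \<in> S. \<forall>f. pp (f o\<^sub>L rmult z) = blinfun_apply f z}"

lemma J_subspace: "subspace J"
proof -
  have "f o\<^sub>L rmult (x + y) = (f o\<^sub>L rmult x) + (f o\<^sub>L rmult y)" "f o\<^sub>L rmult (r *\<^sub>R x) = r *\<^sub>R (f o\<^sub>L rmult x)"
    "f o\<^sub>L rmult 0 = 0"
    for f :: "('h \<Rightarrow>\<^sub>L 'h) \<Rightarrow>\<^sub>L real" and x y r
    by (rule blinfun_eqI; simp add: compose_add_right compose_scaleR_right blinfun.add_right blinfun.add_left
        blinfun.scaleR_right blinfun.scaleR_left blinfun.zero_right)+
  then show ?thesis
    by (simp add: subspace_def J_def zero_in add_in scaleR_in blinfun.add_right blinfun.scaleR_right blinfun.zero_right)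
qed

lemma J_left_fixed: "z \<in> J \<Longrightarrow> left_fixed z"
  by (simp add: J_def left_fixed_def unit_compose compose_unit)

text \<open>Openness of \<open>p\<close>: the net converging to \<open>p\<close> lies in \<open>J\<close>.\<close>

lemma J_annihilator:
  assumes f: "\<And>z. z \<in> J \<Longrightarrow> blinfun_apply f z = 0"
  shows "pp f = 0"
proof -
  obtain F where F: "F \<noteq> bot" "\<forall>\<^sub>F x in F. x \<in> S \<and> arens S p (canon S x) = canon S x"
    "\<And>\<phi>. \<phi> \<in> dual S \<Longrightarrow> ((\<lambda>x. canon S x \<phi>) \<longlongrightarrow> p \<phi>) F"
    using open_p by (auto simp: open_projection_def)
  have in_J: "x \<in> J" if x: "x \<in> S" "arens S p (canon S x) = canon S x" for x
  proof -
    have "pp (g o\<^sub>L rmult x) = g x" for g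
    proof -
      have "p (complexify S (g o\<^sub>L rmult x)) = canon S x (complexify S g)"
        using arens_canon_right [OF x(1), of p g] by (simp add: x(2))
      then show ?thesis
        by (simp add: real_part_apply p_bidual canon_def complexify_in_dual complexify_apply x(1))
    qed
    then show ?thesis by (simp add: J_def x)
  qed
  have "\<forall>\<^sub>F x in F. Re (canon S x (complexify S f)) = 0"
    using F(2)
  proof eventually_elim
    case (elim x)
    then show ?case
      using f [OF in_J] by (simp add: canon_def [of S x] complexify_in_dual complexify_apply)
  qed
  then have "((\<lambda>x. Re (canon S x (complexify S f))) \<longlongrightarrow> 0) F"
    by (rule tendsto_eventually)
  moreover have "((\<lambda>x. Re (canon S x (complexify S f))) \<longlongrightarrow> Re (p (complexify S f))) F"
    by (intro tendsto_Re F complexify_in_dual)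
  ultimately show ?thesis
    using tendsto_unique [OF F(1)] by (simp add: real_part_apply p_bidual)
qed

text \<open>For \<open>x \<in> S\<close> the product \<open>zx\<close> is again in \<open>J\<close>, so \<open>x \<mapsto> f (z x)\<close> vanishes on \<open>S\<close>.\<close>

lemma J_ideal:
  assumes f: "\<And>y. y \<in> J \<Longrightarrow> blinfun_apply f y = 0" and z: "z \<in> J"
  shows "pp (f o\<^sub>L lmult z) = 0"
proof -
  have "z o\<^sub>L x \<in> J" if x: "x \<in> S" for x
  proof -
    have "g o\<^sub>L rmult (z o\<^sub>L x) = (g o\<^sub>L rmult x) o\<^sub>L rmult z" for g :: "('h \<Rightarrow>\<^sub>L 'h) \<Rightarrow>\<^sub>L real"
      by (rule blinfun_eqI) (simp add: compose_assoc)
    then show ?thesis using z x by (simp add: J_def compose_in)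
  qed
  then have "pp (f o\<^sub>L lmult z) = pp 0"
    by (intro pp_cong) (simp add: f)
  then show ?thesis by (simp add: blinfun.zero_right)
qed

lemma arens_left_eqI:
  assumes x: "x \<in> S" and y: "y \<in> S"
    and eq: "\<And>f. blinfun_apply f x - pp (f o\<^sub>L lmult x) = blinfun_apply f y - pp (f o\<^sub>L lmult y)"
  shows "arens S (canon S x) q = arens S (canon S y) q"
proof (rule eq_on_dual [OF arens_extensional arens_extensional])
  fix f
  have "real_part q (f o\<^sub>L lmult x) = real_part q (f o\<^sub>L lmult y)" for f
    using eq by (simp add: real_part_q compose_unit x y)
  then show "arens S (canon S x) q (complexify S f) = arens S (canon S y) q (complexify S f)"
    by (simp add: arens_canon_left [OF q_bidual] x y bidual_eq_real_part [OF q_bidual]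
        compose_lmult_scalar_map in_BH)
qed

lemma arens_right_eqI:
  assumes x: "x \<in> S" and y: "y \<in> S"
    and eq: "\<And>f. blinfun_apply f x - pp (f o\<^sub>L rmult x) = blinfun_apply f y - pp (f o\<^sub>L rmult y)"
  shows "arens S q (canon S x) = arens S q (canon S y)"
proof (rule eq_on_dual [OF arens_extensional arens_extensional])
  fix f
  have "real_part q (f o\<^sub>L rmult x) = real_part q (f o\<^sub>L rmult y)" for f
    using eq by (simp add: real_part_q unit_compose x y)
  then show "arens S q (canon S x) (complexify S f) = arens S q (canon S y) (complexify S f)"
    by (simp add: arens_canon_right x y bidual_eq_real_part [OF q_bidual] compose_rmult_scalar_map)
qed

lemma right_annihilated_iff:
  assumes x: "x \<in> S"
  shows "arens S q (canon S x) = bidual_zero S \<longleftrightarrow> (\<forall>f. pp (f o\<^sub>L rmult x) = blinfun_apply f x)"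
    (is "?lhs \<longleftrightarrow> ?rhs")
proof
  assume ?lhs
  show ?rhs
  proof
    fix f
    have "arens S q (canon S x) (complexify S f) = 0"
      using \<open>?lhs\<close> by (simp add: bidual_zero_def complexify_in_dual)
    then have "real_part q (f o\<^sub>L rmult x) = 0"
      by (simp add: arens_canon_right x real_part_apply q_bidual)
    then show "pp (f o\<^sub>L rmult x) = f x"
      by (simp add: real_part_q unit_compose x)
  qed
next
  assume ?rhs
  have 0: "pp (f o\<^sub>L rmult 0) = f 0" for f
    using subspace_0 [OF J_subspace] by (simp add: J_def)
  have "arens S q (canon S x) = arens S q (canon S 0)"
    using \<open>?rhs\<close> by (intro arens_right_eqI x zero_in) (simp add: 0)
  also have "\<dots> = bidual_zero S"
  proof (rule eq_on_dual [OF arens_extensional])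
    fix f
    have "real_part q (g o\<^sub>L rmult 0) = 0" for g
      by (simp add: real_part_q 0 blinfun.zero_right)
    then show "arens S q (canon S 0) (complexify S f) = bidual_zero S (complexify S f)"
      by (simp add: arens_canon_right zero_in bidual_eq_real_part [OF q_bidual]
          compose_rmult_scalar_map bidual_zero_def complexify_in_dual complex_eq_iff)
  qed (simp add: bidual_zero_def)
  finally show ?lhs .
qed

context
  fixes b assumes b: "b \<in> S"
    and commuting: "arens S (canon S b) q = arens S q (canon S b)"
begin

lemma b_commutes: "commutes b"
  unfolding commutes_def
proof (intro conjI allI)
  show "b o\<^sub>L e = b" by (rule compose_unit [OF b])
  fix f
  have "real_part q (f o\<^sub>L lmult b) = real_part q (f o\<^sub>L rmult b)"
    using fun_cong [OF commuting, of "complexify S f"]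
    by (simp add: arens_canon_left [OF q_bidual] arens_canon_right b real_part_apply q_bidual)
  then show "pp (f o\<^sub>L rmult b) = pp (f o\<^sub>L lmult b)"
    by (simp add: real_part_q unit_compose compose_unit b)
qed

abbreviation "r \<equiv> bidual_norm S (arens S (canon S b) q)"

lemma bq_bdd_above:
  "bdd_above ((\<lambda>\<phi>. cmod (arens S (canon S b) q \<phi>)) ` {\<phi> \<in> dual S. dual_norm S \<phi> \<le> 1})"
proof -
  obtain K where K: "0 \<le> K" "\<And>f. cmod (q (complexify S f)) \<le> K * norm f"
    using bidual_bounded [OF q_bidual] by blast
  show ?thesis
  proof (rule bdd_aboveI2)
    fix \<phi> assume "\<phi> \<in> {\<phi> \<in> dual S. dual_norm S \<phi> \<le> 1}"
    then obtain f where f: "\<phi> = complexify S f" "norm f \<le> 1"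
      using dual_eq_complexify by (metis (no_types, lifting) mem_Collect_eq order_trans)
    have "norm (f o\<^sub>L lmult b) \<le> 1 * norm b"
      using norm_compose_lmult [of f b] mult_right_mono [OF f(2) norm_ge_zero [of b]] by simp
    then show "cmod (arens S (canon S b) q \<phi>) \<le> K * norm b"
      using K(2) [of "f o\<^sub>L lmult b"] mult_left_mono [OF _ K(1), of "norm (f o\<^sub>L lmult b)" "norm b"]
      by (simp add: f arens_canon_left [OF q_bidual] b)
  qed
qed

lemma r_nonneg: "0 \<le> r"
proof -
  have "complexify S 0 \<in> {\<phi> \<in> dual S. dual_norm S \<phi> \<le> 1}"
    using dual_norm_complexify_le [of 0] by (simp add: complexify_in_dual)
  then show ?thesis
    unfolding bidual_norm_def by (rule cSUP_upper2 [OF bq_bdd_above]) simp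
qed

lemma real_bound: "\<bar>blinfun_apply f b - pp (f o\<^sub>L lmult b)\<bar> \<le> r * norm f"
proof -
  define \<phi> where "\<phi> k g = k * (blinfun_apply g b - pp (g o\<^sub>L lmult b))" for k :: real and g
  have "linear (\<phi> k)" for k
    by (rule linearI) (simp_all add: \<phi>_def compose_add_left compose_scaleR_left blinfun.add_left
        blinfun.add_right blinfun.scaleR_left blinfun.scaleR_right algebra_simps)
  moreover have "\<phi> k g \<le> r" if g: "norm g \<le> 1" and k: "\<bar>k\<bar> = 1" for k g
  proof -
    have "\<phi> k g \<le> \<bar>real_part q (g o\<^sub>L lmult b)\<bar>"
      using k by (auto simp: \<phi>_def real_part_q compose_unit b abs_if split: if_splits)
    also have "\<dots> \<le> cmod (q (complexify S (g o\<^sub>L lmult b)))"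
      by (simp add: real_part_apply q_bidual abs_Re_le_cmod)
    also have "\<dots> = cmod (arens S (canon S b) q (complexify S g))"
      by (simp add: arens_canon_left [OF q_bidual] b)
    also have "\<dots> \<le> r"
      unfolding bidual_norm_def
      by (rule cSUP_upper [OF _ bq_bdd_above])
        (use dual_norm_complexify_le [of g] g in \<open>simp add: complexify_in_dual\<close>)
    finally show ?thesis .
  qed
  ultimately have "\<phi> k f \<le> r * norm f" if "\<bar>k\<bar> = 1" for k
    using that by (intro linear_functional_bound) auto
  from this [of 1] this [of "- 1"] show ?thesis by (simp add: \<phi>_def abs_le_iff)
qed

text \<open>Since \<open>qz = 0\<close>, the values of \<open>bq = qb\<close> are those of \<open>q (b - z)\<close>, and left multiplication by \<open>q\<close> is
  contractive.\<close>

lemma r_le_distance: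
  assumes z: "z \<in> S" "arens S q (canon S z) = bidual_zero S"
  shows "r \<le> norm (b - z)"
  unfolding bidual_norm_def
proof (rule cSUP_least)
  show "{\<phi> \<in> dual S. dual_norm S \<phi> \<le> 1} \<noteq> {}"
    using dual_norm_complexify_le [of 0] complexify_in_dual [of 0] by auto
  fix \<phi> assume "\<phi> \<in> {\<phi> \<in> dual S. dual_norm S \<phi> \<le> 1}"
  then obtain f where f: "\<phi> = complexify S f" "norm f \<le> 1"
    using dual_eq_complexify by (metis (no_types, lifting) mem_Collect_eq order_trans)
  let ?w = "q (complexify S (f o\<^sub>L rmult b))"
  obtain c where c: "cmod c = 1" "c * ?w = complex_of_real (cmod ?w)"
    using rotation by blast
  define g where "g = f o\<^sub>L scalar_map c"
  have g: "norm g \<le> 1"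
    using norm_compose_scalar_map [of f c] f(2) c(1) by (simp add: g_def)
  have "c * ?w = q (complexify S (g o\<^sub>L rmult b))"
    unfolding g_def compose_rmult_scalar_map [symmetric] by (rule bidual_scalar_map [OF q_bidual, symmetric])
  then have "cmod ?w = real_part q (g o\<^sub>L rmult b)"
    using c(2) by (simp add: real_part_apply q_bidual) (metis Re_complex_of_real)
  also have "\<dots> = g b - pp (g o\<^sub>L rmult b)"
    by (simp add: real_part_q unit_compose b)
  also have "\<dots> = g (b - z) - pp (g o\<^sub>L rmult (b - z))"
  proof -
    have "g o\<^sub>L rmult (b - z) = (g o\<^sub>L rmult b) - (g o\<^sub>L rmult z)"
      by (rule blinfun_eqI) (simp add: compose_diff_right blinfun.diff_left blinfun.diff_right)
    moreover have "pp (g o\<^sub>L rmult z) = g z"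
      using z right_annihilated_iff by blast
    ultimately show ?thesis by (simp add: blinfun.diff_right)
  qed
  also have "\<dots> \<le> norm (b - z)"
    using norm_complement_le [OF g, of "b - z"] by linarith
  finally show "cmod (arens S (canon S b) q \<phi>) \<le> norm (b - z)"
    by (simp add: f commuting arens_canon_right b)
qed

text \<open>The hypotheses on \<open>A\<close> hold when \<open>A\<close> is a closed ideal of \<open>S\<close> containing \<open>b\<close>. The bound \<open>R\<close> is positive so that \<open>b\<close>
  can be divided by it.\<close>

theorem peak_element:
  assumes R: "0 < R" "r \<le> R"
    and A: "closed A" "A \<subseteq> S" "b \<in> A" "\<And>x y. x \<in> A \<Longrightarrow> y \<in> A \<Longrightarrow> x + y \<in> A"
      "\<And>x. x \<in> S \<Longrightarrow> b o\<^sub>L x \<in> A"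
  obtains g where "g \<in> A" "norm g \<le> R"
    "arens S (canon S g) q = arens S (canon S b) q"
    "arens S q (canon S g) = arens S (canon S b) q"
proof -
  note bS = b
  define b' where "b' = (1 / R) *\<^sub>R b"
  have lm: "f o\<^sub>L lmult b' = (1 / R) *\<^sub>R (f o\<^sub>L lmult b)" and rm: "f o\<^sub>L rmult b' = (1 / R) *\<^sub>R (f o\<^sub>L rmult b)"
    for f :: "('h \<Rightarrow>\<^sub>L 'h) \<Rightarrow>\<^sub>L real"
    by (rule blinfun_eqI; simp add: b'_def compose_scaleR_left compose_scaleR_right blinfun.scaleR_left blinfun.scaleR_right)+
  have bound: "\<bar>blinfun_apply f b' - pp (f o\<^sub>L lmult b')\<bar> \<le> norm f" for f
  proof -
    have "f b' - pp (f o\<^sub>L lmult b') = (f b - pp (f o\<^sub>L lmult b)) / R"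
      unfolding lm by (simp add: b'_def blinfun.scaleR_right diff_divide_distrib)
    moreover have "\<bar>f b - pp (f o\<^sub>L lmult b)\<bar> \<le> R * norm f"
      using real_bound [of f] mult_right_mono [OF R(2), of "norm f"] by simp
    ultimately show ?thesis
      using R by (simp add: abs_divide divide_le_eq mult.commute)
  qed
  have comm: "commutes b'"
    using b_commutes unfolding commutes_def lm rm
    by (simp add: b'_def compose_scaleR_left blinfun.scaleR_right)
  interpret peak_setting pp e J b'
    using J_subspace J_left_fixed J_annihilator J_ideal comm bound by unfold_locales auto
  obtain z where z: "z \<in> closure J" "norm (b' o\<^sub>L (e + z)) \<le> 1"
    "\<And>f. pp (f o\<^sub>L rmult z) = blinfun_apply f z" "\<And>f. pp (f o\<^sub>L lmult z) = blinfun_apply f z"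
    using exact_contraction by blast
  have "(o\<^sub>L) b ` closure J \<subseteq> A"
    by (rule image_closure_subset [OF _ A(1)])
      (use A(5) in \<open>auto intro!: continuous_intros simp: J_def\<close>)
  then have bz: "b o\<^sub>L z \<in> A" using z(1) by blast
  define g where "g = b + (b o\<^sub>L z)"
  have gA: "g \<in> A" unfolding g_def by (rule A(4) [OF A(3) bz])
  then have gS: "g \<in> S" using A(2) by blast
  have "norm (b o\<^sub>L (e + z)) / R \<le> 1"
    using z(2) R by (simp add: b'_def compose_scaleR_left)
  then have norm_g: "norm g \<le> R"
    using R compose_unit [OF bS] by (simp add: g_def compose_add_right divide_le_eq)
  have lmult_g: "f o\<^sub>L lmult g = (f o\<^sub>L lmult b) + ((f o\<^sub>L lmult b) o\<^sub>L lmult z)" for f :: "('h \<Rightarrow>\<^sub>L 'h) \<Rightarrow>\<^sub>L real"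
    by (rule blinfun_eqI) (simp add: g_def compose_add_left compose_assoc blinfun.add_left blinfun.add_right)
  have rmult_g: "f o\<^sub>L rmult g = (f o\<^sub>L rmult b) + ((f o\<^sub>L rmult z) o\<^sub>L rmult b)" for f :: "('h \<Rightarrow>\<^sub>L 'h) \<Rightarrow>\<^sub>L real"
    by (rule blinfun_eqI) (simp add: g_def compose_add_right compose_assoc blinfun.add_left blinfun.add_right)
  have swap: "(f o\<^sub>L rmult z) o\<^sub>L lmult b = (f o\<^sub>L lmult b) o\<^sub>L rmult z" for f :: "('h \<Rightarrow>\<^sub>L 'h) \<Rightarrow>\<^sub>L real"
    by (rule blinfun_eqI) (simp add: compose_assoc)
  have "pp ((f o\<^sub>L rmult z) o\<^sub>L rmult b) = f (b o\<^sub>L z)" for f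
    using b_commutes z(3) by (simp add: commutes_def swap)
  then have "arens S q (canon S g) = arens S q (canon S b)"
    by (intro arens_right_eqI gS bS) (simp add: rmult_g blinfun.add_right, simp add: g_def blinfun.add_right)
  moreover have "arens S (canon S g) q = arens S (canon S b) q"
    by (intro arens_left_eqI gS bS) (simp add: lmult_g blinfun.add_right z(4), simp add: g_def blinfun.add_right)
  ultimately show thesis
    using that [OF gA norm_g] commuting by simp
qed

end

end

text \<open>In the case \<open>S = A\<close> the identity \<open>e\<close> may be a proper projection on the Hilbert space, which is why \<open>e\<close> is
  carried through the whole argument in place of the identity operator.\<close>

lemma operator_algebra_unitization:
  fixes A :: "('h::complex_hilbert_space \<Rightarrow>\<^sub>L 'h) set"
  assumes A: "operator_algebra A"
  obtains e where "unital_operator_algebra (unitization A) e" "A \<subseteq> unitization A"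
    "\<And>a x. a \<in> A \<Longrightarrow> x \<in> unitization A \<Longrightarrow> a o\<^sub>L x \<in> A"
proof (cases "\<exists>e. is_identity A e \<and> norm e = 1")
  case True
  then obtain e where e: "is_identity A e" "norm e = 1" by blast
  have S: "unitization A = A" using True by (simp add: unitization_def)
  show thesis
  proof (rule that [of e])
    show "unital_operator_algebra (unitization A) e"
      unfolding S using A e by unfold_locales (auto simp: operator_algebra_def is_identity_def)
  qed (use A in \<open>auto simp: S operator_algebra_def\<close>)
next
  case False
  let ?S = "{a + op_scaleC c id_blinfun | a c. a \<in> A}"
  have S: "unitization A = ?S" by (simp only: unitization_def if_not_P [OF False])
  have zero: "0 \<in> A" and add: "\<And>x y. x \<in> A \<Longrightarrow> y \<in> A \<Longrightarrow> x + y \<in> A"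
    and scale: "\<And>c x. x \<in> A \<Longrightarrow> op_scaleC c x \<in> A" and mult: "\<And>x y. x \<in> A \<Longrightarrow> y \<in> A \<Longrightarrow> x o\<^sub>L y \<in> A"
    and BH: "\<And>x. x \<in> A \<Longrightarrow> x \<in> BH"
    using A by (auto simp: operator_algebra_def)
  have memS: "a + op_scaleC c id_blinfun \<in> ?S" if "a \<in> A" for a c using that by blast
  interpret BH: operator_space "BH :: ('h \<Rightarrow>\<^sub>L 'h) set" by (rule operator_space_BH)
  have id_BH: "(id_blinfun :: 'h \<Rightarrow>\<^sub>L 'h) \<in> BH" by (simp add: BH_def)
  have id_left: "id_blinfun o\<^sub>L x = x" and id_right: "x o\<^sub>L id_blinfun = x" for x :: "'h \<Rightarrow>\<^sub>L 'h"
    by (rule blinfun_eqI; simp)+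
  have one: "op_scaleC 1 x = x" for x :: "'h \<Rightarrow>\<^sub>L 'h"
    using op_scaleC_of_real [of 1 x] by simp
  have zero_scale: "op_scaleC 0 x = 0" for x :: "'h \<Rightarrow>\<^sub>L 'h"
    using op_scaleC_of_real [of 0 x] by simp
  show thesis
  proof (rule that [of id_blinfun])
    show "A \<subseteq> unitization A"
      unfolding S using memS [of _ 0] by (auto simp: zero_scale)
    show "a o\<^sub>L x \<in> A" if a: "a \<in> A" and x: "x \<in> unitization A" for a x
    proof -
      obtain y c where y: "x = y + op_scaleC c id_blinfun" "y \<in> A" using x S by blast
      have "a o\<^sub>L x = (a o\<^sub>L y) + op_scaleC c a"
        by (simp add: y(1) compose_add_right op_scaleC_compose_right BH a id_right)
      then show ?thesis using add [OF mult [OF a y(2)] scale [OF a, of c]] by simp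
    qed
    show "unital_operator_algebra (unitization A) id_blinfun"
      unfolding S
    proof unfold_locales
      show "0 \<in> ?S" using memS [OF zero, of 0] by (simp add: zero_scale)
      show "id_blinfun \<in> ?S" using memS [OF zero, of 1] by (simp add: one)
      show "norm (id_blinfun :: 'h \<Rightarrow>\<^sub>L 'h) \<le> 1" by (rule norm_blinfun_bound) simp_all
      fix x y assume x: "x \<in> ?S"
      then obtain a c where a: "x = a + op_scaleC c id_blinfun" "a \<in> A" by blast
      show "op_scaleC d x \<in> ?S" for d
        using memS [OF scale [OF a(2), of d], of "d * c"] by (simp add: a(1) op_scaleC_add_right op_scaleC_scaleC)
      show "x \<in> BH"
        unfolding a(1) by (intro BH.add_in BH.scaleC_in id_BH BH a(2))
      show "id_blinfun o\<^sub>L x = x" by (rule id_left)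
      show "x o\<^sub>L id_blinfun = x" by (rule id_right)
      assume "y \<in> ?S"
      then obtain a' c' where a': "y = a' + op_scaleC c' id_blinfun" "a' \<in> A" by blast
      have "x + y = (a + a') + op_scaleC (c + c') id_blinfun"
        by (simp add: a(1) a'(1) op_scaleC_add_left add_ac)
      then show "x + y \<in> ?S"
        using memS [OF add [OF a(2) a'(2)], of "c + c'"] by simp
      have "x o\<^sub>L y = ((a o\<^sub>L a') + op_scaleC c' a + op_scaleC c a') + op_scaleC (c * c') id_blinfun"
        by (simp add: a(1) a'(1) compose_add_left compose_add_right op_scaleC_compose_left
            op_scaleC_compose_right BH a(2) id_left id_right op_scaleC_add_right op_scaleC_scaleC add_ac id_BH)
      then show "x o\<^sub>L y \<in> ?S"
        using memS [OF add [OF add [OF mult [OF a(2) a'(2)] scale [OF a(2), of c']] scale [OF a'(2), of c]], of "c * c'"]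
        by simp
    qed
  qed
qed

theorem theorem5p1:
  fixes A :: "('h :: complex_hilbert_space \<Rightarrow>\<^sub>L 'h) set"
    and q :: "'h bifunctional"
    and b :: "'h \<Rightarrow>\<^sub>L 'h"
  assumes "operator_algebra A"
    and "closed_projection (unitization A) q"
    and "b \<in> A"
    and "arens (unitization A) (canon (unitization A) b) q
       = arens (unitization A) q (canon (unitization A) b)"
  shows "(\<exists>y\<in>right_ideal A q. norm (b - y) = (INF z\<in>right_ideal A q. norm (b - z))) \<and>
    (bidual_norm (unitization A) (arens (unitization A) (canon (unitization A) b) q) \<le> 1 \<longrightarrow>
      (\<exists>g\<in>A. norm g \<le> 1 \<and>
        arens (unitization A) (canon (unitization A) g) q
          = arens (unitization A) (canon (unitization A) b) q \<and>
        arens (unitization A) q (canon (unitization A) g)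
          = arens (unitization A) (canon (unitization A) b) q))"
proof -
  let ?S = "unitization A"
  obtain e where S: "unital_operator_algebra ?S e" "A \<subseteq> ?S" "\<And>a x. a \<in> A \<Longrightarrow> x \<in> ?S \<Longrightarrow> a o\<^sub>L x \<in> A"
    using operator_algebra_unitization [OF assms(1)] by metis
  interpret closed_projection_algebra ?S e q
    using S(1) assms(2) by (simp add: closed_projection_algebra_def closed_projection_algebra_axioms_def)
  have b: "b \<in> ?S" using S(2) assms(3) by blast
  have A: "closed A" "\<And>x y. x \<in> A \<Longrightarrow> y \<in> A \<Longrightarrow> x + y \<in> A" "\<And>x. x \<in> A \<Longrightarrow> - x \<in> A"
  proof -
    show "closed A" "\<And>x y. x \<in> A \<Longrightarrow> y \<in> A \<Longrightarrow> x + y \<in> A"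
      using assms(1) by (auto simp: operator_algebra_def)
    fix x assume "x \<in> A"
    then have "op_scaleC (complex_of_real (- 1)) x \<in> A"
      using assms(1) unfolding operator_algebra_def by blast
    then show "- x \<in> A" by (simp only: op_scaleC_of_real) simp
  qed
  have peak: "\<exists>g\<in>A. norm g \<le> R \<and> arens ?S (canon ?S g) q = arens ?S (canon ?S b) q \<and>
      arens ?S q (canon ?S g) = arens ?S (canon ?S b) q"
    if "0 < R" "bidual_norm ?S (arens ?S (canon ?S b) q) \<le> R" for R
    using peak_element [OF b assms(4) that A(1) S(2) assms(3) A(2) S(3) [OF assms(3)]] by metis
  have ideal: "y \<in> right_ideal A q \<longleftrightarrow> y \<in> A \<and> (\<forall>f. pp (f o\<^sub>L rmult y) = blinfun_apply f y)" for y
    using right_annihilated_iff [of y] S(2) by (auto simp: right_ideal_def)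
  define r where "r = bidual_norm ?S (arens ?S (canon ?S b) q)"
  have r_le: "r \<le> norm (b - z)" if "z \<in> right_ideal A q" for z
    using that r_le_distance [OF b assms(4)] S(2) by (auto simp: right_ideal_def r_def)
  have "\<exists>y\<in>right_ideal A q. norm (b - y) \<le> r"
  proof (cases "r = 0")
    case True
    have "pp (f o\<^sub>L rmult b) = f b" for f
      using real_bound [OF b assms(4), of f] b_commutes [OF b assms(4)] True
      by (simp add: r_def commutes_def)
    then have "b \<in> right_ideal A q" using assms(3) by (simp add: ideal)
    then show ?thesis using True by force
  next
    case False
    then have "0 < r" using r_nonneg [OF b assms(4)] by (simp add: r_def)
    then obtain g where g: "g \<in> A" "norm g \<le> r" "arens ?S q (canon ?S g) = arens ?S (canon ?S b) q"
      using peak [of r] by (auto simp: r_def)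
    have "pp (f o\<^sub>L rmult (b - g)) = f (b - g)" for f
    proof -
      have "real_part q (f o\<^sub>L rmult g) = real_part q (f o\<^sub>L rmult b)"
        using fun_cong [OF g(3), of "complexify ?S f"] S(2) g(1) b
        by (simp add: assms(4) arens_canon_right real_part_apply q_bidual subsetD)
      then have "f g - pp (f o\<^sub>L rmult g) = f b - pp (f o\<^sub>L rmult b)"
        using S(2) g(1) b by (simp add: real_part_q unit_compose subsetD)
      moreover have "f o\<^sub>L rmult (b - g) = (f o\<^sub>L rmult b) - (f o\<^sub>L rmult g)"
        by (rule blinfun_eqI) (simp add: compose_diff_right blinfun.diff_left blinfun.diff_right)
      ultimately show ?thesis by (simp add: blinfun.diff_right)
    qed
    moreover have "b - g \<in> A" using A(2) [OF assms(3) A(3) [OF g(1)]] by simp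
    ultimately have "b - g \<in> right_ideal A q" by (simp add: ideal)
    then show ?thesis using g(2) by (intro bexI [of _ "b - g"]) auto
  qed
  then obtain y where y: "y \<in> right_ideal A q" "norm (b - y) \<le> r" by blast
  have "norm (b - y) = (INF z\<in>right_ideal A q. norm (b - z))"
  proof (rule antisym)
    show "norm (b - y) \<le> (INF z\<in>right_ideal A q. norm (b - z))"
      using y r_le by (intro cINF_greatest) (auto intro: order_trans)
    show "(INF z\<in>right_ideal A q. norm (b - z)) \<le> norm (b - y)"
      by (rule cINF_lower [OF _ y(1)]) (auto intro: bdd_belowI2 [where m = 0])
  qed
  with y(1) show ?thesis using peak [of 1] by auto
qed

end
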